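(* i) Let $M$ be a $7$-manifold with a $G_2$-structure defined by $\phi\in\Omega^3_+(M)$ and let $g_\phi$ be the associated Riemannian metric on $M$. Then $\phi$ is conformal-Killing with respect to $g_\phi$ if and only if the $G_2$-structure is nearly parallel. ii) Let $M$ be an $8$-manifold with a $\mathrm{Spin}_7$-structure defined by $\psi\in\Omega^4_+(M)$ and let $g_\psi$ be the associated Riemannian metric on $M$. Then $\psi$ is conformal-Killing with respect to $g_\psi$ if and only if the $\mathrm{Spin}_7$-structure is parallel.
   Context: Notation: $e^{i_1\cdots i_k}:=e^{i_1}\wedge\cdots\wedge e^{i_k}$. Vectors and covectors on a Riemannian manifold are identified by the metric. Conformal-Killing forms: let $(M^m,g)$ be a Riemannian manifold with Levi-Civita connection $\nabla$, and let $\delta$ be the codifferential (locally $\delta\omega=-\sum_k i_{e_k}\nabla_{e_k}\omega$ for a local orthonormal frame $\{e_k\}$ of $TM$). A $p$-form $\omega\in\Omega^p(M)$, $1\le p\le m$, is conformal-Killing with respect to $g$ if $$\nabla_X\omega=\frac{1}{p+1}\,i_Xd\omega-\frac{1}{m-p+1}\,X\wedge\delta\omega,\qquad\forall X\in TM.$$ $G_2$-structures: let $V=\mathbb{R}^7$ with standard basis $\{e_1,\dots,e_7\}$ and dual basis $\{e^1,\dots,e^7\}$, and $$\phi_0=e^{123}+e^{145}+e^{167}+e^{246}-e^{257}-e^{347}-e^{356}.$$ The group $G_2<GL(V)$ is the stabilizer of $\phi_0$; it preserves the standard metric and orientation, for which $\{e^1,\dots,e^7\}$ is orthonormal and positively oriented.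 A $G_2$-structure on a $7$-manifold $M$ is defined by a form $\phi\in\Omega^3_+(M)$, i.e. a smooth $3$-form such that at every $p\in M$ there is a linear isomorphism $f_p:T_pM\to V$ with $f_p^*(\phi_0)=\phi_p$. The associated metric $g_\phi$ and orientation on $M$ are those for which every such $f_p$ is an orientation-preserving isometry; $*_\phi$ is the associated Hodge star operator and $\nabla$ the Levi-Civita connection of $g_\phi$. The $G_2$-structure is called nearly parallel if $\nabla\phi$, viewed as a section of $T^*M\otimes\Lambda^3(M)$, is a section of the line sub-bundle $\mathbb{R}_\phi(M)$ generated by $\sum_{k=1}^7 e^k\otimes *_\phi(e^k\wedge\phi)$, where $\{e^1,\dots,e^7\}$ is any local orthonormal frame of $T^*M$ (this generator does not depend on the choice of frame). The case $\nabla\phi=0$ is included. $\mathrm{Spin}_7$-structures: let $V_+=\mathbb{R}e_0\oplus V=\mathbb{R}^8$ with basis $\{e_0,\dots,e_7\}$ and dual basis $\{e^0,\dots,e^7\}$, and $$\psi_0=e^{0123}+e^{0145}+e^{0167}+e^{0246}-e^{0257}-e^{0347}-e^{0356}+e^{4567}+e^{2367}+e^{2345}+e^{1357}-e^{1346}-e^{1256}-e^{1247}.$$ The group $\mathrm{Spin}_7<GL(V_+)$ is the stabilizer of $\psi_0$; it preserves the standard metric and orientation, for which $\{e^0,\dots,e^7\}$ is orthonormal and positively oriented. A $\mathrm{Spin}_7$-structure on an $8$-manifold $M$ is defined by a form $\psi\in\Omega^4_+(M)$, i.e. a smooth $4$-form such that at every $p\in M$ there is a linear isomorphism $f_p:T_pM\to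 V_+$ with $f_p^*(\psi_0)=\psi_p$. The associated metric $g_\psi$ is the one for which every such $f_p$ is an isometry. The $\mathrm{Spin}_7$-structure is called parallel if $\nabla\psi=0$, where $\nabla$ is the Levi-Civita connection of $g_\psi$. *)

theory Defs
  imports "HOL-Analysis.Analysis" "HOL-Library.Numeral_Type"
begin

text \<open>To be used on open sets only.\<close>

primrec Ck_on :: "nat \<Rightarrow> 'a::euclidean_space set \<Rightarrow> ('a \<Rightarrow> 'b::real_normed_vector) \<Rightarrow> bool" where
  "Ck_on 0 S f \<longleftrightarrow> continuous_on S f"
| "Ck_on (Suc k) S f \<longleftrightarrow>
     (\<forall>x\<in>S. f differentiable (at x)) \<and>
     (\<forall>v. Ck_on k S (\<lambda>x. frechet_derivative f (at x) v))"

definition smooth_on :: "'a::euclidean_space set \<Rightarrow> ('a \<Rightarrow> 'b::real_normed_vector) \<Rightarrow> bool" where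
  "smooth_on S f \<longleftrightarrow> (\<forall>k. Ck_on k S f)"

text \<open>A chart is a pair of a domain and a coordinate map; the values of the coordinate map
  outside the domain are irrelevant.\<close>

type_synonym ('a, 'n) chart = "'a set \<times> ('a \<Rightarrow> real^'n)"

definition chart_inv :: "('a, 'n::finite) chart \<Rightarrow> real^'n \<Rightarrow> 'a" where
  "chart_inv c = inv_into (fst c) (snd c)"

definition points :: "('a, 'n::finite) chart set \<Rightarrow> 'a set" where
  "points A = (\<Union>c\<in>A. fst c)"

definition smooth_manifold :: "'a topology \<Rightarrow> ('a, 'n::finite) chart set \<Rightarrow> bool" where
  "smooth_manifold X A \<longleftrightarrow>
     Hausdorff_space X \<and> second_countable X \<and> points A = topspace X \<and>
     (\<forall>c\<in>A. openin X (fst c) \<and> open (snd c ` fst c) \<and>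
        homeomorphic_map (subtopology X (fst c)) (top_of_set (snd c ` fst c)) (snd c)) \<and>
     (\<forall>c\<in>A. \<forall>c'\<in>A. smooth_on (snd c ` (fst c \<inter> fst c')) (snd c' \<circ> chart_inv c))"

text \<open>A preferred chart is chosen around every point, and the tangent space at \<open>p\<close> is the type
  \<open>real^'n\<close>, a vector being represented by its components in the preferred chart
  at \<open>p\<close>. The map \<open>to_tangent A c q\<close> turns the components of a tangent vector at \<open>q\<close> in
  an arbitrary chart \<open>c\<close> into the vector itself, i.e. into its components in the preferred chart at
  \<open>q\<close>; for the preferred chart it is the identity.\<close>

definition chart_at :: "('a, 'n::finite) chart set \<Rightarrow> 'a \<Rightarrow> ('a, 'n) chart" where
  "chart_at A p = (SOME c. c \<in> A \<and> p \<in> fst c)"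

definition to_tangent :: "('a, 'n::finite) chart set \<Rightarrow> ('a, 'n) chart \<Rightarrow> 'a \<Rightarrow> real^'n \<Rightarrow> real^'n" where
  "to_tangent A c q = frechet_derivative (snd (chart_at A q) \<circ> chart_inv c) (at (snd c q))"

text \<open>A \<open>k\<close>-form on a vector space is a real function of lists of vectors, of which only
  the values on lists of length \<open>k\<close> matter.\<close>

type_synonym 'n form = "(real^'n) list \<Rightarrow> real"

definition alternating_form :: "nat \<Rightarrow> ('n::finite) form \<Rightarrow> bool" where
  "alternating_form k \<alpha> \<longleftrightarrow>
     (\<forall>vs i. length vs = k \<and> i < k \<longrightarrow> linear (\<lambda>u. \<alpha> (vs[i := u]))) \<and>
     (\<forall>vs i j. length vs = k \<and> i < j \<and> j < k \<and> vs ! i = vs ! j \<longrightarrow> \<alpha> vs = 0)"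

definition omit :: "nat \<Rightarrow> 'b list \<Rightarrow> 'b list" where
  "omit i vs = take i vs @ drop (Suc i) vs"

text \<open>The wedge product \<open>\<xi> \<and> \<alpha>\<close> of a covector and a form, normalised so that
  \<open>e\<^sup>1 \<and> \<dots> \<and> e\<^sup>k\<close> takes the value \<open>1\<close> on \<open>(e\<^sub>1, \<dots>, e\<^sub>k)\<close>.\<close>

definition covector_wedge :: "(real^'n \<Rightarrow> real) \<Rightarrow> ('n::finite) form \<Rightarrow> 'n form" where
  "covector_wedge \<xi> \<alpha> = (\<lambda>vs. \<Sum>i<length vs. (-1)^i * \<xi> (vs ! i) * \<alpha> (omit i vs))"

definition contract :: "real^'n \<Rightarrow> ('n::finite) form \<Rightarrow> 'n form" where
  "contract X \<alpha> = (\<lambda>vs. \<alpha> (X # vs))"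

text \<open>\<open>basis_form [i\<^sub>1, \<dots>, i\<^sub>k]\<close> is \<open>e\<^sup>i\<^sup>1 \<and> \<dots> \<and> e\<^sup>i\<^sup>k\<close> for the dual standard basis.\<close>

primrec basis_form :: "'n::finite list \<Rightarrow> 'n form" where
  "basis_form [] = (\<lambda>vs. 1)"
| "basis_form (i # is) = covector_wedge (\<lambda>v. v $ i) (basis_form is)"

definition orthonormal_basis :: "(real^'n \<Rightarrow> real^'n \<Rightarrow> real) \<Rightarrow> ('n::finite \<Rightarrow> real^'n) \<Rightarrow> bool" where
  "orthonormal_basis g e \<longleftrightarrow> (\<forall>i j. g (e i) (e j) = (if i = j then 1 else 0))"

text \<open>An arbitrary orthonormal basis; it is only used in expressions that do not depend on the
  choice.\<close>

definition some_basis :: "(real^'n \<Rightarrow> real^'n \<Rightarrow> real) \<Rightarrow> ('n::finite \<Rightarrow> real^'n)" where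
  "some_basis g = (SOME e. orthonormal_basis g e)"

text \<open>The Hodge star of a \<open>k\<close>-form with respect to an inner product and a volume form:
  \<open>*\<alpha> = (1/k!) \<Sum> \<alpha>(e\<^sub>i\<^sub>1, \<dots>, e\<^sub>i\<^sub>k) vol(e\<^sub>i\<^sub>1, \<dots>, e\<^sub>i\<^sub>k, \<dots>)\<close>, the sum being over all
  multi-indices of length \<open>k\<close>. In this normalisation \<open>\<alpha> \<and> *\<beta> = \<langle>\<alpha>, \<beta>\<rangle> vol\<close>, and
  \<open>*(e\<^sup>1 \<and> \<dots> \<and> e\<^sup>k) = e\<^sup>k\<^sup>+\<^sup>1 \<and> \<dots> \<and> e\<^sup>n\<close> for a positively oriented orthonormal basis.\<close>

definition hodge_star ::
  "(real^'n \<Rightarrow> real^'n \<Rightarrow> real) \<Rightarrow> ('n::finite) form \<Rightarrow> nat \<Rightarrow> 'n form \<Rightarrow> 'n form" where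
  "hodge_star g vol k \<alpha> =
     (\<lambda>vs. (\<Sum>is\<in>{is. length is = k}.
        \<alpha> (map (some_basis g) is) * vol (map (some_basis g) is @ vs)) / fact k)"

definition local_ext_deriv :: "(real^'n \<Rightarrow> ('n::finite) form) \<Rightarrow> real^'n \<Rightarrow> 'n form" where
  "local_ext_deriv \<omega> x =
     (\<lambda>vs. \<Sum>i<length vs. (-1)^i * frechet_derivative (\<lambda>y. \<omega> y (omit i vs)) (at x) (vs ! i))"

text \<open>The Levi-Civita connection is written \<open>\<nabla>\<^sub>u V = D\<^sub>u V + \<Gamma> u V\<close>; it is the torsion-free
  connection for which the metric is parallel.\<close>

definition levi_civita_at ::
  "(real^'n \<Rightarrow> real^'n \<Rightarrow> real^'n \<Rightarrow> real) \<Rightarrow> real^'n \<Rightarrow> (real^'n \<Rightarrow> real^'n \<Rightarrow> real^'n::finite) \<Rightarrow> bool" where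
  "levi_civita_at g x \<Gamma> \<longleftrightarrow>
     bilinear \<Gamma> \<and> (\<forall>u v. \<Gamma> u v = \<Gamma> v u) \<and>
     (\<forall>u v w. frechet_derivative (\<lambda>y. g y v w) (at x) u = g x (\<Gamma> u v) w + g x v (\<Gamma> u w))"

definition christoffel ::
  "(real^'n \<Rightarrow> real^'n \<Rightarrow> real^'n \<Rightarrow> real) \<Rightarrow> real^'n \<Rightarrow> real^'n \<Rightarrow> real^'n \<Rightarrow> real^'n::finite" where
  "christoffel g x = (THE \<Gamma>. levi_civita_at g x \<Gamma>)"

text \<open>The fundamental lemma of Riemannian geometry: the description above determines the
  Christoffel symbols of every differentiable metric.\<close>

lemma levi_civita_at_unique_exists:
  fixes g :: "real^'n \<Rightarrow> real^'n \<Rightarrow> real^'n \<Rightarrow> real"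
  assumes U: "open U" "x \<in> U"
    and bil: "\<And>y. y \<in> U \<Longrightarrow> bilinear (g y)"
    and sym: "\<And>y u v. y \<in> U \<Longrightarrow> g y u v = g y v u"
    and pos: "\<And>u. u \<noteq> 0 \<Longrightarrow> g x u u > 0"
    and diff: "\<And>u v. (\<lambda>y. g y u v) differentiable (at x)"
  shows "\<exists>!\<Gamma>. levi_civita_at g x \<Gamma>"
proof -
  define D where "D u v w = frechet_derivative (\<lambda>y. g y v w) (at x) u" for u v w
  have Dd: "((\<lambda>y. g y v w) has_derivative (\<lambda>u. D u v w)) (at x)" for v w
    using diff[of v w] unfolding D_def frechet_derivative_works by simp
  have Deq: "D u v w = f' u" if f': "((\<lambda>y. f y) has_derivative f') (at x)"
      and eq: "\<And>y. y \<in> U \<Longrightarrow> f y = g y v w" for u v w f f'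
  proof -
    have "((\<lambda>y. g y v w) has_derivative f') (at x)"
      using has_derivative_transform_within_open[OF f' U] eq by auto
    with Dd[of v w] show ?thesis by (metis has_derivative_unique)
  qed
  have D1: "D (u + u') v w = D u v w + D u' v w" "D (r *\<^sub>R u) v w = r * D u v w" for u u' v w r
    using linear_add[OF has_derivative_linear[OF Dd[of v w]]]
      linear_scale[OF has_derivative_linear[OF Dd[of v w]]] by auto
  have Dsym: "D u v w = D u w v" for u v w
    by (rule Deq[OF Dd]) (use sym in auto)
  have D2: "D u (v + v') w = D u v w + D u v' w" for u v v' w
    by (rule Deq[OF has_derivative_add[OF Dd Dd]]) (use bilinear_ladd[OF bil] in auto)
  have D2': "D u (r *\<^sub>R v) w = r * D u v w" for u v w r
    by (rule Deq[OF has_derivative_mult_right[OF Dd]]) (use bilinear_lmul[OF bil] in auto)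
  have D3: "D u v (w + w') = D u v w + D u v w'" for u v w w'
    using D2 Dsym by metis
  have D3': "D u v (r *\<^sub>R w) = r * D u v w" for u v w r
    using D2' Dsym by metis
  have bx: "bilinear (g x)" using bil U by auto
  note gl = bilinear_ladd[OF bx] bilinear_lmul[OF bx] bilinear_radd[OF bx] bilinear_rmul[OF bx]
    bilinear_lsub[OF bx]
  have inj: "u = v" if "\<And>w. g x u w = g x v w" for u v
  proof (rule ccontr)
    assume "u \<noteq> v"
    then have "g x (u - v) (u - v) > 0" using pos by simp
    moreover have "g x (u - v) (u - v) = 0" using that[of "u - v"] by (simp add: gl)
    ultimately show False by simp
  qed
  define F where "F u = (\<chi> i. g x u (axis i 1))" for u
  have linF: "linear F"
    unfolding F_def by (rule linearI) (auto simp: vec_eq_iff gl)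
  have ext: "f = h" if "linear f" "linear h" "\<And>i. f (axis i 1) = h (axis i 1)"
    for f h :: "real^'n \<Rightarrow> real"
    using that by (intro linear_eq_stdbasis) (auto simp: Basis_vec_def)
  have lin2: "linear (g x u)" for u using bx by (simp add: bilinear_def)
  have "inj F"
  proof (rule injI)
    fix u v assume "F u = F v"
    then have "g x u = g x v"
      by (intro ext lin2) (simp add: F_def vec_eq_iff)
    then show "u = v" by (intro inj) simp
  qed
  then have "surj F" using linF linear_injective_imp_surjective by blast
  have riesz: "\<exists>u. \<forall>w. g x u w = l w" if "linear l" for l
  proof -
    obtain u where u: "F u = (\<chi> i. l (axis i 1))" using \<open>surj F\<close> by (metis surjD)
    have "g x u = l" using u by (intro ext lin2 that) (simp add: F_def vec_eq_iff)
    then show ?thesis by auto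
  qed
  define K where "K u v w = (D u v w + D v u w - D w u v) / 2" for u v w
  have "linear (K u v)" for u v
    by (rule linearI) (auto simp: K_def D1 D3 D3' field_simps)
  then have "\<forall>u v. \<exists>z. \<forall>w. g x z w = K u v w" using riesz by blast
  then obtain G where G: "\<And>u v w. g x (G u v) w = K u v w" by metis
  have G': "g x v (G u w) = K u w v" for u v w using G sym U by metis
  have "levi_civita_at g x G"
    unfolding levi_civita_at_def bilinear_def
  proof (intro conjI allI)
    show "linear (G u)" for u
      by (rule linearI; rule inj) (auto simp: gl G K_def D1 D2 D2' D3 D3' field_simps)
    show "linear (\<lambda>u. G u v)" for v
      by (rule linearI; rule inj) (auto simp: gl G K_def D1 D2 D2' D3 D3' field_simps)
    show "G u v = G v u" for u v
      by (rule inj) (use Dsym in \<open>auto simp: G K_def\<close>)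
    show "frechet_derivative (\<lambda>y. g y v w) (at x) u = g x (G u v) w + g x v (G u w)" for u v w
      using Dsym[of u v w] Dsym[of v u w] Dsym[of w u v]
      by (simp add: G G' K_def flip: D_def) (simp add: field_simps)
  qed
  moreover have "H = G" if H: "levi_civita_at g x H" for H
  proof -
    have m: "D a b c = g x (H a b) c + g x (H a c) b" for a b c
      using H sym U unfolding levi_civita_at_def D_def by metis
    have s: "H a b = H b a" for a b using H unfolding levi_civita_at_def by blast
    have "g x (H u v) w = g x (G u v) w" for u v w
      using m[of u v w] m[of v u w] m[of w u v] s[of u v] s[of u w] s[of v w]
      by (simp add: G K_def)
    then have "H u v = G u v" for u v by (rule inj)
    then show ?thesis by blast
  qed
  ultimately show ?thesis by blast
qed

definition local_nabla ::
  "(real^'n \<Rightarrow> real^'n \<Rightarrow> real^'n \<Rightarrow> real) \<Rightarrow> (real^'n \<Rightarrow> 'n form) \<Rightarrow> real^'n \<Rightarrow> real^'n \<Rightarrow> ('n::finite) form" where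
  "local_nabla g \<omega> x u =
     (\<lambda>vs. frechet_derivative (\<lambda>y. \<omega> y vs) (at x) u
        - (\<Sum>i<length vs. \<omega> x (vs[i := christoffel g x u (vs ! i)])))"

text \<open>Forms and metrics on a manifold are families of forms and inner products on the tangent
  spaces. Differentiation is performed on their expressions in charts: the result at a point is
  computed in the preferred chart there, whose components are the ones used for the tangent
  space. Since the operations are natural, any other chart would yield the same tensor.\<close>

definition chart_form ::
  "('a, 'n::finite) chart set \<Rightarrow> ('a, 'n) chart \<Rightarrow> ('a \<Rightarrow> 'n form) \<Rightarrow> real^'n \<Rightarrow> 'n form" where
  "chart_form A c \<omega> x =
     (\<lambda>vs. \<omega> (chart_inv c x) (map (to_tangent A c (chart_inv c x)) vs))"

definition chart_metric ::
  "('a, 'n::finite) chart set \<Rightarrow> ('a, 'n) chart \<Rightarrow> ('a \<Rightarrow> real^'n \<Rightarrow> real^'n \<Rightarrow> real) \<Rightarrow>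
     real^'n \<Rightarrow> real^'n \<Rightarrow> real^'n \<Rightarrow> real" where
  "chart_metric A c g x u v =
     g (chart_inv c x) (to_tangent A c (chart_inv c x) u) (to_tangent A c (chart_inv c x) v)"

definition smooth_form :: "('a, 'n::finite) chart set \<Rightarrow> nat \<Rightarrow> ('a \<Rightarrow> 'n form) \<Rightarrow> bool" where
  "smooth_form A k \<omega> \<longleftrightarrow>
     (\<forall>p\<in>points A. alternating_form k (\<omega> p)) \<and>
     (\<forall>c\<in>A. \<forall>vs. length vs = k \<longrightarrow> smooth_on (snd c ` fst c) (\<lambda>x. chart_form A c \<omega> x vs))"

definition ext_deriv :: "('a, 'n::finite) chart set \<Rightarrow> ('a \<Rightarrow> 'n form) \<Rightarrow> 'a \<Rightarrow> 'n form" where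
  "ext_deriv A \<omega> p =
     (let c = chart_at A p in local_ext_deriv (chart_form A c \<omega>) (snd c p))"

definition nabla ::
  "('a, 'n::finite) chart set \<Rightarrow> ('a \<Rightarrow> real^'n \<Rightarrow> real^'n \<Rightarrow> real) \<Rightarrow> ('a \<Rightarrow> 'n form) \<Rightarrow>
     'a \<Rightarrow> real^'n \<Rightarrow> 'n form" where
  "nabla A g \<omega> p X =
     (let c = chart_at A p in local_nabla (chart_metric A c g) (chart_form A c \<omega>) (snd c p) X)"

definition codifferential ::
  "('a, 'n::finite) chart set \<Rightarrow> ('a \<Rightarrow> real^'n \<Rightarrow> real^'n \<Rightarrow> real) \<Rightarrow> ('a \<Rightarrow> 'n form) \<Rightarrow>
     'a \<Rightarrow> 'n form" where
  "codifferential A g \<omega> p =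
     (\<lambda>vs. - (\<Sum>k\<in>UNIV. let e = some_basis (g p) k in contract e (nabla A g \<omega> p e) vs))"

definition conformal_killing ::
  "('a, 'n::finite) chart set \<Rightarrow> ('a \<Rightarrow> real^'n \<Rightarrow> real^'n \<Rightarrow> real) \<Rightarrow> nat \<Rightarrow> ('a \<Rightarrow> 'n form) \<Rightarrow> bool" where
  "conformal_killing A g k \<omega> \<longleftrightarrow>
     (\<forall>p\<in>points A. \<forall>X vs. length vs = k \<longrightarrow>
        nabla A g \<omega> p X vs =
          1 / (real k + 1) * contract X (ext_deriv A \<omega> p) vs
          - 1 / (real CARD('n) - real k + 1)
            * covector_wedge (g p X) (codifferential A g \<omega> p) vs)"

definition adapted :: "nat \<Rightarrow> ('n::finite) form \<Rightarrow> 'n form \<Rightarrow> (real^'n \<Rightarrow> real^'n) \<Rightarrow> bool" where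
  "adapted k \<alpha>\<^sub>0 \<alpha> f \<longleftrightarrow>
     linear f \<and> bij f \<and> (\<forall>vs. length vs = k \<longrightarrow> \<alpha>\<^sub>0 (map f vs) = \<alpha> vs)"

definition modelled_on ::
  "('a, 'n::finite) chart set \<Rightarrow> nat \<Rightarrow> 'n form \<Rightarrow> ('a \<Rightarrow> 'n form) \<Rightarrow> bool" where
  "modelled_on A k \<alpha>\<^sub>0 \<omega> \<longleftrightarrow>
     smooth_form A k \<omega> \<and> (\<forall>p\<in>points A. \<exists>f. adapted k \<alpha>\<^sub>0 (\<omega> p) f)"

text \<open>The metric for which all adapted isomorphisms are isometries.\<close>

definition assoc_metric ::
  "nat \<Rightarrow> ('n::finite) form \<Rightarrow> ('a \<Rightarrow> 'n form) \<Rightarrow> 'a \<Rightarrow> real^'n \<Rightarrow> real^'n \<Rightarrow> real" where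
  "assoc_metric k \<alpha>\<^sub>0 \<omega> p u v = (THE r. \<forall>f. adapted k \<alpha>\<^sub>0 (\<omega> p) f \<longrightarrow> r = f u \<bullet> f v)"

text \<open>The index type \<open>7\<close> is the ring of integers modulo 7; its elements are
  \<open>1, \<dots>, 7\<close> with \<open>7 = 0\<close>.\<close>

definition phi0 :: "7 form" where
  "phi0 vs =
     basis_form [1,2,3] vs + basis_form [1,4,5] vs + basis_form [1,6,7] vs
     + basis_form [2,4,6] vs - basis_form [2,5,7] vs
     - basis_form [3,4,7] vs - basis_form [3,5,6] vs"

definition g2_structure :: "('a, 7) chart set \<Rightarrow> ('a \<Rightarrow> 7 form) \<Rightarrow> bool" where
  "g2_structure A \<phi> \<longleftrightarrow> modelled_on A 3 phi0 \<phi>"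

definition g2_metric :: "('a \<Rightarrow> 7 form) \<Rightarrow> 'a \<Rightarrow> real^7 \<Rightarrow> real^7 \<Rightarrow> real" where
  "g2_metric \<phi> = assoc_metric 3 phi0 \<phi>"

text \<open>The volume form of \<open>g2_metric \<phi>\<close> for the associated orientation: the
  adapted isomorphisms, being orientation-preserving isometries, pull
  \<open>e\<^sup>1 \<and> \<dots> \<and> e\<^sup>7\<close> back to it.\<close>

definition g2_volume :: "('a \<Rightarrow> 7 form) \<Rightarrow> 'a \<Rightarrow> 7 form" where
  "g2_volume \<phi> p vs =
     (THE r. \<forall>f. adapted 3 phi0 (\<phi> p) f \<longrightarrow> r = basis_form [1,2,3,4,5,6,7] (map f vs))"

definition g2_star :: "('a \<Rightarrow> 7 form) \<Rightarrow> 'a \<Rightarrow> nat \<Rightarrow> 7 form \<Rightarrow> 7 form" where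
  "g2_star \<phi> p = hodge_star (g2_metric \<phi> p) (g2_volume \<phi> p)"

text \<open>The value on \<open>X\<close> of \<open>\<Sum>\<^sub>k e\<^sup>k \<otimes> *(e\<^sup>k \<and> \<phi>)\<close> at \<open>p\<close>; the coframe dual to an orthonormal
  frame is given by the inner products with the frame.\<close>

definition g2_generator :: "('a \<Rightarrow> 7 form) \<Rightarrow> 'a \<Rightarrow> real^7 \<Rightarrow> 7 form" where
  "g2_generator \<phi> p X =
     (\<lambda>vs. \<Sum>k\<in>UNIV. let \<xi> = g2_metric \<phi> p (some_basis (g2_metric \<phi> p) k)
        in \<xi> X * g2_star \<phi> p 4 (covector_wedge \<xi> (\<phi> p)) vs)"

definition nearly_parallel_g2 :: "('a, 7) chart set \<Rightarrow> ('a \<Rightarrow> 7 form) \<Rightarrow> bool" where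
  "nearly_parallel_g2 A \<phi> \<longleftrightarrow>
     (\<forall>p\<in>points A. \<exists>r. \<forall>X vs. length vs = 3 \<longrightarrow>
        nabla A (g2_metric \<phi>) \<phi> p X vs = r * g2_generator \<phi> p X vs)"

definition psi0 :: "8 form" where
  "psi0 vs =
     basis_form [0,1,2,3] vs + basis_form [0,1,4,5] vs + basis_form [0,1,6,7] vs
     + basis_form [0,2,4,6] vs - basis_form [0,2,5,7] vs
     - basis_form [0,3,4,7] vs - basis_form [0,3,5,6] vs
     + basis_form [4,5,6,7] vs + basis_form [2,3,6,7] vs + basis_form [2,3,4,5] vs
     + basis_form [1,3,5,7] vs - basis_form [1,3,4,6] vs
     - basis_form [1,2,5,6] vs - basis_form [1,2,4,7] vs"

definition spin7_structure :: "('a, 8) chart set \<Rightarrow> ('a \<Rightarrow> 8 form) \<Rightarrow> bool" where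
  "spin7_structure A \<psi> \<longleftrightarrow> modelled_on A 4 psi0 \<psi>"

definition spin7_metric :: "('a \<Rightarrow> 8 form) \<Rightarrow> 'a \<Rightarrow> real^8 \<Rightarrow> real^8 \<Rightarrow> real" where
  "spin7_metric \<psi> = assoc_metric 4 psi0 \<psi>"

definition parallel_spin7 :: "('a, 8) chart set \<Rightarrow> ('a \<Rightarrow> 8 form) \<Rightarrow> bool" where
  "parallel_spin7 A \<psi> \<longleftrightarrow>
     (\<forall>p\<in>points A. \<forall>X vs. length vs = 4 \<longrightarrow> nabla A (spin7_metric \<psi>) \<psi> p X vs = 0)"

end

theory Submission
  imports Defs
begin

text \<open>The statement is pointwise. Fix a point \<open>p\<close> and an adapted frame there, write \<open>\<omega>\<close> for \<open>\<phi>\<close> or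
\<open>\<psi>\<close>, \<open>k\<close> for its degree and \<open>T\<^sub>X = \<nabla>\<^sub>X \<omega>\<close>. Call a tuple \<open>v\<^sub>1, \<dots>, v\<^sub>k\<close> calibrated if
\<open>\<omega>(v\<^sub>1, \<dots>, v\<^sub>k)\<close> is non-zero and its square is the product of the squared lengths
\<open>|v\<^sub>i|\<^sup>2\<close>; in general the square is at most that product.

\<^item> \<open>T\<^sub>X\<close> vanishes on calibrated tuples (\<open>nabla_calibrated\<close>): if the tuple is moved in
  the direction \<open>X\<close>, parallel to first order, the difference of the two sides of the inequality is
  a non-negative function with a zero, and its derivative there is \<open>- 2 \<omega>(v) T\<^sub>X(v)\<close>.
\<^item> Since the connection is torsion-free, \<open>d\<omega>\<close> is the alternation of \<open>T\<close>. Evaluating the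
  conformal-Killing equation for \<open>u\<close> on \<open>(u, w\<^sub>2, \<dots>, w\<^sub>k)\<close> therefore removes \<open>d\<omega>\<close>, and for
  \<open>w\<^sub>i\<close> orthogonal to \<open>u\<close> it leaves \<open>T\<^sub>u(u, w)\<close> proportional to \<open>|u|\<^sup>2 \<delta>\<omega>(w)\<close>. Any \<open>k - 1\<close> vectors of
  an adapted basis can be completed to a calibrated tuple by a further basis vector \<open>u\<close>: two points
  lie on a line of the Fano plane, and three points on a plane of the affine space of dimension
  three over the field with two elements. So \<open>\<delta>\<omega> = 0\<close>, hence \<open>T\<^sub>u(u, w) = 0\<close> for all \<open>u\<close> and \<open>w\<close>, and
  \<open>T\<^sub>u(v) = \<tau>(u, v)\<close> for a form \<open>\<tau>\<close> of degree \<open>k + 1\<close> (\<open>conformal_killing_model\<close>).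
\<^item> A coefficient of \<open>\<tau>\<close> vanishes as soon as \<open>k\<close> of its \<open>k + 1\<close> basis vectors are calibrated. In
  dimension 8 any five basis vectors contain a calibrated quadruple, so \<open>\<tau> = 0\<close>. In dimension 7
  four basis vectors contain a calibrated triple or are one of the seven complements of such triples;
  evaluating \<open>T\<close> on rotated calibrated triples shows that the seven coefficients left are those of a
  multiple of \<open>*\<phi>\<^sub>0\<close> (\<open>spin7_killing_model\<close>, \<open>g2_killing_model\<close>).
\<^item> The value of the generator of nearly parallel structures at \<open>X\<close> is \<open>- i\<^sub>X *\<phi>\<close>
  (\<open>g2_generator_eq\<close>). So conformal-Killing implies nearly parallel. Conversely, if \<open>T\<^sub>X = c i\<^sub>X *\<phi>\<close>
  then \<open>d\<phi> = 4 c *\<phi>\<close> and \<open>\<delta>\<phi> = 0\<close>, which gives back the equation.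

Two preliminaries concern the metric. It has to be determined by the form, and its components in a
chart have to be differentiable, for the Levi-Civita connection to be the torsion-free metric one.
Both come from explicit formulas: the determinants of the skew matrices of \<open>\<phi>(v, \<sqdot>, \<sqdot>)\<close> and
\<open>\<psi>(v, w, \<sqdot>, \<sqdot>)\<close>, made invertible by adding rank-one matrices, are known
expressions in the metric and in the determinant of an adapted frame (\<open>abs_det_cross7\<close>,
\<open>abs_det_cross8\<close>), and the metric can be solved for. The orientation used by the star
is well defined because \<open>*\<phi>\<^sub>0\<close> can be written in terms of the cross product, so that the stabiliser
of \<open>\<phi>\<^sub>0\<close> preserves \<open>*\<phi>\<^sub>0\<close> and hence the volume form (\<open>stabilizer_preserves_vol7\<close>).\<close>

section \<open>Alternating forms and their coefficients\<close>

lemma alternating_formD_linear: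
  assumes "alternating_form k \<alpha>" "length vs = k" "i < k"
  shows "linear (\<lambda>u. \<alpha> (vs[i := u]))"
  using assms unfolding alternating_form_def by blast

lemma alternating_form_not_distinct:
  assumes "alternating_form k \<alpha>" "length vs = k" "\<not> distinct vs"
  shows "\<alpha> vs = 0"
proof -
  obtain i j where "i < k" "j < k" "i \<noteq> j" "vs ! i = vs ! j"
    using assms(2,3) by (auto simp: distinct_conv_nth)
  then show ?thesis
    using assms(1,2) unfolding alternating_form_def by (metis linorder_neqE_nat)
qed

lemma alternating_form_linear_slot:
  assumes "alternating_form k \<alpha>" "length us + length ws + 1 = k"
  shows "linear (\<lambda>u. \<alpha> (us @ u # ws))"
  using alternating_formD_linear[OF assms(1), of "us @ 0 # ws" "length us"] assms(2) by simp

lemma alternating_form_swap: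
  assumes \<alpha>: "alternating_form k \<alpha>" and len: "length us + length ws + 2 = k"
  shows "\<alpha> (us @ b # a # ws) = - \<alpha> (us @ a # b # ws)"
proof -
  have z: "\<alpha> (us @ x # x # ws) = 0" for x
    by (rule alternating_form_not_distinct[OF \<alpha>]) (use len in auto)
  have 1: "\<alpha> (us @ (x + y) # z # ws) = \<alpha> (us @ x # z # ws) + \<alpha> (us @ y # z # ws)" for x y z
    using linear_add[OF alternating_form_linear_slot[OF \<alpha>, of us "z # ws"]] len by simp
  have 2: "\<alpha> (us @ z # (x + y) # ws) = \<alpha> (us @ z # x # ws) + \<alpha> (us @ z # y # ws)" for x y z
    using linear_add[OF alternating_form_linear_slot[OF \<alpha>, of "us @ [z]" ws]] len by simp
  have "\<alpha> (us @ (a + b) # (a + b) # ws) =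
      \<alpha> (us @ a # b # ws) + \<alpha> (us @ b # a # ws)"
    unfolding 1 unfolding 2 z by simp
  then show ?thesis using z[of "a + b"] by simp
qed

lemma alternating_form_move:
  assumes \<alpha>: "alternating_form k \<alpha>"
  shows "length us + length ws + length zs + 1 = k \<Longrightarrow>
    \<alpha> (us @ a # ws @ zs) = (-1) ^ length ws * \<alpha> (us @ ws @ a # zs)"
proof (induction ws arbitrary: us)
  case (Cons b ws)
  have "\<alpha> (us @ a # b # ws @ zs) = - \<alpha> (us @ b # a # ws @ zs)"
    using alternating_form_swap[OF \<alpha>, of us "ws @ zs" a b] Cons.prems by simp
  also have "\<dots> = (-1) ^ length (b # ws) * \<alpha> (us @ (b # ws) @ a # zs)"
    using Cons.IH[of "us @ [b]"] Cons.prems by simp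
  finally show ?case by simp
qed simp

lemma alternating_form_pullback:
  fixes h :: "real^'m \<Rightarrow> real^'n"
  assumes "alternating_form k \<alpha>" "linear h"
  shows "alternating_form k (\<lambda>vs. \<alpha> (map h vs))"
  unfolding alternating_form_def
proof (intro conjI allI impI; elim conjE)
  fix vs :: "(real^'m) list" and i assume "length vs = k" "i < k"
  then show "linear (\<lambda>u. \<alpha> (map h (vs[i := u])))"
    using linear_compose[OF assms(2) alternating_formD_linear[OF assms(1), of "map h vs" i]]
    by (simp add: map_update o_def)
next
  fix vs :: "(real^'m) list" and i j assume *: "length vs = k" "i < j" "j < k" "vs ! i = vs ! j"
  then have "\<not> distinct vs" by (simp add: distinct_conv_nth) (metis less_trans nat_neq_iff)
  then show "\<alpha> (map h vs) = 0"
    using * by (intro alternating_form_not_distinct[OF assms(1)]) (auto simp: distinct_map)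
qed

lemma alternating_form_add:
  assumes "alternating_form k \<alpha>" "alternating_form k \<beta>"
  shows "alternating_form k (\<lambda>vs. \<alpha> vs + \<beta> vs)"
  using assms unfolding alternating_form_def by (auto intro: linear_compose_add)

lemma alternating_form_cmult:
  assumes "alternating_form k \<alpha>"
  shows "alternating_form k (\<lambda>vs. c * \<alpha> vs)"
  using assms linear_compose_scale_right[of "\<lambda>u. \<alpha> (_ [_ := u])" c]
  unfolding alternating_form_def real_scaleR_def by auto

lemma alternating_form_diff:
  assumes "alternating_form k \<alpha>" "alternating_form k \<beta>"
  shows "alternating_form k (\<lambda>vs. \<alpha> vs - \<beta> vs)"
  using alternating_form_add[OF assms(1) alternating_form_cmult[OF assms(2), of "-1"]] by simp

text \<open>The sublists keep the order of the list, so for a list of all indices they are representatives of the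
  \<open>k\<close>-element index sets; evaluating the definition enumerates them.\<close>

primrec sublists_of_length :: "nat \<Rightarrow> 'b list \<Rightarrow> 'b list list" where
  "sublists_of_length k [] = (if k = 0 then [[]] else [])"
| "sublists_of_length k (x # xs) =
     (case k of 0 \<Rightarrow> [[]]
      | Suc m \<Rightarrow> map (Cons x) (sublists_of_length m xs) @ sublists_of_length k xs)"

text \<open>An alternating form is determined by its coefficients at increasing index lists. Instead of sorting
  an arbitrary list \<open>js\<close>, the proof goes through \<open>xs\<close> and moves each index of \<open>xs\<close> that occurs in \<open>js\<close> to
  the front; the vectors \<open>us\<close> have already been moved.\<close>

lemma alternating_form_zero_on_sublists:
  assumes \<alpha>: "alternating_form k \<alpha>"
  shows "\<lbrakk>\<And>is. is \<in> set (sublists_of_length m xs) \<Longrightarrow> \<alpha> (us @ map e is) = 0;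
    length us + m = k; length js = m; set js \<subseteq> set xs\<rbrakk> \<Longrightarrow> \<alpha> (us @ map e js) = 0"
proof (induction xs arbitrary: m us js)
  case (Cons x xs)
  show ?case
  proof (cases "x \<in> set js")
    case False
    have "is \<in> set (sublists_of_length m (x # xs))" if "is \<in> set (sublists_of_length m xs)" for "is"
      using that by (cases m; cases xs) auto
    then show ?thesis
      using False Cons.prems by (intro Cons.IH[of m us js] Cons.prems(1)) auto
  next
    case True
    then obtain as bs where js: "js = as @ x # bs" by (meson split_list)
    then obtain m' where m: "m = Suc m'" using Cons.prems by (cases m) auto
    have "\<alpha> ((us @ [e x]) @ map e (as @ bs)) = 0"
    proof (cases "x \<in> set (as @ bs)")
      case True
      then show ?thesis
        by (intro alternating_form_not_distinct[OF \<alpha>]) (use Cons.prems m js in auto)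
    next
      case False
      show ?thesis
      proof (rule Cons.IH[of m'])
        fix "is" assume "is \<in> set (sublists_of_length m' xs)"
        then show "\<alpha> ((us @ [e x]) @ map e is) = 0"
          using Cons.prems(1)[of "x # is"] m by simp
      qed (use False Cons.prems m js in auto)
    qed
    moreover have "\<alpha> (us @ e x # map e as @ map e bs) =
        (-1) ^ length as * \<alpha> (us @ map e as @ e x # map e bs)"
      using alternating_form_move[OF \<alpha>, of us "map e as" "map e bs" "e x"] Cons.prems m js by simp
    ultimately show ?thesis using js by simp
  qed
qed (auto split: if_splits)

lemma vec_expand: "(v :: real^'n::finite) = (\<Sum>i\<in>UNIV. (v $ i) *\<^sub>R axis i 1)"
  using basis_expansion[of v] by (simp add: scalar_mult_eq_scaleR)

lemma alternating_form_zero_from_axes: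
  assumes \<alpha>: "alternating_form k \<alpha>"
    and z: "\<And>js. length js = k \<Longrightarrow> \<alpha> (map (\<lambda>i. axis i 1) js) = 0"
  shows "length vs = k \<Longrightarrow> \<alpha> vs = 0"
proof -
  have "length ws + length js = k \<Longrightarrow> \<alpha> (ws @ map (\<lambda>i. axis i 1) js) = 0" for ws js
  proof (induction ws arbitrary: js rule: rev_induct)
    case (snoc v ws)
    let ?f = "\<lambda>u. \<alpha> (ws @ u # map (\<lambda>i. axis i 1) js)"
    have lin: "linear ?f" by (rule alternating_form_linear_slot[OF \<alpha>]) (use snoc.prems in simp)
    have "?f v = ?f (\<Sum>i\<in>UNIV. (v $ i) *\<^sub>R axis i 1)" using vec_expand[of v] by simp
    also have "\<dots> = (\<Sum>i\<in>UNIV. (v $ i) * ?f (axis i 1))"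
      using linear_sum[OF lin, of "\<lambda>i. (v $ i) *\<^sub>R axis i 1" UNIV]
      by (simp add: linear_scale[OF lin])
    also have "\<dots> = 0"
      using snoc.IH[of "_ # js"] snoc.prems by simp
    finally show ?case by simp
  qed (use z in auto)
  from this[of vs "[]"] show "length vs = k \<Longrightarrow> \<alpha> vs = 0" by simp
qed

lemma alternating_form_eq_zero:
  assumes \<alpha>: "alternating_form k \<alpha>" and xs: "set xs = UNIV"
    and z: "\<And>is. is \<in> set (sublists_of_length k xs) \<Longrightarrow> \<alpha> (map (\<lambda>i. axis i 1) is) = 0"
    and vs: "length vs = k"
  shows "\<alpha> vs = 0"
  by (rule alternating_form_zero_from_axes[OF \<alpha> _ vs])
    (use alternating_form_zero_on_sublists[OF \<alpha>, of k xs "[]" "\<lambda>i. axis i 1"] z xs in auto)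

lemma length_omit [simp]: "i < length vs \<Longrightarrow> length (omit i vs) = length vs - 1"
  by (simp add: omit_def)

lemma nth_omit: "\<lbrakk>i < length vs; m < length vs - 1\<rbrakk> \<Longrightarrow> omit i vs ! m = vs ! (if m < i then m else Suc m)"
  by (auto simp: omit_def nth_append min_def)

lemma omit_update:
  assumes "i < length vs" "j < length vs"
  shows "omit i (vs[j := u]) =
    (if i = j then omit i vs else (omit i vs)[(if j < i then j else j - 1) := u])"
proof (cases i j rule: linorder_cases)
  case less
  then have "drop (Suc i) (vs[j := u]) = (drop (Suc i) vs)[j - Suc i := u]"
    by (simp add: drop_update_swap)
  then show ?thesis using less assms by (cases j) (simp_all add: omit_def list_update_append)
next
  case greater
  then show ?thesis using assms by (simp add: omit_def list_update_append take_update_swap)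
qed (simp add: omit_def)

text \<open>If the vectors number \<open>i\<close> and \<open>j\<close> agree, only the summands omitting one of the two survive, and these
  differ by moving the common vector past the \<open>j - i - 1\<close> vectors in between.\<close>

lemma alternating_covector_wedge:
  assumes \<alpha>: "alternating_form k \<alpha>" and \<xi>: "linear \<xi>"
  shows "alternating_form (Suc k) (covector_wedge \<xi> \<alpha>)"
  unfolding alternating_form_def
proof (intro conjI allI impI; elim conjE)
  fix vs :: "(real^'a) list" and j assume len: "length vs = Suc k" and j: "j < Suc k"
  have "linear (\<lambda>u. (-1)^i * \<xi> (vs[j := u] ! i) * \<alpha> (omit i (vs[j := u])))" if i: "i < Suc k" for i
  proof (cases "i = j")
    case True
    then have "(\<lambda>u. (-1)^i * \<xi> (vs[j := u] ! i) * \<alpha> (omit i (vs[j := u])))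
       = (\<lambda>u. ((-1)^i * \<alpha> (omit i vs)) * \<xi> u)"
      using len j by (auto simp: omit_update)
    then show ?thesis using linear_compose_scale_right[OF \<xi>] by simp
  next
    case False
    let ?j = "if j < i then j else j - 1"
    have "(\<lambda>u. (-1)^i * \<xi> (vs[j := u] ! i) * \<alpha> (omit i (vs[j := u])))
       = (\<lambda>u. ((-1)^i * \<xi> (vs ! i)) * \<alpha> ((omit i vs)[?j := u]))"
      using len j i False by (auto simp: omit_update)
    moreover have "linear (\<lambda>u. \<alpha> ((omit i vs)[?j := u]))"
      by (rule alternating_formD_linear[OF \<alpha>]) (use len i j False in auto)
    ultimately show ?thesis using linear_compose_scale_right by fastforce
  qed
  then show "linear (\<lambda>u. covector_wedge \<xi> \<alpha> (vs[j := u]))"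
    unfolding covector_wedge_def length_list_update len by (intro linear_compose_sum) auto
next
  fix vs :: "(real^'a) list" and i j
  assume len: "length vs = Suc k" and ij: "i < j" "j < Suc k" and eq: "vs ! i = vs ! j"
  let ?t = "\<lambda>l. (-1)^l * \<xi> (vs ! l) * \<alpha> (omit l vs)"
  have z: "?t l = 0" if l: "l < Suc k" "l \<noteq> i" "l \<noteq> j" for l
  proof -
    let ?s = "\<lambda>m. if m < l then m else m - 1"
    have n: "omit l vs ! ?s m = vs ! m" if "m < Suc k" "m \<noteq> l" for m
      using that l len by (cases m; cases "m < l") (simp_all add: nth_omit)
    have "omit l vs ! ?s i = omit l vs ! ?s j"
      using n[of i] n[of j] l ij eq by simp
    moreover have s: "?s i < length (omit l vs)" "?s j < length (omit l vs)" "?s i \<noteq> ?s j"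
      using l ij len by auto
    ultimately have "\<not> distinct (omit l vs)"
      using nth_eq_iff_index_eq[OF _ s(1,2)] by blast
    then have "\<alpha> (omit l vs) = 0"
      using alternating_form_not_distinct[OF \<alpha>, of "omit l vs"] len l by simp
    then show ?thesis by simp
  qed
  define us v ws zs where d: "us = take i vs" "v = vs ! i" "ws = take (j - Suc i) (drop (Suc i) vs)"
    "zs = drop (Suc j) vs"
  have dr: "drop (Suc i) vs = ws @ v # zs"
  proof -
    have "drop (Suc i) vs = ws @ drop (j - Suc i) (drop (Suc i) vs)"
      unfolding d by (rule append_take_drop_id[symmetric])
    also have "drop (j - Suc i) (drop (Suc i) vs) = drop j vs" using ij by simp
    also have "\<dots> = v # zs" using ij len eq d by (simp add: Cons_nth_drop_Suc)
    finally show ?thesis .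
  qed
  have lens: "length us = i" "length ws = j - Suc i" using ij len by (auto simp: d)
  have vs: "vs = us @ v # ws @ v # zs"
    using id_take_nth_drop[of i vs] dr ij len by (simp flip: d)
  have o: "omit i vs = us @ ws @ v # zs" "omit j vs = us @ v # ws @ zs"
  proof -
    show "omit i vs = us @ ws @ v # zs" by (simp add: omit_def dr flip: d)
    have "take j vs = take j ((us @ v # ws) @ v # zs)" using vs by simp
    also have "j = length (us @ v # ws)" using lens ij by simp
    then have "take j ((us @ v # ws) @ v # zs) = us @ v # ws" by (metis append_eq_conv_conj)
    finally have "take j vs = us @ v # ws" .
    then show "omit j vs = us @ v # ws @ zs" by (simp add: omit_def flip: d)
  qed
  have mv: "\<alpha> (us @ v # ws @ zs) = (-1) ^ length ws * \<alpha> (us @ ws @ v # zs)"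
    by (rule alternating_form_move[OF \<alpha>]) (use len vs in simp)
  have "covector_wedge \<xi> \<alpha> vs = (\<Sum>l\<in>{i, j}. ?t l)"
    unfolding covector_wedge_def len by (rule sum.mono_neutral_right) (use z ij in auto)
  also have "\<dots> = ?t i + ?t j" using ij by simp
  also have "\<dots> = 0"
  proof -
    have v: "vs ! i = v" "vs ! j = v" using eq d by simp_all
    have "j = i + length ws + 1" using lens ij by simp
    then have "(-1::real) ^ j * (-1) ^ length ws = - ((-1) ^ i)"
      by (simp add: power_add flip: power_mult_distrib)
    moreover have "?t j = ((-1) ^ j * (-1) ^ length ws) * (\<xi> v * \<alpha> (us @ ws @ v # zs))"
      by (simp add: o mv v)
    ultimately show ?thesis by (simp add: o v)
  qed
  finally show "covector_wedge \<xi> \<alpha> vs = 0" .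
qed

lemma linear_component: "linear (\<lambda>v::real^'n. v $ i)"
  by (rule linearI) auto

lemma alternating_basis_form: "length is = k \<Longrightarrow> alternating_form k (basis_form is)"
proof (induction "is" arbitrary: k)
  case (Cons i "is")
  then show ?case
    using alternating_covector_wedge[OF Cons.IH[OF refl] linear_component] by auto
qed (simp add: alternating_form_def)

section \<open>The cross products of the model forms\<close>

lemma exhaust_7: fixes x :: 7 shows "x = 1 \<or> x = 2 \<or> x = 3 \<or> x = 4 \<or> x = 5 \<or> x = 6 \<or> x = 7"
proof (induct x)
  case (of_int z)
  then have "z = 0 \<or> z = 1 \<or> z = 2 \<or> z = 3 \<or> z = 4 \<or> z = 5 \<or> z = 6" by fastforce
  then show ?case by auto
qed

lemma exhaust_8:
  fixes x :: 8
  shows "x = 0 \<or> x = 1 \<or> x = 2 \<or> x = 3 \<or> x = 4 \<or> x = 5 \<or> x = 6 \<or> x = 7"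
proof (induct x)
  case (of_int z)
  then have "z = 0 \<or> z = 1 \<or> z = 2 \<or> z = 3 \<or> z = 4 \<or> z = 5 \<or> z = 6 \<or> z = 7" by fastforce
  then show ?case by auto
qed

lemma UNIV_7: "UNIV = {1, 2, 3, 4, 5, 6, 7 :: 7}"
  using exhaust_7 by auto

lemma UNIV_8: "UNIV = {0, 1, 2, 3, 4, 5, 6, 7 :: 8}"
  using exhaust_8 by auto

lemma forall_7: "(\<forall>i::7. P i) \<longleftrightarrow> P 1 \<and> P 2 \<and> P 3 \<and> P 4 \<and> P 5 \<and> P 6 \<and> P 7"
  by (metis exhaust_7)

lemma forall_8: "(\<forall>i::8. P i) \<longleftrightarrow> P 0 \<and> P 1 \<and> P 2 \<and> P 3 \<and> P 4 \<and> P 5 \<and> P 6 \<and> P 7"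
  by (metis exhaust_8)

lemma sum_7: "sum f (UNIV :: 7 set) = f 1 + f 2 + f 3 + f 4 + f 5 + f 6 + f 7"
  unfolding UNIV_7 by (simp add: ac_simps)

lemma sum_8: "sum f (UNIV :: 8 set) = f 0 + f 1 + f 2 + f 3 + f 4 + f 5 + f 6 + f 7"
  unfolding UNIV_8 by (simp add: ac_simps)

lemma basis_form_3:
  "basis_form [i, j, k] [u, v, w] =
     u $ i * (v $ j * w $ k - v $ k * w $ j)
   - v $ i * (u $ j * w $ k - u $ k * w $ j)
   + w $ i * (u $ j * v $ k - u $ k * v $ j)"
  by (simp add: covector_wedge_def omit_def lessThan_Suc numeral_eq_Suc algebra_simps)

definition cross7 :: "real^7 \<Rightarrow> real^7 \<Rightarrow> real^7" where
  "cross7 u v = (\<chi> k. phi0 [u, v, axis k 1])"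

text \<open>Basis forms are evaluated by expansions for explicit argument lists, such as \<open>basis_form_3\<close>, instead of by
  their recursion.\<close>

declare basis_form.simps(2) [simp del]

lemma phi0_cross7: "phi0 [u, v, w] = cross7 u v \<bullet> w"
  by (simp add: cross7_def inner_vec_def sum_7 phi0_def basis_form_3 axis_def) (simp add: algebra_simps)

text \<open>The defining identity of a cross product: for a unit vector \<open>v\<close>, multiplication by \<open>v\<close> is a complex
  structure on the orthogonal complement of \<open>v\<close>.\<close>

lemma cross7_cross7: "cross7 v (cross7 v u) = (v \<bullet> u) *\<^sub>R v - (v \<bullet> v) *\<^sub>R u"
  by (simp add: vec_eq_iff forall_7 inner_vec_def sum_7 cross7_def phi0_def basis_form_3 axis_def)
   (simp add: algebra_simps)

lemma basis_form_Cons4: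
  "basis_form [i, j, k, l] [u, v, w, x] =
     u $ i * basis_form [j, k, l] [v, w, x] - v $ i * basis_form [j, k, l] [u, w, x]
   + w $ i * basis_form [j, k, l] [u, v, x] - x $ i * basis_form [j, k, l] [u, v, w]"
  by (simp add: basis_form.simps(2)[of i] covector_wedge_def[of "\<lambda>v. v $ i"] omit_def lessThan_Suc numeral_eq_Suc)

text \<open>With \<open>real^8\<close> regarded as the octonions, \<open>pair8 a b\<close> is the imaginary part of \<open>b\<close> times the
  conjugate of \<open>a\<close>, and \<open>cliff8 x\<close> below is Clifford multiplication by an imaginary octonion \<open>x\<close>. The
  form \<open>psi0\<close> is built from these seven complex structures (\<open>psi0_pair8\<close>), which reduces identities of
  degree four to the Clifford relation.\<close>

definition pair8 :: "real^8 \<Rightarrow> real^8 \<Rightarrow> real^8" where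
  "pair8 a b = (\<chi> m. a $ 0 * b $ m - a $ m * b $ 0 + psi0 [axis 0 1, axis m 1, a, b])"

lemma pair8_nth:
  "pair8 a b $ 0 = 0"
  "pair8 a b $ 1 = a$0 * b$1 - a$1 * b$0 + a$2 * b$3 - a$3 * b$2 + a$4 * b$5 - a$5 * b$4 + a$6 * b$7 - a$7 * b$6"
  "pair8 a b $ 2 = a$0 * b$2 - a$2 * b$0 - a$1 * b$3 + a$3 * b$1 + a$4 * b$6 - a$6 * b$4 - a$5 * b$7 + a$7 * b$5"
  "pair8 a b $ 3 = a$0 * b$3 - a$3 * b$0 + a$1 * b$2 - a$2 * b$1 - a$4 * b$7 + a$7 * b$4 - a$5 * b$6 + a$6 * b$5"
  "pair8 a b $ 4 = a$0 * b$4 - a$4 * b$0 - a$1 * b$5 + a$5 * b$1 - a$2 * b$6 + a$6 * b$2 + a$3 * b$7 - a$7 * b$3"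
  "pair8 a b $ 5 = a$0 * b$5 - a$5 * b$0 + a$1 * b$4 - a$4 * b$1 + a$2 * b$7 - a$7 * b$2 + a$3 * b$6 - a$6 * b$3"
  "pair8 a b $ 6 = a$0 * b$6 - a$6 * b$0 - a$1 * b$7 + a$7 * b$1 + a$2 * b$4 - a$4 * b$2 - a$3 * b$5 + a$5 * b$3"
  "pair8 a b $ 7 = a$0 * b$7 - a$7 * b$0 + a$1 * b$6 - a$6 * b$1 - a$2 * b$5 + a$5 * b$2 - a$3 * b$4 + a$4 * b$3"
  by (simp_all add: pair8_def psi0_def basis_form_Cons4 basis_form_3 axis_def)

definition cliff8 :: "real^8 \<Rightarrow> real^8 \<Rightarrow> real^8" where
  "cliff8 x a = (\<chi> n. x \<bullet> pair8 a (axis n 1))"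

lemma cliff8_inner: "cliff8 x a \<bullet> b = x \<bullet> pair8 a b"
  by (simp add: cliff8_def inner_vec_def sum_8 pair8_nth axis_def) (simp add: algebra_simps)

lemma cliff8_cliff8: "x $ 0 = 0 \<Longrightarrow> cliff8 x (cliff8 x a) = - (x \<bullet> x) *\<^sub>R a"
  by (simp add: vec_eq_iff forall_8 cliff8_def inner_vec_def sum_8 pair8_nth axis_def)
    (simp add: algebra_simps)

lemma cliff8_pair8: "cliff8 (pair8 a b) a = (a \<bullet> a) *\<^sub>R b - (a \<bullet> b) *\<^sub>R a"
  by (simp add: vec_eq_iff forall_8 cliff8_def inner_vec_def sum_8 pair8_nth axis_def)
    (simp add: algebra_simps)

lemma alternating_phi0: "alternating_form 3 phi0"
  unfolding phi0_def
  by (intro alternating_form_add alternating_form_diff alternating_basis_form) simp_all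

lemma alternating_psi0: "alternating_form 4 psi0"
  unfolding psi0_def
  by (intro alternating_form_add alternating_form_diff alternating_basis_form) simp_all

lemma linear_pair8: "linear (pair8 a)"
  by (rule linearI) (simp_all add: vec_eq_iff forall_8 pair8_nth algebra_simps)

lemma pair8_commute: "pair8 b a = - pair8 a b"
  by (simp add: vec_eq_iff forall_8 pair8_nth)

lemma linear_pair8_left: "linear (\<lambda>a. pair8 a b)"
  by (rule linearI) (simp_all add: vec_eq_iff forall_8 pair8_nth algebra_simps)

lemma linear_eq_on_axes:
  fixes f g :: "real^'n::finite \<Rightarrow> real"
  assumes "linear f" "linear g" "\<And>i. f (axis i 1) = g (axis i 1)"
  shows "f x = g x"
  using linear_eq_stdbasis[OF assms(1,2)] assms(3) by (auto simp: Basis_vec_def)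

text \<open>Both sides are linear in \<open>c\<close> and \<open>d\<close>, so the identity needs to be checked only for basis vectors in these two
  places, where it is bilinear in \<open>a\<close> and \<open>b\<close>.\<close>

lemma psi0_pair8:
  "psi0 [a, b, c, d] = pair8 a b \<bullet> pair8 c d - (a \<bullet> c) * (b \<bullet> d) + (a \<bullet> d) * (b \<bullet> c)"
proof (rule linear_eq_on_axes[where x = d])
  show "linear (\<lambda>d. psi0 [a, b, c, d])"
    using alternating_form_linear_slot[OF alternating_psi0, of "[a, b, c]" "[]"] by simp
  show "linear (\<lambda>d. pair8 a b \<bullet> pair8 c d - (a \<bullet> c) * (b \<bullet> d) + (a \<bullet> d) * (b \<bullet> c))" for c
    by (rule linearI) (simp_all add: linear_add[OF linear_pair8] linear_scale[OF linear_pair8]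
      inner_right_distrib algebra_simps)
  fix j
  show "psi0 [a, b, c, axis j 1] = pair8 a b \<bullet> pair8 c (axis j 1)
    - (a \<bullet> c) * (b \<bullet> axis j 1) + (a \<bullet> axis j 1) * (b \<bullet> c)"
  proof (rule linear_eq_on_axes[where x = c])
    show "linear (\<lambda>c. psi0 [a, b, c, axis j 1])"
      using alternating_form_linear_slot[OF alternating_psi0, of "[a, b]" "[axis j 1]"] by simp
    show "linear (\<lambda>c. pair8 a b \<bullet> pair8 c (axis j 1)
      - (a \<bullet> c) * (b \<bullet> axis j 1) + (a \<bullet> axis j 1) * (b \<bullet> c))"
      by (rule linearI) (simp_all add: linear_add[OF linear_pair8_left] linear_scale[OF linear_pair8_left]
        inner_right_distrib algebra_simps)
    fix i
    have "\<forall>i j. psi0 [a, b, axis i 1, axis j 1] = pair8 a b \<bullet> pair8 (axis i 1) (axis j 1)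
      - (a \<bullet> axis i 1) * (b \<bullet> axis j 1) + (a \<bullet> axis j 1) * (b \<bullet> axis i 1)"
      unfolding forall_8
      by (simp add: psi0_def basis_form_Cons4 basis_form_3 inner_vec_def sum_8 pair8_nth axis_def)
    then show "psi0 [a, b, axis i 1, axis j 1] = pair8 a b \<bullet> pair8 (axis i 1) (axis j 1)
      - (a \<bullet> axis i 1) * (b \<bullet> axis j 1) + (a \<bullet> axis j 1) * (b \<bullet> axis i 1)"
      by blast
  qed
qed

text \<open>The triple cross product of \<open>psi0\<close>.\<close>

definition cross8 :: "real^8 \<Rightarrow> real^8 \<Rightarrow> real^8 \<Rightarrow> real^8" where
  "cross8 a b c = cliff8 (pair8 a b) c - (a \<bullet> c) *\<^sub>R b + (b \<bullet> c) *\<^sub>R a"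

lemma psi0_cross8: "psi0 [a, b, c, d] = cross8 a b c \<bullet> d"
  by (simp add: cross8_def psi0_pair8 cliff8_inner inner_add_left inner_diff_left algebra_simps)

lemma cliff8_pair8_right: "cliff8 (pair8 a b) b = (a \<bullet> b) *\<^sub>R b - (b \<bullet> b) *\<^sub>R a"
proof -
  have "cliff8 (pair8 a b) b = - cliff8 (pair8 b a) b"
    by (simp add: pair8_commute[of a b] cliff8_def vec_eq_iff)
  then show ?thesis by (simp add: cliff8_pair8 inner_commute)
qed

lemma linear_cliff8: "linear (cliff8 x)"
proof (rule linearI)
  have lin: "linear (\<lambda>a. x \<bullet> pair8 a b)" for b
    by (rule linearI) (simp_all add: linear_add[OF linear_pair8_left] linear_scale[OF linear_pair8_left]
      inner_right_distrib)
  show "cliff8 x (a + a') = cliff8 x a + cliff8 x a'" "cliff8 x (r *\<^sub>R a) = r *\<^sub>R cliff8 x a" for a a' r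
    by (simp_all add: cliff8_def vec_eq_iff linear_add[OF lin] linear_scale[OF lin])
qed

lemma norm_pair8: "pair8 a b \<bullet> pair8 a b = (a \<bullet> a) * (b \<bullet> b) - (a \<bullet> b)\<^sup>2"
  using cliff8_inner[of "pair8 a b" a b]
  by (simp add: cliff8_pair8 inner_diff_left power2_eq_square)

lemma cliff8_skew: "cliff8 x a \<bullet> b = - (a \<bullet> cliff8 x b)"
  by (simp add: cliff8_inner inner_commute[of a] pair8_commute[of a])

text \<open>The squared length of the triple product is the Gram determinant of its arguments, here in a form from
  which the bound by \<open>|a|\<^sup>2 |b|\<^sup>2 |c|\<^sup>2\<close> can be read off.\<close>

lemma norm_cross8:
  "cross8 a b c \<bullet> cross8 a b c = (a \<bullet> a) * (b \<bullet> b) * (c \<bullet> c) - (a \<bullet> b)\<^sup>2 * (c \<bullet> c)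
     - ((b \<bullet> c) *\<^sub>R a - (a \<bullet> c) *\<^sub>R b) \<bullet> ((b \<bullet> c) *\<^sub>R a - (a \<bullet> c) *\<^sub>R b)"
proof -
  let ?K = "cliff8 (pair8 a b)"
  have 1: "?K c \<bullet> ?K c = ((a \<bullet> a) * (b \<bullet> b) - (a \<bullet> b)\<^sup>2) * (c \<bullet> c)"
    by (simp add: cliff8_skew[of _ c] cliff8_cliff8 pair8_nth norm_pair8 algebra_simps)
  have 2: "?K c \<bullet> a = (a \<bullet> b) * (a \<bullet> c) - (a \<bullet> a) * (b \<bullet> c)"
    by (simp add: cliff8_skew[of _ c] cliff8_pair8 inner_diff_right inner_commute[of c])
  have 3: "?K c \<bullet> b = (b \<bullet> b) * (a \<bullet> c) - (a \<bullet> b) * (b \<bullet> c)"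
    by (simp add: cliff8_skew[of _ c] cliff8_pair8_right inner_diff_right inner_commute[of c])
  show ?thesis
    by (simp add: cross8_def inner_add_left inner_add_right inner_diff_left inner_diff_right 1 2 3
      inner_commute[of a "?K c"] inner_commute[of b "?K c"] inner_commute[of b a])
      (simp add: algebra_simps power2_eq_square)
qed

text \<open>The calibration inequality; Cauchy-Schwarz reduces it to the length of the triple product.\<close>

lemma psi0_comass: "(psi0 [a, b, c, d])\<^sup>2 \<le> (a \<bullet> a) * (b \<bullet> b) * (c \<bullet> c) * (d \<bullet> d)"
proof -
  have "(cross8 a b c \<bullet> d)\<^sup>2 \<le> (cross8 a b c \<bullet> cross8 a b c) * (d \<bullet> d)"
    by (rule Cauchy_Schwarz_ineq)
  also have "\<dots> \<le> (a \<bullet> a) * (b \<bullet> b) * (c \<bullet> c) * (d \<bullet> d)"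
  proof (rule mult_right_mono)
    have "0 \<le> (a \<bullet> b)\<^sup>2 * (c \<bullet> c)" by simp
    moreover have "0 \<le> ((b \<bullet> c) *\<^sub>R a - (a \<bullet> c) *\<^sub>R b) \<bullet> ((b \<bullet> c) *\<^sub>R a - (a \<bullet> c) *\<^sub>R b)"
      by (rule inner_ge_zero)
    ultimately show "cross8 a b c \<bullet> cross8 a b c \<le> (a \<bullet> a) * (b \<bullet> b) * (c \<bullet> c)"
      unfolding norm_cross8 by linarith
  qed simp
  finally show ?thesis by (simp add: psi0_cross8)
qed

lemma cross7_skew: "cross7 v a \<bullet> b = - (a \<bullet> cross7 v b)"
  using alternating_form_swap[OF alternating_phi0, of "[v]" "[]" a b]
  by (simp add: phi0_cross7 inner_commute)

lemma phi0_comass: "(phi0 [a, b, c])\<^sup>2 \<le> (a \<bullet> a) * (b \<bullet> b) * (c \<bullet> c)"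
proof -
  have "(cross7 a b \<bullet> c)\<^sup>2 \<le> (cross7 a b \<bullet> cross7 a b) * (c \<bullet> c)"
    by (rule Cauchy_Schwarz_ineq)
  also have "cross7 a b \<bullet> cross7 a b = (a \<bullet> a) * (b \<bullet> b) - (a \<bullet> b)\<^sup>2"
    by (simp add: cross7_skew[of _ b] cross7_cross7 inner_diff_right inner_commute power2_eq_square)
  also have "\<dots> * (c \<bullet> c) \<le> (a \<bullet> a) * (b \<bullet> b) * (c \<bullet> c)"
    by (intro mult_right_mono) auto
  finally show ?thesis by (simp add: phi0_cross7)
qed

section \<open>Determinants of skew matrices with a small kernel\<close>

definition outer :: "real^'n \<Rightarrow> real^'n \<Rightarrow> real^'n^'n" where
  "outer x y = (\<chi> i j. x $ i * y $ j)"

lemma mult_outer: "A ** outer x y = outer (A *v x) (y :: real^'n::finite)"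
  by (simp add: vec_eq_iff outer_def matrix_matrix_mult_def matrix_vector_mult_def
    sum_distrib_right mult.assoc)

lemma outer_mult: "outer x y ** A = outer (x :: real^'n::finite) (transpose A *v y)"
  by (simp add: vec_eq_iff outer_def matrix_matrix_mult_def matrix_vector_mult_def transpose_def
    sum_distrib_left mult_ac)

lemma outer_vec: "outer x y *v z = (y \<bullet> z) *\<^sub>R (x :: real^'n::finite)"
  by (simp add: vec_eq_iff outer_def matrix_vector_mult_def inner_vec_def sum_distrib_left
    sum_distrib_right mult_ac)

lemma transpose_outer: "transpose (outer x y) = outer (y :: real^'n::finite) x"
  by (simp add: vec_eq_iff outer_def transpose_def mult.commute)

lemma outer_linear:
  "outer (x + x') y = outer x y + outer (x' :: real^'n::finite) y"
  "outer x (y + y') = outer x y + outer x y'"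
  "outer (c *\<^sub>R x) y = c *\<^sub>R outer x y" "outer x (c *\<^sub>R y) = c *\<^sub>R outer x y"
  "outer 0 y = 0" "outer x 0 = 0"
  by (simp_all add: vec_eq_iff outer_def algebra_simps)

lemma transpose_add: "transpose (A + B) = transpose A + transpose (B :: real^'n^'m)"
  by (simp add: vec_eq_iff transpose_def)

text \<open>Matrix identities are verified by letting both sides act on a vector.\<close>

lemmas matrix_action = matrix_eq matrix_vector_mult_add_rdistrib matrix_vector_mult_diff_rdistrib
  matrix_vector_right_distrib matrix_vector_mult_scaleR outer_vec
  scaleR_matrix_vector_assoc[symmetric] matrix_vector_mul_assoc[symmetric]
  inner_add_left inner_add_right inner_diff_left inner_diff_right

text \<open>The matrices \<open>1 + t x v\<^sup>T\<close> form a one-parameter group, and scaling by 2 along \<open>x\<close> conjugates the parameter \<open>t\<close>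
  to \<open>2 t\<close>; so the determinant \<open>D\<close> for \<open>t = 1\<close> satisfies \<open>D = D\<^sup>2\<close> and \<open>D \<noteq> 0\<close>.\<close>

lemma det_unipotent:
  fixes x v :: "real^'n::finite"
  assumes xv: "x \<bullet> v = 0"
  shows "det (mat 1 + outer x v) = 1"
proof (cases "x = 0")
  case False
  define r where "r = x \<bullet> x"
  have r: "r \<noteq> 0" using False by (simp add: r_def)
  let ?U = "\<lambda>t::real. mat 1 + t *\<^sub>R outer x v"
  let ?K = "mat 1 + (1 / r) *\<^sub>R outer x x" and ?K' = "mat 1 - (1 / (2 * r)) *\<^sub>R outer x x"
  have vx: "v \<bullet> x = 0" using xv by (simp add: inner_commute)
  have m: "?U 1 ** ?U 1 = ?U 2" "?U 1 ** ?U (-1) = mat 1"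
    using vx by (simp_all add: matrix_action) (simp_all add: vec_eq_iff algebra_simps)
  have K: "?K ** ?K' = mat 1" "?K ** ?U 1 = ?U 2 ** ?K"
    using vx r by (simp_all add: matrix_action r_def[symmetric]) (simp_all add: vec_eq_iff field_simps)
  have "det ?K * det ?K' = 1" using arg_cong[OF K(1), of det] by (simp add: det_mul)
  then have "det (?U 1) = det (?U 2)"
    using arg_cong[OF K(2), of det] by (auto simp: det_mul)
  moreover have "det (?U 1) * det (?U 1) = det (?U 2)" "det (?U 1) * det (?U (-1)) = 1"
    using arg_cong[OF m(1), of det] arg_cong[OF m(2), of det] by (simp_all add: det_mul)
  ultimately have "det (?U 1) = 1" by auto
  then show ?thesis by simp
qed (simp add: outer_linear)

lemma det_dilation:
  fixes v :: "real^'n::finite"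
  assumes "v \<bullet> v = 1"
  shows "det (mat 1 + s *\<^sub>R outer v v) = 1 + s"
proof -
  fix k :: 'n
  have n: "norm (axis k 1 :: real^'n) = norm v" using assms by (simp add: norm_eq_sqrt_inner)
  obtain f :: "real^'n \<Rightarrow> real^'n" where f: "orthogonal_transformation f" "f (axis k 1) = v"
    by (rule orthogonal_transformation_exists[OF n])
  let ?Q = "matrix f"
  let ?D = "mat 1 + s *\<^sub>R outer (axis k 1) (axis k 1)"
  have Q: "orthogonal_matrix ?Q" using f(1) by (simp add: orthogonal_transformation_matrix)
  have Qk: "?Q *v axis k 1 = v"
    using f by (simp add: orthogonal_transformation_linear)
  have Qt: "(transpose ?Q *v y) \<bullet> axis k 1 = v \<bullet> y" for y
    using Qk by (metis dot_lmul_matrix inner_commute transpose_matrix_vector)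
  have QQ: "?Q *v (transpose ?Q *v y) = y" for y
    using Q by (metis matrix_vector_mul_assoc matrix_vector_mul_lid orthogonal_matrix_def)
  have "mat 1 + s *\<^sub>R outer v v = ?Q ** ?D ** transpose ?Q"
    by (simp add: matrix_action QQ Qk Qt inner_commute[of "axis k 1"] del: transpose_matrix_vector)
  moreover have "det ?Q * det (transpose ?Q) = 1"
    using Q by (metis det_I det_mul orthogonal_matrix_def)
  ultimately have "det (mat 1 + s *\<^sub>R outer v v) = det ?D"
    by (simp add: det_mul mult.commute mult.left_commute)
  also have "\<dots> = (\<Prod>i\<in>UNIV. ?D $ i $ i)"
    by (rule det_diagonal) (auto simp: mat_def outer_def axis_def)
  also have "\<dots> = (\<Prod>i\<in>UNIV. if i = k then 1 + s else 1)"
    by (rule prod.cong) (auto simp: mat_def outer_def axis_def)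
  also have "\<dots> = 1 + s" by simp
  finally show ?thesis .
qed

text \<open>If \<open>v\<close> spans the kernel of \<open>N\<close> on both sides, adding \<open>\<xi> \<xi>\<^sup>T\<close> makes \<open>N\<close> invertible unless \<open>\<xi>\<close> is orthogonal
  to \<open>v\<close>, and this compares the choices of \<open>\<xi>\<close>: writing \<open>\<xi> = c (v + x)\<close> with \<open>x\<close> orthogonal to \<open>v\<close>, unipotent
  matrices turn \<open>N + c\<^sup>2 v v\<^sup>T\<close> into \<open>N + \<xi> \<xi>\<^sup>T\<close>. A covector \<open>\<xi>\<close> that is independent of the metric can thus be
  used although \<open>v\<close> is normalised by the metric.\<close>

lemma det_rank_one_kernel:
  fixes N :: "real^'n^'n::finite"
  assumes N: "N *v v = 0" "transpose N *v v = 0" and v: "v \<bullet> v = 1"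
  shows "det (N + outer \<xi> \<xi>) = (\<xi> \<bullet> v)\<^sup>2 * det (N + outer v v)"
proof (cases "\<xi> \<bullet> v = 0")
  case True
  have "(N + outer \<xi> \<xi>) *v v = 0" using True N by (simp add: matrix_action)
  moreover have "v \<noteq> 0" using v by auto
  ultimately have "det (N + outer \<xi> \<xi>) = 0"
    by (metis invertible_det_nz invertible_left_inverse matrix_left_invertible_ker)
  then show ?thesis using True by simp
next
  case False
  define c where "c = \<xi> \<bullet> v"
  define x where "x = (1 / c) *\<^sub>R \<xi> - v"
  have c: "c \<noteq> 0" using False by (simp add: c_def)
  have xv: "x \<bullet> v = 0" "v \<bullet> x = 0" using c v by (simp_all add: x_def c_def inner_diff_left inner_diff_right inner_commute)
  have \<xi>: "\<xi> = c *\<^sub>R (v + x)" using c by (simp add: x_def)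
  let ?K = "mat 1 + (c - 1) *\<^sub>R outer v v"
  have Nv: "v \<bullet> (N *v y) = 0" for y
    using N(2) by (metis dot_lmul_matrix inner_commute inner_zero_left transpose_matrix_vector)
  have "N + outer \<xi> \<xi> = (mat 1 + outer x v) ** (?K ** (N + outer v v) ** ?K) ** (mat 1 + outer v x)"
    using N(1) Nv xv v
    by (simp add: matrix_action \<xi> outer_linear) (simp add: algebra_simps)
  then show ?thesis
    using v xv by (simp add: det_mul det_unipotent det_dilation c_def power2_eq_square)
qed

text \<open>Transposes are kept as matrices, since \<open>transpose_outer\<close> and skew-symmetry are stated for them.\<close>

declare transpose_matrix_vector [simp del]

lemma matrix_vector_mult_minus: "(- A) *v x = - (A *v (x :: real^'n::finite))"
  by (simp add: vec_eq_iff matrix_vector_mult_def sum_negf)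

lemma det_scaleR: "det (r *\<^sub>R A) = r ^ CARD('n) * det (A :: real^'n^'n::finite)"
proof -
  have "r *\<^sub>R A = (r *\<^sub>R mat 1) ** A" by (simp add: matrix_action)
  moreover have "det (r *\<^sub>R mat 1 :: real^'n^'n) = r ^ CARD('n)"
    by (subst det_diagonal) (simp_all add: mat_def)
  ultimately show ?thesis by (simp add: det_mul)
qed

text \<open>If \<open>N\<close> is skew and \<open>P\<close> symmetric, then \<open>P - N\<close> is the transpose of \<open>N + P\<close>, so the hypothesis says that
  \<open>N + P\<close> is orthogonal.\<close>

lemma det_skew_complement:
  fixes N P :: "real^'n^'n::finite"
  assumes skew: "transpose N = - N" and P: "transpose P = P" and mult: "(N + P) ** (P - N) = mat 1"
  shows "\<bar>det (N + P)\<bar> = 1"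
proof -
  have "transpose (N + P) = P - N" by (simp add: transpose_add skew P)
  then have "det (P - N) = det (N + P)" by (metis det_transpose)
  then have "det (N + P) * det (N + P) = 1" using arg_cong[OF mult, of det] by (simp add: det_mul)
  then show ?thesis by (metis abs_1 abs_mult_self_eq abs_square_eq_1 power2_eq_square)
qed

lemma sqrt_scaled_outer: "r > 0 \<Longrightarrow> outer \<xi> \<xi> = r *\<^sub>R outer ((1 / sqrt r) *\<^sub>R \<xi>) ((1 / sqrt r) *\<^sub>R (\<xi>::real^'n::finite))"
  by (simp add: outer_linear)

lemma linear_cross7: "linear (cross7 v)"
proof (rule linearI)
  have lin: "linear (\<lambda>a. phi0 [v, a, b])" for b
    using alternating_form_linear_slot[OF alternating_phi0, of "[v]" "[b]"] by simp
  show "cross7 v (a + a') = cross7 v a + cross7 v a'" "cross7 v (r *\<^sub>R a) = r *\<^sub>R cross7 v a" for a a' r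
    by (simp_all add: cross7_def vec_eq_iff linear_add[OF lin] linear_scale[OF lin])
qed

lemma linear_cross8: "linear (cross8 a b)"
  by (rule linearI) (simp_all add: cross8_def linear_add[OF linear_cliff8]
    linear_scale[OF linear_cliff8] inner_add_right algebra_simps)

lemma cross7_scaleR: "cross7 (r *\<^sub>R v) u = r *\<^sub>R cross7 v u"
proof -
  have lin: "linear (\<lambda>a. phi0 [a, u, b])" for b
    using alternating_form_linear_slot[OF alternating_phi0, of "[]" "[u, b]"] by simp
  show ?thesis by (simp add: cross7_def vec_eq_iff linear_scale[OF lin])
qed

lemma cross7_self: "cross7 v v = 0"
  using alternating_form_not_distinct[OF alternating_phi0] by (simp add: cross7_def vec_eq_iff)

lemma skew_matrix:
  fixes h :: "real^'n::finite \<Rightarrow> real^'n"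
  assumes "linear h" "\<And>a b. h a \<bullet> b = - (a \<bullet> h b)"
  shows "transpose (matrix h) = - matrix h"
proof -
  have "transpose (matrix h) $ i $ j = (- matrix h) $ i $ j" for i j
    using assms(2)[of "axis i 1" "axis j 1"]
    by (simp add: transpose_def matrix_def inner_axis inner_axis')
  then show ?thesis unfolding vec_eq_iff by blast
qed

text \<open>After normalising \<open>w\<close>, \<open>det_rank_one_kernel\<close> replaces \<open>\<eta>\<close> by the unit vector in the kernel, for which the
  matrix is orthogonal by \<open>cross7_cross7\<close>.\<close>

lemma abs_det_cross7:
  assumes w: "w \<noteq> 0"
  shows "\<bar>det (matrix (cross7 w) + outer \<eta> \<eta>)\<bar> = (w \<bullet> w)\<^sup>2 * (\<eta> \<bullet> w)\<^sup>2"
proof -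
  define r n where "r = norm w" and "n = (1 / r) *\<^sub>R w"
  have r: "r > 0" using w by (simp add: r_def)
  have wn: "w = r *\<^sub>R n" using r by (simp add: n_def)
  have nn: "n \<bullet> n = 1" using r by (simp add: n_def r_def dot_square_norm power2_eq_square)
  define N where "N = matrix (cross7 n)"
  have Nv: "N *v y = cross7 n y" for y by (simp add: N_def matrix_works linear_cross7)
  have skew: "transpose N = - N"
    unfolding N_def using linear_cross7 cross7_skew by (rule skew_matrix)
  have ker: "N *v n = 0" "transpose N *v n = 0"
    by (simp_all add: Nv cross7_self skew matrix_vector_mult_minus)
  have "\<bar>det (N + outer n n)\<bar> = 1"
  proof (rule det_skew_complement[OF skew])
    have "n \<bullet> cross7 n y = 0" for y using cross7_skew[of n n y] by (simp add: cross7_self)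
    then show "(N + outer n n) ** (outer n n - N) = mat 1"
      by (simp add: matrix_action Nv cross7_cross7 nn linear_diff[OF linear_cross7] linear_scale[OF linear_cross7] cross7_self)
  qed (simp add: transpose_outer)
  moreover have "matrix (cross7 w) + outer \<eta> \<eta> = r *\<^sub>R (N + outer ((1 / sqrt r) *\<^sub>R \<eta>) ((1 / sqrt r) *\<^sub>R \<eta>))"
    using r sqrt_scaled_outer[OF r, of \<eta>]
    by (simp add: scaleR_add_right) (simp add: N_def matrix_def vec_eq_iff wn cross7_scaleR)
  ultimately have "\<bar>det (matrix (cross7 w) + outer \<eta> \<eta>)\<bar> = r ^ 7 * ((1 / sqrt r) *\<^sub>R \<eta> \<bullet> n)\<^sup>2"
    using r det_rank_one_kernel[OF ker nn, of "(1 / sqrt r) *\<^sub>R \<eta>"]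
    by (simp only: det_scaleR abs_mult) simp
  also have "((1 / sqrt r) *\<^sub>R \<eta> \<bullet> n)\<^sup>2 = (\<eta> \<bullet> n)\<^sup>2 / r"
    using r by (simp add: power_divide)
  also have "r ^ 7 * ((\<eta> \<bullet> n)\<^sup>2 / r) = (w \<bullet> w)\<^sup>2 * (\<eta> \<bullet> w)\<^sup>2"
    using r nn by (simp add: wn eval_nat_numeral)
  finally show ?thesis .
qed

text \<open>The kernel is spanned by \<open>n\<close> and \<open>m\<close>. It is rotated so that its second basis vector \<open>q\<close> is orthogonal to
  \<open>\<xi>\<close>; then \<open>det_rank_one_kernel\<close> applies to \<open>\<eta>\<close> and \<open>q\<close>, and afterwards to \<open>\<xi>\<close> and \<open>p\<close>.\<close>

lemma det_two_kernel:
  fixes N :: "real^'n^'n::finite"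
  assumes skew: "transpose N = - N"
    and N: "N *v n = 0" "N *v m = 0" and on: "n \<bullet> n = 1" "m \<bullet> m = 1" "n \<bullet> m = 0"
    and sq: "\<And>y. N *v (N *v y) = (n \<bullet> y) *\<^sub>R n + (m \<bullet> y) *\<^sub>R m - y"
  shows "\<bar>det (N + outer \<xi> \<xi> + outer \<eta> \<eta>)\<bar> = ((\<xi> \<bullet> n) * (\<eta> \<bullet> m) - (\<xi> \<bullet> m) * (\<eta> \<bullet> n))\<^sup>2"
proof -
  define s where "s = sqrt ((\<xi> \<bullet> n)\<^sup>2 + (\<xi> \<bullet> m)\<^sup>2)"
  obtain c d where cd: "\<xi> \<bullet> n = s * c" "\<xi> \<bullet> m = s * d" "c\<^sup>2 + d\<^sup>2 = 1"
  proof (cases "s = 0")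
    case True
    then have "\<xi> \<bullet> n = 0" "\<xi> \<bullet> m = 0"
      by (auto simp: s_def sum_power2_eq_zero_iff)
    then show ?thesis using that[of 1 0] True by simp
  next
    case False
    have "s\<^sup>2 = (\<xi> \<bullet> n)\<^sup>2 + (\<xi> \<bullet> m)\<^sup>2" by (simp add: s_def)
    then have "((\<xi> \<bullet> n) / s)\<^sup>2 + ((\<xi> \<bullet> m) / s)\<^sup>2 = s\<^sup>2 / s\<^sup>2"
      by (simp only: power_divide add_divide_distrib)
    then have "((\<xi> \<bullet> n) / s)\<^sup>2 + ((\<xi> \<bullet> m) / s)\<^sup>2 = 1" using False by simp
    then show ?thesis using that[of "(\<xi> \<bullet> n) / s" "(\<xi> \<bullet> m) / s"] False by simp
  qed
  define p q where "p = c *\<^sub>R n + d *\<^sub>R m" and "q = c *\<^sub>R m - d *\<^sub>R n"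
  have mn: "m \<bullet> n = 0" using on by (simp add: inner_commute)
  have pq: "p \<bullet> p = 1" "q \<bullet> q = 1" "p \<bullet> q = 0" "q \<bullet> p = 0"
    using cd(3) on mn by (simp_all add: p_def q_def inner_add_left inner_add_right inner_diff_left
      inner_diff_right power2_eq_square algebra_simps)
  have \<xi>p: "\<xi> \<bullet> p = s" "\<xi> \<bullet> q = 0"
  proof -
    have "\<xi> \<bullet> p = s * (c\<^sup>2 + d\<^sup>2)" by (simp add: p_def inner_add_right cd power2_eq_square algebra_simps)
    then show "\<xi> \<bullet> p = s" by (simp add: cd)
    show "\<xi> \<bullet> q = 0" by (simp add: q_def inner_diff_right cd algebra_simps)
  qed
  have Npq: "N *v p = 0" "N *v q = 0"
    by (simp_all add: p_def q_def N matrix_vector_right_distrib matrix_vector_mult_diff_distrib matrix_vector_mult_scaleR)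
  have skew0: "transpose N *v y = - (N *v y)" for y by (simp add: skew matrix_vector_mult_minus)
  have eq: "(n \<bullet> y) *\<^sub>R n + (m \<bullet> y) *\<^sub>R m = (p \<bullet> y) *\<^sub>R p + (q \<bullet> y) *\<^sub>R q" for y
  proof -
    have "(p \<bullet> y) *\<^sub>R p + (q \<bullet> y) *\<^sub>R q = ((c\<^sup>2 + d\<^sup>2) * (n \<bullet> y)) *\<^sub>R n + ((c\<^sup>2 + d\<^sup>2) * (m \<bullet> y)) *\<^sub>R m"
      by (simp add: p_def q_def inner_add_left inner_diff_left power2_eq_square algebra_simps)
    then show ?thesis by (simp add: cd)
  qed
  have "\<bar>det (N + (outer p p + outer q q))\<bar> = 1"
  proof (rule det_skew_complement[OF skew])
    have pN: "p \<bullet> (N *v y) = 0" "q \<bullet> (N *v y) = 0" for y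
      using Npq skew0 by (metis dot_lmul_matrix inner_zero_left minus_zero transpose_matrix_vector)+
    show "(N + (outer p p + outer q q)) ** (outer p p + outer q q - N) = mat 1"
      by (simp add: matrix_action matrix_vector_mult_diff_distrib Npq sq pN pq eq)
  qed (simp add: transpose_add transpose_outer)
  moreover have "det (N + outer \<xi> \<xi> + outer \<eta> \<eta>) = (\<eta> \<bullet> q)\<^sup>2 * det (N + outer \<xi> \<xi> + outer q q)"
    by (rule det_rank_one_kernel)
      (simp_all add: pq transpose_add transpose_outer matrix_action skew0 Npq \<xi>p)
  moreover have "det (N + outer q q + outer \<xi> \<xi>) = (\<xi> \<bullet> p)\<^sup>2 * det (N + outer q q + outer p p)"
    by (rule det_rank_one_kernel)
      (simp_all add: pq transpose_add transpose_outer matrix_action skew0 Npq)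
  moreover have "N + outer \<xi> \<xi> + outer q q = N + outer q q + outer \<xi> \<xi>"
      "N + outer q q + outer p p = N + (outer p p + outer q q)"
    by (simp_all only: add_ac)
  ultimately have "\<bar>det (N + outer \<xi> \<xi> + outer \<eta> \<eta>)\<bar> = ((\<eta> \<bullet> q) * s)\<^sup>2"
    by (simp only: abs_mult \<xi>p power_mult_distrib) simp
  also have "(\<eta> \<bullet> q) * s = (\<xi> \<bullet> n) * (\<eta> \<bullet> m) - (\<xi> \<bullet> m) * (\<eta> \<bullet> n)"
    by (simp add: q_def inner_diff_right cd algebra_simps)
  finally show ?thesis .
qed

text \<open>Gram-Schmidt gives \<open>a \<and> b = r n \<and> m\<close> with \<open>n\<close>, \<open>m\<close> orthonormal, and multiplication by \<open>n \<and> m\<close> is a complex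
  structure on the complement of the plane, so \<open>det_two_kernel\<close> applies.\<close>

lemma abs_det_cross8:
  assumes ab: "(a \<bullet> a) * (b \<bullet> b) - (a \<bullet> b)\<^sup>2 \<noteq> 0"
  shows "\<bar>det (matrix (cross8 a b) + outer \<xi> \<xi> + outer \<eta> \<eta>)\<bar> =
    ((a \<bullet> a) * (b \<bullet> b) - (a \<bullet> b)\<^sup>2)\<^sup>2 * ((\<xi> \<bullet> a) * (\<eta> \<bullet> b) - (\<xi> \<bullet> b) * (\<eta> \<bullet> a))\<^sup>2"
proof -
  define s n where "s = norm a" and "n = (1 / s) *\<^sub>R a"
  define c t m where "c = n \<bullet> b" and "t = norm (b - c *\<^sub>R n)" and "m = (1 / t) *\<^sub>R (b - c *\<^sub>R n)"
  have s: "s > 0" using ab by (auto simp: s_def)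
  have a: "a = s *\<^sub>R n" using s by (simp add: n_def)
  have nn: "n \<bullet> n = 1" using s by (simp add: n_def s_def dot_square_norm power2_eq_square)
  have t2: "(b - c *\<^sub>R n) \<bullet> (b - c *\<^sub>R n) = b \<bullet> b - c\<^sup>2"
    using nn by (simp add: inner_diff_left inner_diff_right c_def inner_commute power2_eq_square)
  have "(a \<bullet> a) * (b \<bullet> b) - (a \<bullet> b)\<^sup>2 = s\<^sup>2 * (b \<bullet> b - c\<^sup>2)"
    using nn by (simp add: a c_def power2_eq_square algebra_simps)
  then have D: "(a \<bullet> a) * (b \<bullet> b) - (a \<bullet> b)\<^sup>2 = (s * t)\<^sup>2"
    by (simp add: t_def power_mult_distrib power2_norm_eq_inner t2)
  then have t: "t > 0" using ab s by (auto simp: t_def)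
  have b: "b = c *\<^sub>R n + t *\<^sub>R m" using t by (simp add: m_def)
  have mm: "m \<bullet> m = 1"
    using t by (simp add: m_def) (metis dot_square_norm nonzero_eq_divide_eq power2_eq_square t_def
        less_irrefl mult_eq_0_iff divide_self_if times_divide_eq_right mult.commute)
  have nm: "n \<bullet> m = 0" "m \<bullet> n = 0"
    using nn by (simp_all add: m_def inner_diff_right inner_diff_left c_def inner_commute)
  define r where "r = s * t"
  have r: "r > 0" using s t by (simp add: r_def)
  define N where "N = matrix (cross8 n m)"
  have Nv: "N *v y = cross8 n m y" for y by (simp add: N_def matrix_works linear_cross8)
  have sk: "cross8 n m x \<bullet> y = - (x \<bullet> cross8 n m y)" for x y
    using alternating_form_swap[OF alternating_psi0, of "[n, m]" "[]" x y]
    by (simp add: psi0_cross8 inner_commute)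
  have ker: "N *v n = 0" "N *v m = 0"
    by (simp_all add: Nv cross8_def cliff8_pair8 cliff8_pair8_right nn mm nm)
  have sq: "N *v (N *v y) = (n \<bullet> y) *\<^sub>R n + (m \<bullet> y) *\<^sub>R m - y" for y
  proof -
    have 0: "n \<bullet> cross8 n m y = 0" "m \<bullet> cross8 n m y = 0"
      using sk[of y n] sk[of y m] ker by (simp_all add: Nv inner_commute)
    have "N *v (N *v y) = cliff8 (pair8 n m) (cross8 n m y)"
      by (simp add: Nv cross8_def[of n m "cross8 n m y"] 0)
    also have "\<dots> = (n \<bullet> y) *\<^sub>R n + (m \<bullet> y) *\<^sub>R m - y"
      by (simp add: cross8_def linear_add[OF linear_cliff8] linear_diff[OF linear_cliff8]
        linear_scale[OF linear_cliff8] cliff8_cliff8 pair8_nth norm_pair8 cliff8_pair8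
        cliff8_pair8_right nn mm nm)
    finally show ?thesis .
  qed
  have cr: "cross8 a b y = r *\<^sub>R cross8 n m y" for y
  proof -
    have "pair8 a b = r *\<^sub>R pair8 n m"
    proof -
      have "pair8 n n = 0" using norm_pair8[of n n] by (simp add: power2_eq_square)
      then show ?thesis
        by (simp add: a b r_def linear_add[OF linear_pair8] linear_scale[OF linear_pair8]
          linear_scale[OF linear_pair8_left])
    qed
    moreover have "cliff8 (r *\<^sub>R p) y = r *\<^sub>R cliff8 p y" for p by (simp add: cliff8_def vec_eq_iff)
    ultimately show ?thesis
      by (simp add: cross8_def) (simp add: a b r_def inner_add_left algebra_simps)
  qed
  have "matrix (cross8 a b) + outer \<xi> \<xi> + outer \<eta> \<eta> =
      r *\<^sub>R (N + outer ((1 / sqrt r) *\<^sub>R \<xi>) ((1 / sqrt r) *\<^sub>R \<xi>) + outer ((1 / sqrt r) *\<^sub>R \<eta>) ((1 / sqrt r) *\<^sub>R \<eta>))"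
    using sqrt_scaled_outer[OF r, of \<xi>] sqrt_scaled_outer[OF r, of \<eta>]
    by (simp add: scaleR_add_right) (simp add: N_def matrix_def vec_eq_iff cr)
  then have "\<bar>det (matrix (cross8 a b) + outer \<xi> \<xi> + outer \<eta> \<eta>)\<bar> =
     r ^ 8 * (((1 / sqrt r) *\<^sub>R \<xi> \<bullet> n) * ((1 / sqrt r) *\<^sub>R \<eta> \<bullet> m) - ((1 / sqrt r) *\<^sub>R \<xi> \<bullet> m) * ((1 / sqrt r) *\<^sub>R \<eta> \<bullet> n))\<^sup>2"
    using r det_two_kernel[OF skew_matrix[OF linear_cross8 sk, folded N_def] ker nn mm nm(1) sq]
    by (simp only: det_scaleR abs_mult) simp
  also have "((1 / sqrt r) *\<^sub>R \<xi> \<bullet> n) * ((1 / sqrt r) *\<^sub>R \<eta> \<bullet> m) - ((1 / sqrt r) *\<^sub>R \<xi> \<bullet> m) * ((1 / sqrt r) *\<^sub>R \<eta> \<bullet> n)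
     = ((\<xi> \<bullet> n) * (\<eta> \<bullet> m) - (\<xi> \<bullet> m) * (\<eta> \<bullet> n)) / r"
    using r by (simp add: diff_divide_distrib)
  also have "r ^ 8 * (((\<xi> \<bullet> n) * (\<eta> \<bullet> m) - (\<xi> \<bullet> m) * (\<eta> \<bullet> n)) / r)\<^sup>2 =
     (r\<^sup>2)\<^sup>2 * (r * ((\<xi> \<bullet> n) * (\<eta> \<bullet> m) - (\<xi> \<bullet> m) * (\<eta> \<bullet> n)))\<^sup>2"
    using r by (simp add: power_divide power_mult_distrib) (simp add: eval_nat_numeral)
  also have "r * ((\<xi> \<bullet> n) * (\<eta> \<bullet> m) - (\<xi> \<bullet> m) * (\<eta> \<bullet> n)) = (\<xi> \<bullet> a) * (\<eta> \<bullet> b) - (\<xi> \<bullet> b) * (\<eta> \<bullet> a)"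
    by (simp add: a b r_def inner_add_right algebra_simps)
  finally show ?thesis by (simp add: D r_def)
qed

section \<open>Recovering the metric from the form\<close>

definition slot_matrix :: "('n::finite) form \<Rightarrow> (real^'n) list \<Rightarrow> real^'n^'n" where
  "slot_matrix \<alpha> us = (\<chi> i j. \<alpha> (us @ [axis j 1, axis i 1]))"

text \<open>The matrix of the form changes by congruence with the matrix of \<open>f\<close>. With \<open>outer_pullback\<close>, which says the
  same of the added rank-one matrices, the determinants of the model are multiplied by \<open>det f\<^sup>2\<close>.\<close>

lemma slot_matrix_pullback:
  assumes f: "linear f" and N: "\<And>x y. \<alpha> (us @ [x, y]) = (N *v f x) \<bullet> f y"
  shows "slot_matrix \<alpha> us = transpose (matrix f) ** N ** matrix f"
proof -
  have F: "matrix f *v x = f x" for x by (simp add: matrix_works f)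
  have "(transpose (matrix f) ** N ** matrix f) $ i $ j = (N *v f (axis j 1)) \<bullet> f (axis i 1)" for i j
  proof -
    have "(transpose (matrix f) ** N ** matrix f) $ i $ j
        = axis i 1 \<bullet> ((transpose (matrix f) ** N ** matrix f) *v axis j 1)"
      by (simp add: inner_axis' matrix_vector_mul_component inner_axis)
    also have "\<dots> = axis i 1 \<bullet> (transpose (matrix f) *v (N *v f (axis j 1)))"
      by (simp add: F flip: matrix_vector_mul_assoc)
    also have "\<dots> = f (axis i 1) \<bullet> (N *v f (axis j 1))"
      by (simp add: transpose_matrix_vector inner_commute[of "axis i 1"] dot_lmul_matrix F)
        (simp add: inner_commute)
    finally show ?thesis by (simp add: inner_commute)
  qed
  then show ?thesis by (simp add: slot_matrix_def vec_eq_iff N)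
qed

lemma outer_pullback:
  fixes f :: "real^'n::finite \<Rightarrow> real^'n"
  assumes f: "linear f" and \<eta>: "\<And>v. \<eta> \<bullet> f v = \<xi> \<bullet> v"
  shows "outer \<xi> \<xi> = transpose (matrix f) ** outer \<eta> \<eta> ** matrix f"
proof -
  have "(transpose (matrix f) *v \<eta>) \<bullet> v = \<xi> \<bullet> v" for v
    using \<eta>[of v] by (simp add: transpose_matrix_vector dot_lmul_matrix matrix_works f)
  then have "transpose (matrix f) *v \<eta> = \<xi>" by (metis vector_eq_rdot)
  then show ?thesis by (simp add: mult_outer outer_mult)
qed

lemma bij_transport_covector:
  fixes f :: "real^'n::finite \<Rightarrow> real^'n"
  assumes "linear f" "bij f"
  obtains \<eta> where "\<And>v. \<eta> \<bullet> f v = \<xi> \<bullet> v"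
proof
  show "adjoint (inv f) \<xi> \<bullet> f v = \<xi> \<bullet> v" for v
    using adjoint_works[OF inj_linear_imp_inv_linear[OF assms(1)], of "f v" \<xi>] assms(2)
    by (simp add: bij_is_inj inner_commute)
qed

text \<open>The form alone determines \<open>|det f| |f v|\<^sup>2\<close>, the squared length of \<open>v\<close> multiplied by the volume density.\<close>

definition g2_weighted_norm :: "7 form \<Rightarrow> real^7 \<Rightarrow> real" where
  "g2_weighted_norm \<alpha> v = sqrt \<bar>det (slot_matrix \<alpha> [v] + outer v v)\<bar> / (v \<bullet> v)"

lemma det_slot_matrix_g2:
  assumes f: "adapted 3 phi0 \<alpha> f" and v: "v \<noteq> 0"
  shows "\<bar>det (slot_matrix \<alpha> [v] + outer v v)\<bar> = (det (matrix f) * (f v \<bullet> f v) * (v \<bullet> v))\<^sup>2"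
proof -
  have lin: "linear f" and bij: "bij f" and *: "\<forall>vs. length vs = 3 \<longrightarrow> phi0 (map f vs) = \<alpha> vs"
    using f by (auto simp: adapted_def)
  have \<alpha>: "\<alpha> [u, v, w] = phi0 [f u, f v, f w]" for u v w using spec[OF *, of "[u, v, w]"] by simp
  obtain \<eta> where \<eta>: "\<And>w. \<eta> \<bullet> f w = v \<bullet> w" using bij_transport_covector[OF lin bij] by blast
  have "slot_matrix \<alpha> [v] = transpose (matrix f) ** matrix (cross7 (f v)) ** matrix f"
    by (rule slot_matrix_pullback[OF lin]) (simp add: \<alpha> phi0_cross7 matrix_works linear_cross7)
  then have "slot_matrix \<alpha> [v] + outer v v =
      transpose (matrix f) ** (matrix (cross7 (f v)) + outer \<eta> \<eta>) ** matrix f"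
    by (simp only: outer_pullback[OF lin \<eta>]) (simp add: matrix_action)
  moreover have "f v \<noteq> 0" using v bij lin by (metis bij_is_inj injD linear_0)
  ultimately show ?thesis
    by (simp add: det_mul abs_mult abs_det_cross7 \<eta> power_mult_distrib) (simp add: power2_eq_square)
qed

lemma g2_weighted_norm:
  assumes f: "adapted 3 phi0 \<alpha> f"
  shows "g2_weighted_norm \<alpha> v = \<bar>det (matrix f)\<bar> * (f v \<bullet> f v)"
proof (cases "v = 0")
  case True
  have "f 0 = 0" using f by (simp add: adapted_def linear_0)
  then show ?thesis using True by (simp add: g2_weighted_norm_def)
qed (simp add: g2_weighted_norm_def det_slot_matrix_g2[OF f] abs_mult)

definition area :: "('a::real_vector \<Rightarrow> 'b::real_inner) \<Rightarrow> 'a \<Rightarrow> 'a \<Rightarrow> real" where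
  "area f v w = (f v \<bullet> f v) * (f w \<bullet> f w) - (f v \<bullet> f w)\<^sup>2"

lemma area_eq_0_imp_parallel:
  assumes lin: "linear f" and inj: "inj f" and z: "area f v w = 0" and v: "v \<noteq> 0"
  obtains c where "w = c *\<^sub>R v"
proof -
  define A p where "A = f v \<bullet> f v" and "p = f v \<bullet> f w"
  have "f v \<noteq> 0" using v inj lin by (metis injD linear_0)
  then have A: "A \<noteq> 0" by (simp add: A_def)
  have "(A *\<^sub>R f w - p *\<^sub>R f v) \<bullet> (A *\<^sub>R f w - p *\<^sub>R f v) = A * area f v w"
    by (simp add: area_def A_def p_def inner_diff_left inner_diff_right inner_commute[of "f w" "f v"]
      power2_eq_square algebra_simps)
  then have "f (A *\<^sub>R w - p *\<^sub>R v) = 0" using z lin by (simp add: linear_diff linear_scale)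
  then have "A *\<^sub>R w = p *\<^sub>R v" using inj lin linear_injective_0 by fastforce
  then have "(1 / A) *\<^sub>R (A *\<^sub>R w) = (p / A) *\<^sub>R v" by simp
  then have "w = (p / A) *\<^sub>R v" using A by simp
  then show thesis by (rule that)
qed

lemma area_eq_0:
  assumes lin: "linear f" "linear g" and inj: "inj f" and z: "area f v w = 0"
  shows "area g v w = 0"
proof (cases "v = 0")
  case True
  then show ?thesis using lin by (simp add: area_def linear_0)
next
  case False
  then obtain c where "w = c *\<^sub>R v" using area_eq_0_imp_parallel[OF lin(1) inj z] by blast
  then show ?thesis using lin by (simp add: area_def linear_scale power2_eq_square)
qed

lemma area_nonneg: "area f v w \<ge> 0"
  using Cauchy_Schwarz_ineq[of "f v" "f w"] by (simp add: area_def)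

text \<open>The form alone determines the squared area of the parallelogram spanned by \<open>v\<close> and \<open>w\<close>, multiplied by the
  volume density. For parallel vectors the default value \<open>0\<close> of the quotient is the right one.\<close>

definition spin7_weighted_area :: "8 form \<Rightarrow> real^8 \<Rightarrow> real^8 \<Rightarrow> real" where
  "spin7_weighted_area \<alpha> v w =
     sqrt \<bar>det (slot_matrix \<alpha> [v, w] + outer v v + outer w w)\<bar> / area id v w"

lemma det_slot_matrix_spin7:
  assumes f: "adapted 4 psi0 \<alpha> f" and vw: "area id v w \<noteq> 0"
  shows "\<bar>det (slot_matrix \<alpha> [v, w] + outer v v + outer w w)\<bar> = (det (matrix f) * area f v w * area id v w)\<^sup>2"
proof -
  have lin: "linear f" and bij: "bij f" and *: "\<forall>vs. length vs = 4 \<longrightarrow> psi0 (map f vs) = \<alpha> vs"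
    using f by (auto simp: adapted_def)
  have \<alpha>: "\<alpha> [u, v, w, x] = psi0 [f u, f v, f w, f x]" for u v w x
    using spec[OF *, of "[u, v, w, x]"] by simp
  obtain \<xi> where \<xi>: "\<And>u. \<xi> \<bullet> f u = v \<bullet> u" using bij_transport_covector[OF lin bij] by blast
  obtain \<eta> where \<eta>: "\<And>u. \<eta> \<bullet> f u = w \<bullet> u" using bij_transport_covector[OF lin bij] by blast
  have "slot_matrix \<alpha> [v, w] = transpose (matrix f) ** matrix (cross8 (f v) (f w)) ** matrix f"
    by (rule slot_matrix_pullback[OF lin]) (simp add: \<alpha> psi0_cross8 matrix_works linear_cross8)
  then have "slot_matrix \<alpha> [v, w] + outer v v + outer w w =
      transpose (matrix f) ** (matrix (cross8 (f v) (f w)) + outer \<xi> \<xi> + outer \<eta> \<eta>) ** matrix f"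
    by (simp only: outer_pullback[OF lin \<xi>] outer_pullback[OF lin \<eta>]) (simp add: matrix_action)
  moreover have "area f v w \<noteq> 0"
    using area_eq_0[OF lin linear_id bij_is_inj[OF bij]] vw by blast
  then have "\<bar>det (matrix (cross8 (f v) (f w)) + outer \<xi> \<xi> + outer \<eta> \<eta>)\<bar> =
      (area f v w)\<^sup>2 * (area id v w)\<^sup>2"
    using abs_det_cross8[of "f v" "f w" \<xi> \<eta>] by (simp add: area_def \<xi> \<eta> inner_commute power2_eq_square)
  ultimately show ?thesis
    by (simp add: det_mul abs_mult power_mult_distrib) (simp add: power2_eq_square)
qed

lemma spin7_weighted_area:
  assumes f: "adapted 4 psi0 \<alpha> f"
  shows "spin7_weighted_area \<alpha> v w = \<bar>det (matrix f)\<bar> * area f v w"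
proof (cases "area id v w = 0")
  case True
  then have "area f v w = 0"
    using f area_eq_0[OF linear_id, of f v w] by (simp add: adapted_def)
  then show ?thesis using True by (simp add: spin7_weighted_area_def)
qed (simp add: spin7_weighted_area_def det_slot_matrix_spin7[OF f] abs_mult area_nonneg)

lemma inner_polarize:
  assumes "linear f"
  shows "f u \<bullet> f v = (f (u + v) \<bullet> f (u + v) - f u \<bullet> f u - f v \<bullet> (f v :: 'b::real_inner)) / 2"
  using assms by (simp add: linear_add inner_add_left inner_add_right inner_commute)

lemma det_gram:
  fixes f :: "real^'n::finite \<Rightarrow> real^'n"
  shows "det (\<chi> i j. f (axis i 1) \<bullet> f (axis j 1)) = (det (matrix f))\<^sup>2"
proof -
  have "(\<chi> i j. f (axis i 1) \<bullet> f (axis j 1)) = transpose (matrix f) ** matrix f"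
    by (simp add: vec_eq_iff matrix_matrix_mult_def transpose_def matrix_def inner_vec_def)
  then show ?thesis by (simp add: det_mul power2_eq_square)
qed

lemma det_gram_scaled:
  fixes f :: "real^'n::finite \<Rightarrow> real^'n"
  assumes "\<And>i j. f (axis i 1) \<bullet> f (axis j 1) = c * A $ i $ j"
  shows "(det (matrix f))\<^sup>2 = c ^ CARD('n) * det A"
proof -
  have "(\<chi> i j. f (axis i 1) \<bullet> f (axis j 1)) = c *\<^sub>R A" by (simp add: vec_eq_iff assms)
  then show ?thesis by (metis det_gram det_scaleR)
qed

lemma adapted_linear: "adapted k \<alpha>\<^sub>0 \<alpha> f \<Longrightarrow> linear f"
  and adapted_bij: "adapted k \<alpha>\<^sub>0 \<alpha> f \<Longrightarrow> bij f"
  by (simp_all add: adapted_def)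

lemma adapted_det_pos: "adapted k \<alpha>\<^sub>0 \<alpha> f \<Longrightarrow> \<bar>det (matrix f)\<bar> > 0"
  by (metis adapted_bij adapted_linear bij_is_inj det_nz_iff_inj zero_less_abs_iff)

lemma adapted_nonzero: "adapted k \<alpha>\<^sub>0 \<alpha> f \<Longrightarrow> v \<noteq> 0 \<Longrightarrow> f v \<bullet> f v > 0"
  by (metis adapted_bij adapted_linear bij_is_inj injD inner_gt_zero_iff linear_0)

text \<open>The second equation recovers the conformal factor from the volumes.\<close>

lemma conformal_frames:
  fixes f f' :: "real^'n::finite \<Rightarrow> real^'n"
  assumes lin: "linear f" "linear f'" and c: "\<And>v. f v \<bullet> f v = c * (f' v \<bullet> f' v)"
  shows "f u \<bullet> f v = c * (f' u \<bullet> f' v)" "(det (matrix f))\<^sup>2 = c ^ CARD('n) * (det (matrix f'))\<^sup>2"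
proof -
  show *: "f u \<bullet> f v = c * (f' u \<bullet> f' v)" for u v
    by (simp add: inner_polarize[OF lin(1), of u v] inner_polarize[OF lin(2), of u v] c algebra_simps)
  show "(det (matrix f))\<^sup>2 = c ^ CARD('n) * (det (matrix f'))\<^sup>2"
    using det_gram_scaled[of f c "\<chi> i j. f' (axis i 1) \<bullet> f' (axis j 1)"] by (simp add: * det_gram)
qed

text \<open>By \<open>g2_weighted_norm\<close> two adapted frames are conformal with factor the ratio of their determinants \<open>b / a\<close>; so
  \<open>a\<^sup>2 = (b / a)\<^sup>7 b\<^sup>2\<close> and the factor is 1.\<close>

lemma g2_inner_unique:
  assumes f: "adapted 3 phi0 \<alpha> f" and f': "adapted 3 phi0 \<alpha> f'"
  shows "f u \<bullet> f v = f' u \<bullet> f' v"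
proof -
  define a b where "a = \<bar>det (matrix f)\<bar>" and "b = \<bar>det (matrix f')\<bar>"
  have pos: "a > 0" "b > 0" unfolding a_def b_def by (rule adapted_det_pos, fact)+
  have c: "f v \<bullet> f v = (b / a) * (f' v \<bullet> f' v)" for v
    using g2_weighted_norm[OF f, of v] g2_weighted_norm[OF f', of v] pos
    by (simp add: a_def b_def field_simps)
  note * = conformal_frames[OF adapted_linear[OF f] adapted_linear[OF f'] c]
  have "a\<^sup>2 = (b / a) ^ 7 * b\<^sup>2" using *(2) by (simp add: a_def b_def)
  then have "a\<^sup>2 * a ^ 7 = b ^ 7 * b\<^sup>2" using pos by (simp add: power_divide field_simps)
  then have "a ^ 9 = b ^ 9" by (simp flip: power_add)
  then have "a = b" using pos by (metis less_imp_le power_eq_iff_eq_base zero_less_numeral)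
  then show ?thesis using *(1) pos by simp
qed

definition gram3 :: "('a \<Rightarrow> 'b::real_inner) \<Rightarrow> 'a \<Rightarrow> 'a \<Rightarrow> 'a \<Rightarrow> real" where
  "gram3 f u v w = (f u \<bullet> f u) * (f v \<bullet> f v) * (f w \<bullet> f w) + 2 * (f u \<bullet> f v) * (f v \<bullet> f w) * (f u \<bullet> f w)
     - (f u \<bullet> f u) * (f v \<bullet> f w)\<^sup>2 - (f v \<bullet> f v) * (f u \<bullet> f w)\<^sup>2 - (f w \<bullet> f w) * (f u \<bullet> f v)\<^sup>2"

text \<open>The determinant of the weighted area form on \<open>u \<and> v\<close> and \<open>u \<and> w\<close>, with the mixed entry obtained by
  polarisation. By Jacobi's identity for complementary
  minors it is the Gram determinant of \<open>u\<close>, \<open>v\<close>, \<open>w\<close> times \<open>|u|\<^sup>2\<close> and a density; as the Gram determinant is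
  symmetric, quotients of such determinants are ratios of squared lengths.\<close>

definition spin7_minor :: "8 form \<Rightarrow> real^8 \<Rightarrow> real^8 \<Rightarrow> real^8 \<Rightarrow> real" where
  "spin7_minor \<alpha> u v w = spin7_weighted_area \<alpha> u v * spin7_weighted_area \<alpha> u w
     - ((spin7_weighted_area \<alpha> u (v + w) - spin7_weighted_area \<alpha> u v - spin7_weighted_area \<alpha> u w) / 2)\<^sup>2"

lemma spin7_minor:
  assumes f: "adapted 4 psi0 \<alpha> f"
  shows "spin7_minor \<alpha> u v w = (det (matrix f))\<^sup>2 * (f u \<bullet> f u) * gram3 f u v w"
proof -
  define D where "D = \<bar>det (matrix f)\<bar>"
  have p: "(area f u (v + w) - area f u v - area f u w) / 2 = (f u \<bullet> f u) * (f v \<bullet> f w) - (f u \<bullet> f v) * (f u \<bullet> f w)"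
    using adapted_linear[OF f]
    by (simp add: area_def linear_add inner_add_left inner_add_right inner_commute[of "f w" "f v"]
      power2_eq_square field_simps)
  have "spin7_minor \<alpha> u v w = D\<^sup>2 * (area f u v * area f u w - ((area f u (v + w) - area f u v - area f u w) / 2)\<^sup>2)"
    unfolding spin7_minor_def spin7_weighted_area[OF f] D_def[symmetric]
    by (simp add: power2_eq_square algebra_simps)
  also have "\<dots> = D\<^sup>2 * ((f u \<bullet> f u) * gram3 f u v w)"
    unfolding p by (simp add: area_def gram3_def power2_eq_square algebra_simps)
  finally show ?thesis by (simp add: D_def)
qed

lemma gram3_commute: "gram3 f v u w = gram3 f u v w"
  by (simp add: gram3_def inner_commute algebra_simps)

lemma spin7_minor_ratio:
  assumes f: "adapted 4 psi0 \<alpha> f"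
  shows "spin7_minor \<alpha> u v w * (f v \<bullet> f v) = spin7_minor \<alpha> v u w * (f u \<bullet> f u)"
  by (simp add: spin7_minor[OF f] gram3_commute[of f v u])

lemma independent_third:
  fixes f :: "real^'n::finite \<Rightarrow> real^'n"
  assumes f: "linear f" "bij f" and uv: "area f u v \<noteq> 0" and n: "CARD('n) > 2"
  obtains w where "gram3 f u v w \<noteq> 0"
proof -
  have "dim {f u, f v} < DIM(real^'n)"
    using dim_le_card[of "{f u, f v}" "{f u, f v}"] n card_insert_le_m1[of 2 "{f v}" "f u"]
    by (auto simp: span_superset)
  then obtain z where z: "z \<noteq> 0" "\<And>y. y \<in> span {f u, f v} \<Longrightarrow> orthogonal z y"
    using orthogonal_to_subspace_exists[of "{f u, f v}"] by blast
  have o: "f u \<bullet> z = 0" "f v \<bullet> z = 0"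
    using z(2)[of "f u"] z(2)[of "f v"] by (simp_all add: span_base orthogonal_def inner_commute)
  have "f (inv f z) = z" using f by (simp add: bij_is_surj surj_f_inv_f)
  then have "gram3 f u v (inv f z) = (z \<bullet> z) * area f u v"
    by (simp add: gram3_def area_def o algebra_simps)
  then show thesis using that[of "inv f z"] z uv by simp
qed

text \<open>The minors of areas determine all ratios of squared lengths, so two adapted frames are conformal. The
  factor \<open>c\<close> is 1 because volumes give \<open>a = c\<^sup>4 b\<close> and weighted areas \<open>a c\<^sup>2 = b\<close>.\<close>

lemma spin7_inner_unique:
  assumes f: "adapted 4 psi0 \<alpha> f" and f': "adapted 4 psi0 \<alpha> f'"
  shows "f u \<bullet> f v = f' u \<bullet> f' v"
proof -
  define a b where "a = \<bar>det (matrix f)\<bar>" and "b = \<bar>det (matrix f')\<bar>"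
  have pos: "a > 0" "b > 0" unfolding a_def b_def by (rule adapted_det_pos, fact)+
  note lin = adapted_linear[OF f] adapted_linear[OF f']
  define e e' where "e = axis (0::8) (1::real)" and "e' = axis (1::8) (1::real)"
  have e: "e \<noteq> 0" by (simp add: e_def)
  define c where "c = (f e \<bullet> f e) / (f' e \<bullet> f' e)"
  have c: "f u \<bullet> f u = c * (f' u \<bullet> f' u)" for u
  proof -
    have "(f u \<bullet> f u) * (f' e \<bullet> f' e) = (f' u \<bullet> f' u) * (f e \<bullet> f e)"
    proof (cases "area f e u = 0")
      case True
      then obtain r where "u = r *\<^sub>R e"
        using area_eq_0_imp_parallel[OF lin(1) bij_is_inj[OF adapted_bij[OF f]] _ e] by blast
      then show ?thesis using lin by (simp add: linear_scale)
    next
      case False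
      then obtain w where w: "gram3 f e u w \<noteq> 0"
        using independent_third[OF lin(1) adapted_bij[OF f]] by auto
      have m: "spin7_minor \<alpha> u e w * (f e \<bullet> f e) = spin7_minor \<alpha> e u w * (f u \<bullet> f u)"
        "spin7_minor \<alpha> u e w * (f' e \<bullet> f' e) = spin7_minor \<alpha> e u w * (f' u \<bullet> f' u)"
        by (rule spin7_minor_ratio[OF f], rule spin7_minor_ratio[OF f'])
      have "spin7_minor \<alpha> e u w * ((f u \<bullet> f u) * (f' e \<bullet> f' e)) =
          (spin7_minor \<alpha> u e w * (f e \<bullet> f e)) * (f' e \<bullet> f' e)"
        unfolding m by simp
      also have "\<dots> = (spin7_minor \<alpha> u e w * (f' e \<bullet> f' e)) * (f e \<bullet> f e)" by simp
      also have "\<dots> = spin7_minor \<alpha> e u w * ((f' u \<bullet> f' u) * (f e \<bullet> f e))"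
        unfolding m by simp
      finally have "spin7_minor \<alpha> e u w * ((f u \<bullet> f u) * (f' e \<bullet> f' e)) =
          spin7_minor \<alpha> e u w * ((f' u \<bullet> f' u) * (f e \<bullet> f e))" .
      moreover have "spin7_minor \<alpha> e u w \<noteq> 0"
        using w pos(1) adapted_nonzero[OF f e] by (simp add: spin7_minor[OF f] a_def)
      ultimately show ?thesis by simp
    qed
    then show ?thesis using adapted_nonzero[OF f' e] by (simp add: c_def field_simps)
  qed
  have c0: "c > 0" unfolding c_def using adapted_nonzero[OF f e] adapted_nonzero[OF f' e] by simp
  note * = conformal_frames[OF lin c]
  have "a\<^sup>2 = (c ^ 4 * b)\<^sup>2" using *(2) by (simp add: a_def b_def power_mult_distrib flip: power_mult)
  then have "a = c ^ 4 * b" using pos c0 by (simp add: power2_eq_iff_nonneg)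
  moreover have "area f' e e' \<noteq> 0"
    using area_eq_0[OF lin(2) linear_id bij_is_inj[OF adapted_bij[OF f']], of e e']
    by (auto simp: area_def e_def e'_def inner_axis_axis)
  moreover have "a * area f e e' = b * area f' e e'"
    using spin7_weighted_area[OF f, of e e'] spin7_weighted_area[OF f', of e e'] by (simp add: a_def b_def)
  moreover have "area f e e' = c\<^sup>2 * area f' e e'"
    by (simp add: area_def *(1) power2_eq_square algebra_simps)
  ultimately have "c ^ 4 * c\<^sup>2 = 1" using pos by simp
  then have "c ^ 6 = 1 ^ 6" by (simp flip: power_add)
  then have "c = 1" using c0 by (metis less_imp_le power_eq_iff_eq_base zero_less_numeral zero_le_one)
  then show ?thesis using *(1) by simp
qed

section \<open>Differentiability of the recovered metric\<close>

lemma differentiable_transform_eventually: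
  assumes "f differentiable (at x)" "\<forall>\<^sub>F y in nhds x. g y = f y"
  shows "g differentiable (at x)"
proof -
  obtain D where "(f has_derivative D) (at x)" using assms(1) by (auto simp: differentiable_def)
  then have "(g has_derivative D) (at x)"
    using assms(2) eventually_nhds_x_imp_x[OF assms(2)]
    by (elim has_derivative_transform_eventually)
      (auto simp: eventually_at_filter elim: eventually_mono)
  then show ?thesis by (auto simp: differentiable_def)
qed

lemma differentiable_eventually_pos:
  fixes h :: "'a::real_normed_vector \<Rightarrow> real"
  assumes "h differentiable (at x)" "h x > 0"
  shows "\<forall>\<^sub>F y in nhds x. h y > 0"
proof -
  have "isCont h x" using assms(1) by (rule differentiable_imp_continuous_within)
  then show ?thesis
    using assms(2) order_tendstoD(1)[of h "h x" "nhds x" 0]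
    by (simp add: isCont_def tendsto_at_iff_tendsto_nhds)
qed

lemma differentiable_compose_real:
  fixes h :: "'a::real_normed_vector \<Rightarrow> real"
  assumes "h differentiable (at x)" "(F has_real_derivative D) (at (h x))"
  shows "(\<lambda>y. F (h y)) differentiable (at x)"
  using differentiable_compose[of F h x UNIV] assms has_field_derivative_imp_has_derivative differentiableI
  by blast

lemma differentiable_powr:
  fixes h :: "'a::real_normed_vector \<Rightarrow> real"
  assumes "h differentiable (at x)" "h x > 0"
  shows "(\<lambda>y. h y powr a) differentiable (at x)"
  using differentiable_compose_real[OF assms(1) has_real_derivative_powr[OF assms(2)]] .

lemma power_powr:
  assumes "(g::real) > 0"
  shows "(g ^ n) powr a = g powr (real n * a)"
proof -
  have "(g ^ n) powr a = (g powr real n) powr a" using assms by (simp add: powr_realpow)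
  then show ?thesis by (simp only: powr_powr)
qed

lemma differentiable_sqrt_abs:
  fixes h :: "'a::real_normed_vector \<Rightarrow> real"
  assumes "h differentiable (at x)" "h x \<noteq> 0"
  shows "(\<lambda>y. sqrt \<bar>h y\<bar>) differentiable (at x)"
proof -
  have pos: "(\<lambda>y. sqrt \<bar>k y\<bar>) differentiable (at x)"
    if k: "k differentiable (at x)" "k x > 0" for k :: "'a \<Rightarrow> real"
    by (rule differentiable_transform_eventually[OF
        differentiable_compose_real[OF k(1) DERIV_real_sqrt[OF k(2)]]])
      (use differentiable_eventually_pos[OF k] in \<open>auto elim: eventually_mono\<close>)
  from assms(2) consider "h x > 0" | "- h x > 0" by linarith
  then show ?thesis
  proof cases
    case 2
    then show ?thesis using pos[of "\<lambda>y. - h y"] assms(1) by simp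
  qed (use pos assms in simp)
qed

lemma differentiable_prod:
  fixes f :: "'i \<Rightarrow> 'a::real_normed_vector \<Rightarrow> real"
  assumes "\<And>i. i \<in> I \<Longrightarrow> f i differentiable (at x)"
  shows "(\<lambda>y. \<Prod>i\<in>I. f i y) differentiable (at x)"
  using assms by (induction I rule: infinite_finite_induct) auto

lemma differentiable_det:
  fixes A :: "'a::real_normed_vector \<Rightarrow> real^'n^'n::finite"
  assumes "\<And>i j. (\<lambda>y. A y $ i $ j) differentiable (at x)"
  shows "(\<lambda>y. det (A y)) differentiable (at x)"
  unfolding det_def
  by (intro differentiable_sum differentiable_mult differentiable_const differentiable_prod assms
    finite_permutations finite ballI)

text \<open>The frames \<open>F y\<close> may jump with \<open>y\<close>, but their inner products are functions of the coefficients of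
  the form. The weighted inner product \<open>B = |det F| \<langle>F u, F v\<rangle>\<close> is the polarisation of
  \<open>g2_weighted_norm\<close>, and its determinant is \<open>|det F|\<^sup>9\<close>.\<close>

lemma g2_inner_differentiable:
  assumes ev: "\<forall>\<^sub>F y in nhds x. adapted 3 phi0 (\<omega> y) (F y)"
    and \<omega>: "\<And>vs. length vs = 3 \<Longrightarrow> (\<lambda>y. \<omega> y vs) differentiable (at x)"
  shows "(\<lambda>y. F y u \<bullet> F y v) differentiable (at x)"
proof -
  have x: "adapted 3 phi0 (\<omega> x) (F x)" using ev by (rule eventually_nhds_x_imp_x)
  have q: "(\<lambda>y. g2_weighted_norm (\<omega> y) v) differentiable (at x)" for v
  proof (cases "v = 0")
    case False
    have "(\<lambda>y. det (slot_matrix (\<omega> y) [v] + outer v v)) differentiable (at x)"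
      by (rule differentiable_det) (auto simp: slot_matrix_def intro!: \<omega> differentiable_add)
    moreover have "det (slot_matrix (\<omega> x) [v] + outer v v) \<noteq> 0"
      using det_slot_matrix_g2[OF x False] adapted_det_pos[OF x] adapted_nonzero[OF x False] False by auto
    ultimately show ?thesis
      unfolding g2_weighted_norm_def divide_inverse
      by (intro differentiable_mult differentiable_sqrt_abs differentiable_const)
  qed (simp add: g2_weighted_norm_def)
  define B where "B y u v = (g2_weighted_norm (\<omega> y) (u + v) - g2_weighted_norm (\<omega> y) u - g2_weighted_norm (\<omega> y) v) / 2" for y u v
  have dB: "(\<lambda>y. B y u v) differentiable (at x)" for u v
    unfolding B_def divide_inverse by (intro differentiable_mult differentiable_diff differentiable_const q)
  have B: "B y u v = \<bar>det (matrix (F y))\<bar> * (F y u \<bullet> F y v)" if "adapted 3 phi0 (\<omega> y) (F y)" for y u v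
    by (simp add: B_def g2_weighted_norm[OF that] inner_polarize[OF adapted_linear[OF that], of u v] field_simps)
  define d where "d y = det (\<chi> i j. B y (axis i 1) (axis j 1))" for y
  have dd: "d differentiable (at x)"
    unfolding d_def by (rule differentiable_det) (simp add: dB)
  have d: "d y = \<bar>det (matrix (F y))\<bar> ^ 9" if y: "adapted 3 phi0 (\<omega> y) (F y)" for y
  proof -
    let ?D = "\<bar>det (matrix (F y))\<bar>"
    have "d y = det (?D *\<^sub>R (\<chi> i j. F y (axis i 1) \<bullet> F y (axis j 1)))"
      unfolding d_def B[OF y] by (rule arg_cong[where f = det]) (simp add: vec_eq_iff)
    also have "\<dots> = ?D ^ 7 * ?D\<^sup>2" by (simp add: det_scaleR det_gram)
    finally show ?thesis by (simp only: power_add[symmetric]) simp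
  qed
  have "(\<lambda>y. B y u v * d y powr (- 1 / 9)) differentiable (at x)"
    using d[OF x] adapted_det_pos[OF x]
    by (intro differentiable_mult dB differentiable_powr dd) simp
  then show ?thesis
  proof (rule differentiable_transform_eventually)
    show "\<forall>\<^sub>F y in nhds x. F y u \<bullet> F y v = B y u v * d y powr (- 1 / 9)"
      using ev
    proof eventually_elim
      fix y assume y: "adapted 3 phi0 (\<omega> y) (F y)"
      have "d y powr (- 1 / 9) = inverse \<bar>det (matrix (F y))\<bar>"
        using adapted_det_pos[OF y] power_powr[of "\<bar>det (matrix (F y))\<bar>" 9 "- 1 / 9"]
        by (simp add: d[OF y] powr_minus)
      then show "F y u \<bullet> F y v = B y u v * d y powr (- 1 / 9)"
        using adapted_det_pos[OF y] by (simp add: B[OF y])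
    qed
  qed
qed

text \<open>As for the uniqueness, minors of weighted areas give all inner products up to the common factor
  \<open>|F e|\<^sup>2\<close>, for a fixed basis vector \<open>e\<close>; the matrix of these ratios is \<open>R\<close>. A weighted area in terms of \<open>R\<close>
  yields \<open>s = |det F| |F e|\<^sup>4\<close>, and \<open>det F\<^sup>2 = |F e|\<^sup>1\<^sup>6 det R\<close>, so that \<open>|F e|\<^sup>2\<^sup>4 = s\<^sup>2 / det R\<close>.\<close>

lemma spin7_inner_differentiable:
  assumes ev: "\<forall>\<^sub>F y in nhds x. adapted 4 psi0 (\<omega> y) (F y)"
    and \<omega>: "\<And>vs. length vs = 4 \<Longrightarrow> (\<lambda>y. \<omega> y vs) differentiable (at x)"
  shows "(\<lambda>y. F y u \<bullet> F y v) differentiable (at x)"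
proof -
  have x: "adapted 4 psi0 (\<omega> x) (F x)" using ev by (rule eventually_nhds_x_imp_x)
  note lin = adapted_linear and bij = adapted_bij
  have q: "(\<lambda>y. spin7_weighted_area (\<omega> y) v w) differentiable (at x)" for v w
  proof (cases "area id v w = 0")
    case False
    have "(\<lambda>y. det (slot_matrix (\<omega> y) [v, w] + outer v v + outer w w)) differentiable (at x)"
      by (rule differentiable_det) (auto simp: slot_matrix_def intro!: \<omega> differentiable_add)
    moreover have "area (F x) v w \<noteq> 0"
      using area_eq_0[OF lin[OF x] linear_id bij_is_inj[OF bij[OF x]]] False by blast
    then have "det (slot_matrix (\<omega> x) [v, w] + outer v v + outer w w) \<noteq> 0"
      using det_slot_matrix_spin7[OF x False] adapted_det_pos[OF x] False by auto
    ultimately show ?thesis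
      unfolding spin7_weighted_area_def divide_inverse
      by (intro differentiable_mult differentiable_sqrt_abs differentiable_const)
  qed (simp add: spin7_weighted_area_def)
  have minor: "(\<lambda>y. spin7_minor (\<omega> y) u v w) differentiable (at x)" for u v w
    unfolding spin7_minor_def divide_inverse
    by (intro differentiable_mult differentiable_diff differentiable_const differentiable_power q)
  define e e' where "e = axis (0::8) (1::real)" and "e' = axis (1::8) (1::real)"
  have e: "e \<noteq> 0" by (simp add: e_def)
  have ratio: "(\<lambda>y. (F y u \<bullet> F y u) / (F y e \<bullet> F y e)) differentiable (at x)" for u
  proof (cases "area (F x) e u = 0")
    case True
    then obtain r where r: "u = r *\<^sub>R e"
      using area_eq_0_imp_parallel[OF lin[OF x] bij_is_inj[OF bij[OF x]] _ e] by blast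
    have "\<forall>\<^sub>F y in nhds x. (F y u \<bullet> F y u) / (F y e \<bullet> F y e) = r * r"
      using ev
    proof eventually_elim
      fix y assume y: "adapted 4 psi0 (\<omega> y) (F y)"
      show "(F y u \<bullet> F y u) / (F y e \<bullet> F y e) = r * r"
        using adapted_nonzero[OF y e] by (simp add: r linear_scale[OF lin[OF y]])
    qed
    then show ?thesis by (rule differentiable_transform_eventually[rotated]) simp
  next
    case False
    then obtain w where w: "gram3 (F x) e u w \<noteq> 0"
      using independent_third[OF lin[OF x] bij[OF x]] by auto
    let ?m = "\<lambda>y. spin7_minor (\<omega> y) e u w"
    \<comment> \<open>The vector \<open>w\<close> is chosen at \<open>x\<close>; the denominator \<open>?m\<close> then stays non-zero nearby.\<close>
    have m0: "?m x \<noteq> 0"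
      using w adapted_det_pos[OF x] adapted_nonzero[OF x e] by (simp add: spin7_minor[OF x])
    have "\<forall>\<^sub>F y in nhds x. (?m y)\<^sup>2 > 0"
      using differentiable_eventually_pos[of "\<lambda>y. (?m y)\<^sup>2" x] minor m0 by simp
    then have "\<forall>\<^sub>F y in nhds x. (F y u \<bullet> F y u) / (F y e \<bullet> F y e) = spin7_minor (\<omega> y) u e w / ?m y"
      using ev
    proof eventually_elim
      case (elim y)
      then show ?case
        using spin7_minor_ratio[OF elim(2), of u e w] adapted_nonzero[OF elim(2) e] by (simp add: field_simps)
    qed
    then show ?thesis
      by (rule differentiable_transform_eventually[rotated]) (intro differentiable_divide minor m0)
  qed
  define R where "R y u v = ((F y (u + v) \<bullet> F y (u + v)) / (F y e \<bullet> F y e) - (F y u \<bullet> F y u) / (F y e \<bullet> F y e)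
      - (F y v \<bullet> F y v) / (F y e \<bullet> F y e)) / 2" for y u v
  have dR: "(\<lambda>y. R y u v) differentiable (at x)" for u v
    unfolding R_def by (intro differentiable_divide differentiable_diff ratio differentiable_const) simp
  have R: "F y u \<bullet> F y v = (F y e \<bullet> F y e) * R y u v" if y: "adapted 4 psi0 (\<omega> y) (F y)" for y u v
    using adapted_nonzero[OF y e]
    by (simp add: R_def inner_polarize[OF lin[OF y], of u v] field_simps)
  define d where "d y = det (\<chi> i j. R y (axis i 1) (axis j 1))" for y
  define s where "s y = spin7_weighted_area (\<omega> y) e e' / (R y e e * R y e' e' - (R y e e')\<^sup>2)" for y
  have key: "0 < d y \<and> (s y)\<^sup>2 = (F y e \<bullet> F y e) ^ 12 * d y \<and> R y e e * R y e' e' - (R y e e')\<^sup>2 \<noteq> 0"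
    if y: "adapted 4 psi0 (\<omega> y) (F y)" for y
  proof -
    define g where "g = F y e \<bullet> F y e"
    have g: "g > 0" unfolding g_def by (rule adapted_nonzero[OF y e])
    have det: "(det (matrix (F y)))\<^sup>2 = g ^ 8 * d y"
      using det_gram_scaled[of "F y" g "\<chi> i j. R y (axis i 1) (axis j 1)"]
      by (simp add: R[OF y, folded g_def] d_def)
    have "0 < (det (matrix (F y)))\<^sup>2" using adapted_det_pos[OF y] by simp
    then have "0 < d y" using g unfolding det by (simp add: zero_less_mult_iff)
    moreover have ar: "area (F y) e e' = g\<^sup>2 * (R y e e * R y e' e' - (R y e e')\<^sup>2)"
      unfolding area_def R[OF y, folded g_def] by (simp add: power2_eq_square algebra_simps)
    have "area (F y) e e' \<noteq> 0"
      using area_eq_0[OF lin[OF y] linear_id bij_is_inj[OF bij[OF y]], of e e']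
      by (auto simp: area_def e_def e'_def inner_axis_axis)
    then have "R y e e * R y e' e' - (R y e e')\<^sup>2 \<noteq> 0" using ar by auto
    moreover from this have "s y = \<bar>det (matrix (F y))\<bar> * g\<^sup>2"
      by (simp add: s_def spin7_weighted_area[OF y] ar)
    then have "(s y)\<^sup>2 = (det (matrix (F y)))\<^sup>2 * g ^ 4" by (simp add: power_mult_distrib flip: power_mult)
    then have "(s y)\<^sup>2 = g ^ 12 * d y" unfolding det by (simp flip: power_add)
    ultimately show ?thesis by (simp add: g_def)
  qed
  have ds: "(\<lambda>y. (s y)\<^sup>2 / d y) differentiable (at x)"
    unfolding s_def d_def
    by (intro differentiable_divide differentiable_power differentiable_diff differentiable_mult dR q
      differentiable_det) (use key[OF x] in \<open>auto simp: dR d_def\<close>)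
  have "(s x)\<^sup>2 / d x > 0"
    using key[OF x] adapted_nonzero[OF x e] by simp
  then have "(\<lambda>y. ((s y)\<^sup>2 / d y) powr (1 / 12) * R y u v) differentiable (at x)"
    by (intro differentiable_mult differentiable_powr ds dR)
  then show ?thesis
  proof (rule differentiable_transform_eventually)
    show "\<forall>\<^sub>F y in nhds x. F y u \<bullet> F y v = ((s y)\<^sup>2 / d y) powr (1 / 12) * R y u v"
      using ev
    proof eventually_elim
      fix y assume y: "adapted 4 psi0 (\<omega> y) (F y)"
      have "((s y)\<^sup>2 / d y) powr (1 / 12) = F y e \<bullet> F y e"
        using key[OF y] adapted_nonzero[OF y e] power_powr[of "F y e \<bullet> F y e" 12 "1 / 12"] by simp
      then show "F y u \<bullet> F y v = ((s y)\<^sup>2 / d y) powr (1 / 12) * R y u v"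
        by (simp only: R[OF y, of u v])
    qed
  qed
qed

section \<open>Covariant derivatives in a chart\<close>

lemma differentiable_has_derivative:
  "f differentiable (at x) \<Longrightarrow> (f has_derivative frechet_derivative f (at x)) (at x)"
  by (simp add: frechet_derivative_works)

lemma frechet_derivative_eventually:
  assumes "(f has_derivative D) (at x)" "\<forall>\<^sub>F y in nhds x. h y = f y"
  shows "frechet_derivative h (at x) = D"
proof -
  have "(h has_derivative D) (at x)"
    using assms(1)
    by (rule has_derivative_transform_eventually)
      (use assms(2) eventually_nhds_x_imp_x[OF assms(2)] in \<open>auto simp: eventually_at_filter elim: eventually_mono\<close>)
  then show ?thesis by (simp add: frechet_derivative_at[symmetric])
qed

text \<open>The action of an endomorphism on forms, by which \<open>local_nabla\<close> differs from the directional derivative.\<close>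

definition derivation :: "(real^'n \<Rightarrow> real^'n) \<Rightarrow> ('n::finite) form \<Rightarrow> 'n form" where
  "derivation A \<alpha> vs = (\<Sum>i<length vs. \<alpha> (vs[i := A (vs ! i)]))"

text \<open>For equal vectors in places \<open>i\<close> and \<open>j\<close>, the summands for \<open>i\<close> and \<open>j\<close> cancel because \<open>\<alpha>\<close> vanishes when \<open>v + A v\<close> is
  put in both places.\<close>

lemma alternating_derivation:
  assumes \<alpha>: "alternating_form k \<alpha>" and A: "linear A"
  shows "alternating_form k (derivation A \<alpha>)"
  unfolding alternating_form_def
proof (intro conjI allI impI; elim conjE)
  fix vs :: "(real^'a) list" and j assume len: "length vs = k" and j: "j < k"
  have "linear (\<lambda>u. \<alpha> (vs[j := u, i := A (vs[j := u] ! i)]))" if i: "i < k" for i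
  proof (cases "i = j")
    case True
    then show ?thesis
      using linear_compose[OF A alternating_formD_linear[OF \<alpha> len j]] len j by (simp add: o_def)
  next
    case False
    then show ?thesis
      using alternating_formD_linear[OF \<alpha>, of "vs[i := A (vs ! i)]" j] len j
      by (simp add: list_update_swap)
  qed
  then show "linear (\<lambda>u. derivation A \<alpha> (vs[j := u]))"
    unfolding derivation_def length_list_update len by (intro linear_compose_sum) auto
next
  fix vs :: "(real^'a) list" and i j
  assume len: "length vs = k" and ij: "i < j" "j < k" and eq: "vs ! i = vs ! j"
  let ?a = "A (vs ! i)"
  have add: "\<alpha> (us[m := a + b]) = \<alpha> (us[m := a]) + \<alpha> (us[m := b])" if "length us = k" "m < k" for us m a b
    using linear_add[OF alternating_formD_linear[OF \<alpha> that]] .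
  have z: "\<alpha> us = 0" if "length us = k" "us ! i = us ! j" for us
    using \<alpha> that ij unfolding alternating_form_def by blast
  have 0: "\<alpha> (vs[l := A (vs ! l)]) = 0" if "l < k" "l \<noteq> i" "l \<noteq> j" for l
    using that eq len by (intro z) auto
  have "\<alpha> (vs[i := vs ! i + ?a, j := vs ! i + ?a]) = 0"
    using ij len by (intro z) auto
  moreover have "\<alpha> (vs[i := ?a, j := ?a]) = 0" "\<alpha> (vs[i := vs ! i, j := vs ! i]) = 0"
    using ij len by (intro z; simp)+
  moreover have "\<alpha> (vs[i := vs ! i + ?a, j := b]) = \<alpha> (vs[i := vs ! i, j := b]) + \<alpha> (vs[i := ?a, j := b])" for b
    using add[of "vs[j := b]" i] ij len by (simp add: list_update_swap)
  ultimately have "\<alpha> (vs[i := vs ! i, j := ?a]) + \<alpha> (vs[i := ?a, j := vs ! i]) = 0"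
    using add[of "vs[i := vs ! i + ?a]" j "vs ! i" ?a] ij len by simp
  then have "\<alpha> (vs[j := ?a]) + \<alpha> (vs[i := ?a]) = 0"
    using eq by (metis list_update_id list_update_swap nth_list_update_neq less_irrefl_nat ij(1))
  moreover have "derivation A \<alpha> vs = (\<Sum>l\<in>{i, j}. \<alpha> (vs[l := A (vs ! l)]))"
    unfolding derivation_def len by (rule sum.mono_neutral_right) (use 0 ij in auto)
  ultimately show "derivation A \<alpha> vs = 0" using ij eq by simp
qed

text \<open>Replacing the pair \<open>v\<^sub>i\<close>, \<open>v\<^sub>m\<close> by a single vector \<open>G\<close> in the place of one or of the other gives values that
  differ by the sign of moving \<open>G\<close> past the vectors in between.\<close>

lemma insert_omitted_antisym:
  assumes \<alpha>: "alternating_form k \<alpha>" and len: "length vs = Suc k" and im: "i < m" "m < Suc k"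
  shows "(-1) ^ m * \<alpha> ((omit m vs)[i := G]) = - ((-1) ^ i * \<alpha> ((omit i vs)[m - 1 := (G :: real^'n::finite)]))"
proof -
  define us ws zs where d: "us = take i vs" "ws = take (m - Suc i) (drop (Suc i) vs)" "zs = drop (Suc m) vs"
  have lens: "length us = i" "length ws = m - Suc i" using im len by (auto simp: d)
  have vs: "vs = us @ vs ! i # ws @ vs ! m # zs"
  proof -
    have "drop (Suc i) vs = ws @ drop (m - Suc i) (drop (Suc i) vs)"
      unfolding d by (rule append_take_drop_id[symmetric])
    also have "drop (m - Suc i) (drop (Suc i) vs) = vs ! m # zs"
      using im len by (simp add: d Cons_nth_drop_Suc)
    finally show ?thesis using id_take_nth_drop[of i vs] im len by (simp add: d)
  qed
  define a b where ab: "a = vs ! i" "b = vs ! m"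
  have vs: "vs = us @ a # ws @ b # zs" using vs by (simp only: ab)
  have m: "m = i + length ws + 1" using lens im by simp
  have "(omit m vs)[i := G] = us @ G # ws @ zs"
    using lens m by (simp add: vs omit_def list_update_append)
  moreover have "(omit i vs)[m - 1 := G] = us @ ws @ G # zs"
    using lens m by (simp add: vs omit_def list_update_append)
  moreover have "\<alpha> (us @ G # ws @ zs) = (-1) ^ length ws * \<alpha> (us @ ws @ G # zs)"
    by (rule alternating_form_move[OF \<alpha>]) (use len vs in simp)
  moreover have "(-1::real) ^ m * (-1) ^ length ws = - ((-1) ^ i)"
    by (simp add: m power_add flip: power_mult_distrib)
  ultimately show ?thesis by (simp add: mult.assoc[symmetric])
qed

lemma sum_antisym:
  fixes H :: "nat \<Rightarrow> nat \<Rightarrow> real"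
  assumes "\<And>i m. i < m \<Longrightarrow> m < n \<Longrightarrow> H m i = - H i m"
  shows "(\<Sum>i<n. \<Sum>m\<in>{..<n} - {i}. H i m) = 0"
proof -
  let ?S = "\<Sum>i<n. \<Sum>m<n. if i = m then 0 else H i m"
  have "?S = (\<Sum>i<n. \<Sum>m<n. if i = m then 0 else H m i)"
    by (subst sum.swap) (simp add: eq_commute)
  also have "\<dots> = (\<Sum>i<n. \<Sum>m<n. - (if i = m then 0 else H i m))"
  proof (intro sum.cong refl)
    fix i m assume "i \<in> {..<n}" "m \<in> {..<n}"
    then show "(if i = m then 0 else H m i) = - (if i = m then 0 else H i m)"
      using assms[of i m] assms[of m i] by (cases i m rule: linorder_cases) auto
  qed
  also have "\<dots> = - ?S" by (simp add: sum_negf)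
  finally have "?S = 0" by simp
  moreover have "(\<Sum>m\<in>{..<n} - {i}. H i m) = (\<Sum>m<n. if i = m then 0 else H i m)" for i
    by (rule sum.mono_neutral_cong_left) auto
  ultimately show ?thesis by simp
qed

text \<open>Why the Christoffel symbols of a torsion-free connection drop out of the exterior derivative: the sum is over
  ordered pairs of places, and the two orders of a pair cancel.\<close>

lemma alternated_symmetric_derivation:
  assumes \<alpha>: "alternating_form k \<alpha>" and sym: "\<And>u v. \<Gamma> u v = \<Gamma> v u" and len: "length vs = Suc k"
  shows "(\<Sum>i<Suc k. (-1) ^ i * derivation (\<Gamma> (vs ! i)) \<alpha> (omit i vs)) = 0"
proof -
  define H where "H i m = (-1) ^ i * \<alpha> ((omit i vs)[(if m < i then m else m - 1) := \<Gamma> (vs ! i) (vs ! m)])" for i m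
  have "(-1) ^ i * derivation (\<Gamma> (vs ! i)) \<alpha> (omit i vs) = (\<Sum>m\<in>{..<Suc k} - {i}. H i m)" if i: "i < Suc k" for i
  proof -
    have "(-1) ^ i * derivation (\<Gamma> (vs ! i)) \<alpha> (omit i vs) =
        (\<Sum>j<k. (-1) ^ i * \<alpha> ((omit i vs)[j := \<Gamma> (vs ! i) (omit i vs ! j)]))"
      using i len by (simp add: derivation_def sum_distrib_left)
    also have "\<dots> = (\<Sum>m\<in>{..<Suc k} - {i}. H i m)"
    proof (rule sum.reindex_bij_witness[where i = "\<lambda>m. if m < i then m else m - 1"
          and j = "\<lambda>j. if j < i then j else Suc j"])
      fix j assume "j \<in> {..<k}"
      then show "H i (if j < i then j else Suc j) =
          (-1) ^ i * \<alpha> ((omit i vs)[j := \<Gamma> (vs ! i) (omit i vs ! j)])"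
        using i len by (auto simp: H_def nth_omit)
    qed (use i in auto)
    finally show ?thesis .
  qed
  then have "(\<Sum>i<Suc k. (-1) ^ i * derivation (\<Gamma> (vs ! i)) \<alpha> (omit i vs)) =
      (\<Sum>i<Suc k. \<Sum>m\<in>{..<Suc k} - {i}. H i m)" by simp
  also have "\<dots> = 0"
  proof (rule sum_antisym)
    fix i m assume im: "i < m" "m < Suc k"
    show "H m i = - H i m"
      using insert_omitted_antisym[OF \<alpha> len im, of "\<Gamma> (vs ! i) (vs ! m)"] im sym[of "vs ! m" "vs ! i"]
      by (simp add: H_def)
  qed
  finally show ?thesis .
qed

text \<open>A form and a metric near a point of a chart, with the regularity that first derivatives at \<open>x\<close> need.\<close>

locale chart_geometry =
  fixes k :: nat and \<omega> :: "real^'n::finite \<Rightarrow> 'n form"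
    and g :: "real^'n \<Rightarrow> real^'n \<Rightarrow> real^'n \<Rightarrow> real" and x :: "real^'n"
  assumes alt: "\<forall>\<^sub>F y in nhds x. alternating_form k (\<omega> y)"
    and form_diff: "\<And>vs. length vs = k \<Longrightarrow> (\<lambda>y. \<omega> y vs) differentiable (at x)"
    and metric: "\<forall>\<^sub>F y in nhds x. bilinear (g y) \<and> (\<forall>u v. g y u v = g y v u)"
    and metric_pos: "\<And>u. u \<noteq> 0 \<Longrightarrow> g x u u > 0"
    and metric_diff: "\<And>u v. (\<lambda>y. g y u v) differentiable (at x)"
begin

abbreviation "\<Gamma> \<equiv> christoffel g x"
abbreviation cov (\<open>\<nabla>\<close>) where "cov \<equiv> local_nabla g \<omega> x"

lemma levi_civita: "levi_civita_at g x \<Gamma>"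
proof -
  obtain U where "open U" "x \<in> U" "\<And>y. y \<in> U \<Longrightarrow> bilinear (g y) \<and> (\<forall>u v. g y u v = g y v u)"
    using metric unfolding eventually_nhds by blast
  then have "\<exists>!\<Gamma>. levi_civita_at g x \<Gamma>"
    by (intro levi_civita_at_unique_exists) (auto simp: metric_pos metric_diff)
  then show ?thesis unfolding christoffel_def by (rule theI')
qed

lemma bilinear_\<Gamma>: "bilinear \<Gamma>" and \<Gamma>_sym: "\<Gamma> u v = \<Gamma> v u"
  and metric_parallel: "frechet_derivative (\<lambda>y. g y v w) (at x) u = g x (\<Gamma> u v) w + g x v (\<Gamma> u w)"
  using levi_civita unfolding levi_civita_at_def by blast+

lemma linear_\<Gamma>: "linear (\<Gamma> u)" "linear (\<lambda>u. \<Gamma> u v)"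
  using bilinear_\<Gamma> unfolding bilinear_def by blast+

lemma alt_x: "alternating_form k (\<omega> x)"
  using alt by (rule eventually_nhds_x_imp_x)

abbreviation "D vs \<equiv> frechet_derivative (\<lambda>y. \<omega> y vs) (at x)"

lemma has_derivative_form: "length vs = k \<Longrightarrow> ((\<lambda>y. \<omega> y vs) has_derivative D vs) (at x)"
  by (intro differentiable_has_derivative form_diff)

lemma nabla_eq: "\<nabla> u vs = D vs u - derivation (\<Gamma> u) (\<omega> x) vs"
  by (simp add: local_nabla_def derivation_def)

lemma alternating_D: "alternating_form k (\<lambda>vs. D vs u)"
  unfolding alternating_form_def
proof (intro conjI allI impI; elim conjE)
  fix vs :: "(real^'n) list" and i assume *: "length vs = k" "i < k"
  show "linear (\<lambda>w. D (vs[i := w]) u)"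
  proof (rule linearI)
    fix a b
    have "D (vs[i := a + b]) = (\<lambda>u. D (vs[i := a]) u + D (vs[i := b]) u)"
      by (rule frechet_derivative_eventually[OF has_derivative_add[OF has_derivative_form has_derivative_form]])
        (use alt * in \<open>auto elim!: eventually_mono simp: linear_add[OF alternating_formD_linear]\<close>)
    then show "D (vs[i := a + b]) u = D (vs[i := a]) u + D (vs[i := b]) u" by simp
    fix r
    have "D (vs[i := r *\<^sub>R a]) = (\<lambda>u. r * D (vs[i := a]) u)"
      by (rule frechet_derivative_eventually[OF has_derivative_mult_right[OF has_derivative_form]])
        (use alt * in \<open>auto elim!: eventually_mono simp: linear_scale[OF alternating_formD_linear]\<close>)
    then show "D (vs[i := r *\<^sub>R a]) u = r *\<^sub>R D (vs[i := a]) u" by simp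
  qed
next
  fix vs :: "(real^'n) list" and i j assume *: "length vs = k" "i < j" "j < k" "vs ! i = vs ! j"
  from alt have "\<forall>\<^sub>F y in nhds x. \<omega> y vs = 0"
    by eventually_elim (use * in \<open>unfold alternating_form_def, blast\<close>)
  then have "D vs = (\<lambda>u. 0)"
    by (rule frechet_derivative_eventually[OF has_derivative_const])
  then show "D vs u = 0" by simp
qed

lemma alternating_nabla: "alternating_form k (\<nabla> u)"
  using alternating_form_diff[OF alternating_D alternating_derivation[OF alt_x linear_\<Gamma>(1)]]
  by (simp add: nabla_eq[abs_def])

lemma linear_nabla:
  assumes "length vs = k"
  shows "linear (\<lambda>u. \<nabla> u vs)"
proof -
  have "linear (D vs)" using has_derivative_linear[OF has_derivative_form[OF assms]] .
  moreover have "linear (\<lambda>u. derivation (\<Gamma> u) (\<omega> x) vs)"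
    unfolding derivation_def assms
  proof (intro linear_compose_sum ballI)
    fix i assume "i \<in> {..<k}"
    then show "linear (\<lambda>u. \<omega> x (vs[i := \<Gamma> u (vs ! i)]))"
      using linear_compose[OF linear_\<Gamma>(2) alternating_formD_linear[OF alt_x assms]] by (simp add: o_def)
  qed
  ultimately show ?thesis unfolding nabla_eq by (rule linear_compose_sub)
qed

lemma ext_deriv_nabla:
  assumes len: "length vs = Suc k"
  shows "local_ext_deriv \<omega> x vs = (\<Sum>i<Suc k. (-1) ^ i * \<nabla> (vs ! i) (omit i vs))"
  using alternated_symmetric_derivation[OF alt_x, of \<Gamma>, OF \<Gamma>_sym len]
  by (simp only: local_ext_deriv_def nabla_eq len right_diff_distrib sum_subtractf)

lemma curve_nhds: "filterlim (\<lambda>t::real. x + t *\<^sub>R u) (nhds x) (nhds 0)"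
proof -
  have "((\<lambda>t::real. x + t *\<^sub>R u) \<longlongrightarrow> x + 0 *\<^sub>R u) (nhds 0)"
    by (intro tendsto_intros filterlim_ident)
  then show ?thesis by simp
qed

lemma eventually_along_curve:
  "\<forall>\<^sub>F y in nhds x. P y \<Longrightarrow> \<forall>\<^sub>F t in nhds (0::real). P (x + t *\<^sub>R u)"
  by (erule eventually_compose_filterlim[OF _ curve_nhds])

lemma derivative_along_curve:
  fixes f :: "real^'n \<Rightarrow> real"
  assumes "(f has_derivative f') (at x)"
  shows "((\<lambda>t. f (x + t *\<^sub>R u)) has_real_derivative f' u) (at 0)"
proof -
  have "((\<lambda>t. x + t *\<^sub>R u) has_derivative (\<lambda>t. t *\<^sub>R u)) (at (0::real))"
    by (auto intro!: derivative_eq_intros)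
  moreover have "(f has_derivative f') (at (x + 0 *\<^sub>R u))" using assms by simp
  ultimately have "((\<lambda>t. f (x + t *\<^sub>R u)) has_derivative (\<lambda>t. f' (t *\<^sub>R u))) (at 0)"
    by (rule has_derivative_compose)
  moreover have "(\<lambda>t. f' (t *\<^sub>R u)) = (*) (f' u)"
    by (rule ext) (simp add: linear_scale[OF has_derivative_linear[OF assms]])
  ultimately show ?thesis by (simp add: has_field_derivative_def)
qed

text \<open>The first \<open>j\<close> vectors are moved with velocities \<open>ws\<close>; the induction on \<open>j\<close> in \<open>derivative_form_moved\<close> sets them in motion
  one after the other.\<close>

definition moved :: "nat \<Rightarrow> (real^'n) list \<Rightarrow> (real^'n) list \<Rightarrow> real \<Rightarrow> (real^'n) list" where
  "moved j vs ws t = map (\<lambda>i. if i < j then vs ! i + t *\<^sub>R ws ! i else vs ! i) [0..<length vs]"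

lemma length_moved [simp]: "length (moved j vs ws t) = length vs"
  by (simp add: moved_def)

lemma nth_moved:
  "i < length vs \<Longrightarrow> moved j vs ws t ! i = (if i < j then vs ! i + t *\<^sub>R ws ! i else vs ! i)"
  by (simp add: moved_def)

lemma moved_0: "moved 0 vs ws t = vs" and moved_at_0: "moved j vs ws 0 = vs"
  by (rule nth_equalityI; simp add: nth_moved)+

lemma moved_Suc: "j < length vs \<Longrightarrow> moved (Suc j) vs ws t = (moved j vs ws t)[j := vs ! j + t *\<^sub>R ws ! j]"
  and moved_same: "j < length vs \<Longrightarrow> (moved j vs ws t)[j := vs ! j] = moved j vs ws t"
  and moved_update: "j < length vs \<Longrightarrow> (moved j vs ws t)[j := a] = moved j (vs[j := a]) ws t"
  by (rule nth_equalityI; auto simp: nth_moved nth_list_update less_Suc_eq)+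

lemma derivative_form_moved:
  assumes len: "length vs = k" and j: "j \<le> k"
  shows "((\<lambda>t. \<omega> (x + t *\<^sub>R u) (moved j vs ws t)) has_real_derivative
           D vs u + (\<Sum>i<j. \<omega> x (vs[i := ws ! i]))) (at 0)"
  using assms
proof (induction j arbitrary: vs)
  case 0
  then show ?case
    using derivative_along_curve[OF has_derivative_form] by (simp add: moved_0)
next
  case (Suc j)
  let ?r = "\<lambda>vs t. \<omega> (x + t *\<^sub>R u) (moved j vs ws t)"
  let ?vs = "vs[j := ws ! j]"
  have 1: "(?r vs has_real_derivative D vs u + (\<Sum>i<j. \<omega> x (vs[i := ws ! i]))) (at 0)"
    using Suc by simp
  have 2: "(?r ?vs has_real_derivative D ?vs u + (\<Sum>i<j. \<omega> x (?vs[i := ws ! i]))) (at 0)"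
    using Suc.IH[of ?vs] Suc.prems by simp
  have "((\<lambda>t. ?r vs t + t * ?r ?vs t) has_real_derivative
      D vs u + (\<Sum>i<Suc j. \<omega> x (vs[i := ws ! i]))) (at 0)"
    by (rule derivative_eq_intros 1 2 refl)+ (simp add: moved_at_0)
  then show ?case
  proof (rule DERIV_cong_ev[THEN iffD2, rotated -1], goal_cases)
    case 2
    from eventually_along_curve[OF alt, of u] show ?case
    proof eventually_elim
      fix t :: real assume a: "alternating_form k (\<omega> (x + t *\<^sub>R u))"
      have l: "linear (\<lambda>w. \<omega> (x + t *\<^sub>R u) ((moved j vs ws t)[j := w]))"
        using Suc.prems by (intro alternating_formD_linear[OF a]) auto
      show "\<omega> (x + t *\<^sub>R u) (moved (Suc j) vs ws t) = ?r vs t + t * ?r ?vs t"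
        using Suc.prems
        by (simp add: moved_Suc linear_add[OF l] linear_scale[OF l]) (simp add: moved_same moved_update)
    qed
  qed simp_all
qed

text \<open>The velocity \<open>- \<Gamma> u v\<close> makes the vector parallel to first order along the line.\<close>

lemma derivative_metric_moved:
  "((\<lambda>t. g (x + t *\<^sub>R u) (v - t *\<^sub>R \<Gamma> u v) (v - t *\<^sub>R \<Gamma> u v)) has_real_derivative 0) (at 0)"
proof -
  let ?w = "\<Gamma> u v"
  let ?h = "\<lambda>a b t. g (x + t *\<^sub>R u) a b"
  have d: "(?h a b has_real_derivative g x (\<Gamma> u a) b + g x a (\<Gamma> u b)) (at 0)" for a b
    using derivative_along_curve[OF differentiable_has_derivative[OF metric_diff[of a b]], of u]
    by (simp add: metric_parallel)
  have sym: "g x v ?w = g x ?w v" using eventually_nhds_x_imp_x[OF metric] by simp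
  have "((\<lambda>t. ?h v v t - 2 * (t * ?h v ?w t) + t * (t * ?h ?w ?w t)) has_real_derivative 0) (at 0)"
    by (rule derivative_eq_intros d refl)+ (simp add: sym)
  then show ?thesis
  proof (rule DERIV_cong_ev[THEN iffD2, rotated -1], goal_cases)
    case 2
    from eventually_along_curve[OF metric, of u] show ?case
    proof eventually_elim
      case (elim t)
      then have b: "bilinear (g (x + t *\<^sub>R u))" and s: "g (x + t *\<^sub>R u) ?w v = g (x + t *\<^sub>R u) v ?w" by auto
      show ?case
        by (simp add: bilinear_lsub[OF b] bilinear_rsub[OF b] bilinear_lmul[OF b] bilinear_rmul[OF b] s
          algebra_simps)
    qed
  qed simp_all
qed

lemma derivative_prod_zero:
  fixes f :: "'i \<Rightarrow> real \<Rightarrow> real"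
  assumes "\<And>i. i \<in> I \<Longrightarrow> (f i has_real_derivative 0) (at 0)"
  shows "((\<lambda>t. \<Prod>i\<in>I. f i t) has_real_derivative 0) (at 0)"
  using assms
proof (induction I rule: infinite_finite_induct)
  case (insert i I)
  have "((\<lambda>t. f i t * (\<Prod>i\<in>I. f i t)) has_real_derivative 0) (at 0)"
    using DERIV_mult[OF insert.prems[of i] insert.IH] insert.prems by simp
  then show ?case using insert.hyps by simp
qed simp_all

text \<open>Both sides of the calibration inequality are differentiated along first-order parallel vectors. The product
  of squared lengths has derivative \<open>0\<close>, the form has derivative \<open>\<nabla> u vs\<close>, and at a calibrated tuple the
  difference \<open>G - h\<^sup>2\<close> is minimal.\<close>

lemma nabla_calibrated:
  assumes comass: "\<forall>\<^sub>F y in nhds x. \<forall>ws. length ws = k \<longrightarrow> (\<omega> y ws)\<^sup>2 \<le> (\<Prod>i<k. g y (ws ! i) (ws ! i))"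
    and len: "length vs = k" and eq: "(\<omega> x vs)\<^sup>2 = (\<Prod>i<k. g x (vs ! i) (vs ! i))" and nz: "\<omega> x vs \<noteq> 0"
  shows "\<nabla> u vs = 0"
proof -
  define ws where "ws = map (\<lambda>v. - \<Gamma> u v) vs"
  define h where "h t = \<omega> (x + t *\<^sub>R u) (moved k vs ws t)" for t
  define G where "G t = (\<Prod>i<k. g (x + t *\<^sub>R u) (moved k vs ws t ! i) (moved k vs ws t ! i))" for t
  have "\<nabla> u vs = D vs u + (\<Sum>i<k. \<omega> x (vs[i := ws ! i]))"
  proof -
    have "\<omega> x (vs[i := ws ! i]) = - \<omega> x (vs[i := \<Gamma> u (vs ! i)])" if "i < k" for i
      using linear_neg[OF alternating_formD_linear[OF alt_x len that]] that len by (simp add: ws_def)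
    then show ?thesis by (simp add: nabla_eq derivation_def len sum_negf)
  qed
  then have h': "(h has_real_derivative \<nabla> u vs) (at 0)"
    using derivative_form_moved[OF len order_refl] by (simp add: h_def[abs_def])
  have G': "(G has_real_derivative 0) (at 0)"
    unfolding G_def[abs_def]
  proof (rule derivative_prod_zero)
    fix i assume "i \<in> {..<k}"
    then show "((\<lambda>t. g (x + t *\<^sub>R u) (moved k vs ws t ! i) (moved k vs ws t ! i)) has_real_derivative 0) (at 0)"
      using derivative_metric_moved[of u "vs ! i"] len by (simp add: moved_def ws_def)
  qed
  have d: "((\<lambda>t. G t - (h t)\<^sup>2) has_real_derivative - 2 * h 0 * \<nabla> u vs) (at 0)"
    by (rule derivative_eq_intros h' G' refl)+ simp
  have "\<forall>\<^sub>F t in nhds 0. G t - (h t)\<^sup>2 \<ge> 0"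
    using eventually_along_curve[OF comass, of u] by eventually_elim (simp add: G_def h_def len)
  moreover have "G 0 - (h 0)\<^sup>2 = 0" by (simp add: G_def h_def moved_at_0 eq)
  ultimately obtain e where "e > 0" "\<forall>t. \<bar>0 - t\<bar> < e \<longrightarrow> G 0 - (h 0)\<^sup>2 \<le> G t - (h t)\<^sup>2"
    unfolding eventually_nhds_metric by (auto simp: dist_real_def)
  then have "- 2 * h 0 * \<nabla> u vs = 0" using DERIV_local_min[OF d] by blast
  moreover have "h 0 \<noteq> 0" using nz by (simp add: h_def moved_at_0)
  ultimately show ?thesis by simp
qed

end

section \<open>From the manifold to a chart\<close>

lemma smooth_on_differentiable: "smooth_on S f \<Longrightarrow> x \<in> S \<Longrightarrow> f differentiable (at x)"
  unfolding smooth_on_def by (metis Ck_on.simps(2))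

lemma chart_inv_chart:
  assumes "smooth_manifold X A" "c \<in> A" "q \<in> fst c"
  shows "chart_inv c (snd c q) = q"
proof -
  have "homeomorphic_map (subtopology X (fst c)) (top_of_set (snd c ` fst c)) (snd c)"
    and "fst c \<subseteq> topspace X"
    using assms(1,2) by (auto simp: smooth_manifold_def openin_subset)
  then have "inj_on (snd c) (fst c)"
    using homeomorphic_imp_injective_map by (metis topspace_subtopology_subset)
  then show ?thesis using assms(3) by (simp add: chart_inv_def)
qed

lemma open_chart_image:
  assumes "smooth_manifold X A" "c \<in> A" "openin X W" "W \<subseteq> fst c"
  shows "open (snd c ` W)"
proof -
  have hom: "homeomorphic_map (subtopology X (fst c)) (top_of_set (snd c ` fst c)) (snd c)"
    and o: "open (snd c ` fst c)"
    using assms(1,2) by (auto simp: smooth_manifold_def)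
  have "openin (subtopology X (fst c)) W"
    using assms(3,4) by (auto simp: openin_subtopology)
  then have "openin (top_of_set (snd c ` fst c)) (snd c ` W)"
    using homeomorphic_imp_open_map[OF hom] by (simp add: open_map_def)
  then show ?thesis using o openin_open_eq by blast
qed

lemma chart_transition_derivatives_inverse:
  assumes M: "smooth_manifold X A" and c: "c \<in> A" "q \<in> fst c" and c': "c' \<in> A" "q \<in> fst c'"
    and D: "((snd c' \<circ> chart_inv c) has_derivative D) (at (snd c q))"
    and D': "((snd c \<circ> chart_inv c') has_derivative D') (at (snd c' q))"
  shows "D' (D v) = v"
proof -
  let ?W = "fst c \<inter> fst c'"
  have "openin X ?W" using M c c' by (auto simp: smooth_manifold_def)
  then have S: "open (snd c ` ?W)" using M c by (intro open_chart_image) auto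
  have "(snd c' \<circ> chart_inv c) (snd c q) = snd c' q" using chart_inv_chart[OF M c] by simp
  then have "((snd c \<circ> chart_inv c') \<circ> (snd c' \<circ> chart_inv c) has_derivative D' \<circ> D) (at (snd c q))"
    using D D' by (intro diff_chain_at) simp_all
  then have "(id has_derivative D' \<circ> D) (at (snd c q))"
  proof (rule has_derivative_transform_within_open[OF _ S])
    show "snd c q \<in> snd c ` ?W" using c c' by auto
    fix y assume "y \<in> snd c ` ?W"
    then show "((snd c \<circ> chart_inv c') \<circ> (snd c' \<circ> chart_inv c)) y = id y"
      using chart_inv_chart[OF M c(1)] chart_inv_chart[OF M c'(1)] by auto
  qed
  then have "D' \<circ> D = id" using has_derivative_id has_derivative_unique by blast
  then show ?thesis by (metis comp_apply id_apply)
qed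

lemma chart_at:
  assumes "p \<in> points A"
  shows "chart_at A p \<in> A" "p \<in> fst (chart_at A p)"
proof -
  have "\<exists>c. c \<in> A \<and> p \<in> fst c" using assms by (auto simp: points_def)
  then have "chart_at A p \<in> A \<and> p \<in> fst (chart_at A p)" unfolding chart_at_def by (rule someI_ex)
  then show "chart_at A p \<in> A" "p \<in> fst (chart_at A p)" by auto
qed

lemma chart_transition_has_derivative:
  assumes M: "smooth_manifold X A" and c: "c \<in> A" "q \<in> fst c" and c': "c' \<in> A" "q \<in> fst c'"
  shows "((snd c' \<circ> chart_inv c) has_derivative
    frechet_derivative (snd c' \<circ> chart_inv c) (at (snd c q))) (at (snd c q))"
proof (intro differentiable_has_derivative smooth_on_differentiable)
  show "smooth_on (snd c ` (fst c \<inter> fst c')) (snd c' \<circ> chart_inv c)"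
    using M c c' by (auto simp: smooth_manifold_def)
qed (use c c' in auto)

lemma to_tangent:
  assumes M: "smooth_manifold X A" and c: "c \<in> A" "q \<in> fst c"
  shows "linear (to_tangent A c q)" "bij (to_tangent A c q)"
proof -
  have "q \<in> points A" using c by (auto simp: points_def)
  note c' = chart_at[OF this]
  note D = chart_transition_has_derivative[OF M c c'] chart_transition_has_derivative[OF M c' c]
  show "linear (to_tangent A c q)"
    unfolding to_tangent_def by (rule has_derivative_linear[OF D(1)])
  show "bij (to_tangent A c q)"
    unfolding to_tangent_def
    by (rule bijI'[OF _ _]; metis chart_transition_derivatives_inverse[OF M c c' D]
        chart_transition_derivatives_inverse[OF M c' c D(2,1)])
qed

lemma to_tangent_chart_at:
  assumes M: "smooth_manifold X A" and p: "p \<in> points A"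
  shows "to_tangent A (chart_at A p) p = id"
proof
  fix v
  note c = chart_at[OF p]
  have "openin X (fst (chart_at A p))" using M c by (auto simp: smooth_manifold_def)
  then have S: "open (snd (chart_at A p) ` fst (chart_at A p))" using M c by (intro open_chart_image) auto
  have "(snd (chart_at A p) \<circ> chart_inv (chart_at A p) has_derivative id) (at (snd (chart_at A p) p))"
    by (rule has_derivative_transform_within_open[OF has_derivative_id S])
      (use c chart_inv_chart[OF M c(1)] in \<open>auto simp: id_def\<close>)
  then show "to_tangent A (chart_at A p) p v = id v"
    unfolding to_tangent_def by (simp add: frechet_derivative_at[symmetric])
qed

text \<open>What both model forms provide: adapted frames are isometric to each other, their inner products depend
  differentiably on the form, and the calibration inequality holds.\<close>

locale rigid_form =
  fixes k :: nat and \<alpha>\<^sub>0 :: "'n::finite form"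
  assumes inner_unique: "\<And>\<alpha> f f' u v. adapted k \<alpha>\<^sub>0 \<alpha> f \<Longrightarrow> adapted k \<alpha>\<^sub>0 \<alpha> f' \<Longrightarrow> f u \<bullet> f v = f' u \<bullet> f' v"
    and inner_differentiable: "\<And>x \<omega> F u v. \<lbrakk>\<forall>\<^sub>F y in nhds x. adapted k \<alpha>\<^sub>0 (\<omega> y) (F y);
      \<And>vs. length vs = k \<Longrightarrow> (\<lambda>y. \<omega> y vs) differentiable (at (x :: real^'n))\<rbrakk>
      \<Longrightarrow> (\<lambda>y. F y u \<bullet> F y v) differentiable (at x)"
    and comass: "\<And>vs. length vs = k \<Longrightarrow> (\<alpha>\<^sub>0 vs)\<^sup>2 \<le> (\<Prod>i<k. vs ! i \<bullet> vs ! i)"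
begin

lemma assoc_metric_eq:
  assumes "adapted k \<alpha>\<^sub>0 (\<omega> p) f"
  shows "assoc_metric k \<alpha>\<^sub>0 \<omega> p u v = f u \<bullet> f v"
  unfolding assoc_metric_def by (rule the_equality) (use assms inner_unique in blast)+

end

locale modelled_manifold = rigid_form k \<alpha>\<^sub>0 for k and \<alpha>\<^sub>0 :: "'n::finite form" +
  fixes X :: "'a topology" and A :: "('a, 'n) chart set" and \<omega> :: "'a \<Rightarrow> 'n form" and p :: 'a
  assumes manifold: "smooth_manifold X A" and modelled: "modelled_on A k \<alpha>\<^sub>0 \<omega>" and p: "p \<in> points A"
begin

abbreviation "c \<equiv> chart_at A p"
abbreviation "g \<equiv> assoc_metric k \<alpha>\<^sub>0 \<omega>"
abbreviation "x \<equiv> snd c p"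

lemmas c = chart_at[OF p]

lemma open_chart: "open (snd c ` fst c)"
  using manifold c by (auto simp: smooth_manifold_def)

lemma near_x: "\<forall>\<^sub>F y in nhds x. y \<in> snd c ` fst c"
  using open_chart c by (intro eventually_nhds_in_open) auto

text \<open>Adapted frames are chosen independently of each other at the points of the chart; only their inner
  products will be differentiated.\<close>

definition frame :: "real^'n \<Rightarrow> real^'n \<Rightarrow> real^'n" where
  "frame y = (SOME f. adapted k \<alpha>\<^sub>0 (\<omega> (chart_inv c y)) f) \<circ> to_tangent A c (chart_inv c y)"

lemma at_chart_point:
  assumes y: "y \<in> snd c ` fst c"
  shows adapted_frame: "adapted k \<alpha>\<^sub>0 (chart_form A c \<omega> y) (frame y)"
    and alternating_chart_form: "alternating_form k (chart_form A c \<omega> y)"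
    and chart_metric_frame: "chart_metric A c g y u v = frame y u \<bullet> frame y v"
proof -
  obtain q where q: "q \<in> fst c" "y = snd c q" using y by blast
  then have qy: "chart_inv c y = q" using chart_inv_chart[OF manifold c(1)] by simp
  have qA: "q \<in> points A" using q c by (auto simp: points_def)
  let ?t = "to_tangent A c q" and ?f = "SOME f. adapted k \<alpha>\<^sub>0 (\<omega> q) f"
  have "\<exists>f. adapted k \<alpha>\<^sub>0 (\<omega> q) f"
    using modelled qA by (simp add: modelled_on_def)
  then have f: "adapted k \<alpha>\<^sub>0 (\<omega> q) ?f" by (rule someI_ex)
  note t = to_tangent[OF manifold c(1) q(1)]
  show "adapted k \<alpha>\<^sub>0 (chart_form A c \<omega> y) (frame y)"
    unfolding adapted_def
  proof (intro conjI allI impI)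
    show "linear (frame y)" "bij (frame y)"
      unfolding frame_def qy
      using adapted_linear[OF f] adapted_bij[OF f] t by (simp_all add: linear_compose bij_comp)
    fix vs :: "(real^'n) list" assume "length vs = k"
    then have "length (map ?t vs) = k" by simp
    then have "\<alpha>\<^sub>0 (map ?f (map ?t vs)) = \<omega> q (map ?t vs)"
      using f unfolding adapted_def by blast
    then show "\<alpha>\<^sub>0 (map (frame y) vs) = chart_form A c \<omega> y vs"
      by (simp add: frame_def chart_form_def qy)
  qed
  show "alternating_form k (chart_form A c \<omega> y)"
    unfolding chart_form_def qy
    by (rule alternating_form_pullback[OF _ t(1)])
      (use modelled qA in \<open>simp add: modelled_on_def smooth_form_def\<close>)
  show "chart_metric A c g y u v = frame y u \<bullet> frame y v"
    by (simp add: chart_metric_def frame_def qy assoc_metric_eq[where \<omega> = \<omega> and p = q, OF f])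
qed

lemma chart_form_x: "chart_form A c \<omega> x = \<omega> p"
  and chart_metric_x: "chart_metric A c g x = g p"
  using chart_inv_chart[OF manifold c] to_tangent_chart_at[OF manifold p]
  by (intro ext; simp add: chart_form_def chart_metric_def)+

sublocale chart_geometry k "chart_form A c \<omega>" "chart_metric A c g" x
proof
  have x: "x \<in> snd c ` fst c" using c by auto
  show "\<forall>\<^sub>F y in nhds x. alternating_form k (chart_form A c \<omega> y)"
    using near_x by eventually_elim (rule alternating_chart_form)
  show diff: "(\<lambda>y. chart_form A c \<omega> y vs) differentiable (at x)" if "length vs = k" for vs
    by (rule smooth_on_differentiable[OF _ x])
      (use modelled that c in \<open>auto simp: modelled_on_def smooth_form_def\<close>)
  show "\<forall>\<^sub>F y in nhds x. bilinear (chart_metric A c g y) \<and>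
      (\<forall>u v. chart_metric A c g y u v = chart_metric A c g y v u)"
    using near_x
  proof eventually_elim
    fix y assume y: "y \<in> snd c ` fst c"
    note lin = adapted_linear[OF adapted_frame[OF y]]
    show "bilinear (chart_metric A c g y) \<and> (\<forall>u v. chart_metric A c g y u v = chart_metric A c g y v u)"
      unfolding bilinear_def
      by (auto intro!: linearI simp: chart_metric_frame[OF y] linear_add[OF lin] linear_scale[OF lin]
          inner_add_left inner_add_right inner_commute)
  qed
  show "chart_metric A c g x u u > 0" if "u \<noteq> 0" for u
    using adapted_nonzero[OF adapted_frame[OF x] that] by (simp add: chart_metric_frame[OF x])
  show "(\<lambda>y. chart_metric A c g y u v) differentiable (at x)" for u v
  proof (rule differentiable_transform_eventually)
    show "(\<lambda>y. frame y u \<bullet> frame y v) differentiable (at x)"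
      by (rule inner_differentiable[OF _ diff]) (use near_x adapted_frame in \<open>auto elim: eventually_mono\<close>)
    show "\<forall>\<^sub>F y in nhds x. chart_metric A c g y u v = frame y u \<bullet> frame y v"
      using near_x by eventually_elim (rule chart_metric_frame)
  qed
qed

abbreviation "cov_deriv \<equiv> nabla A g \<omega> p"

lemma cov_deriv_eq: "cov_deriv = local_nabla (chart_metric A c g) (chart_form A c \<omega>) x"
  by (simp add: nabla_def[abs_def] Let_def)

lemma alternating_cov_deriv: "alternating_form k (cov_deriv u)"
  unfolding cov_deriv_eq by (rule alternating_nabla)

lemma linear_cov_deriv: "length vs = k \<Longrightarrow> linear (\<lambda>u. cov_deriv u vs)"
  unfolding cov_deriv_eq by (rule linear_nabla)

lemma ext_deriv_eq:
  assumes "length vs = Suc k"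
  shows "ext_deriv A \<omega> p vs = (\<Sum>i<Suc k. (-1) ^ i * cov_deriv (vs ! i) (omit i vs))"
  using ext_deriv_nabla[OF assms] by (simp add: ext_deriv_def Let_def cov_deriv_eq)

text \<open>The calibration condition is transported to the model by an adapted frame \<open>f\<close>.\<close>

lemma nabla_calibrated_frame:
  assumes f: "adapted k \<alpha>\<^sub>0 (\<omega> p) f" and len: "length vs = k"
    and cal: "(\<alpha>\<^sub>0 (map f vs))\<^sup>2 = (\<Prod>i<k. f (vs ! i) \<bullet> f (vs ! i))" "\<alpha>\<^sub>0 (map f vs) \<noteq> 0"
  shows "cov_deriv u vs = 0"
  unfolding cov_deriv_eq
proof (rule nabla_calibrated[OF _ len])
  have \<omega>p: "\<alpha>\<^sub>0 (map f vs) = \<omega> p vs" using f len by (simp add: adapted_def)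
  show "(chart_form A c \<omega> x vs)\<^sup>2 = (\<Prod>i<k. chart_metric A c g x (vs ! i) (vs ! i))"
    using cal(1) by (simp add: chart_form_x chart_metric_x assoc_metric_eq[where \<omega> = \<omega> and p = p, OF f] \<omega>p)
  show "chart_form A c \<omega> x vs \<noteq> 0" using cal(2) by (simp add: chart_form_x \<omega>p)
  show "\<forall>\<^sub>F y in nhds x. \<forall>ws. length ws = k \<longrightarrow>
      (chart_form A c \<omega> y ws)\<^sup>2 \<le> (\<Prod>i<k. chart_metric A c g y (ws ! i) (ws ! i))"
    using near_x
  proof eventually_elim
    fix y assume y: "y \<in> snd c ` fst c"
    show "\<forall>ws. length ws = k \<longrightarrow>
      (chart_form A c \<omega> y ws)\<^sup>2 \<le> (\<Prod>i<k. chart_metric A c g y (ws ! i) (ws ! i))"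
    proof (intro allI impI)
      fix ws :: "(real^'n) list" assume "length ws = k"
      then show "(chart_form A c \<omega> y ws)\<^sup>2 \<le> (\<Prod>i<k. chart_metric A c g y (ws ! i) (ws ! i))"
        using comass[of "map (frame y) ws"] adapted_frame[OF y]
        by (simp add: chart_metric_frame[OF y] adapted_def)
    qed
  qed
qed

end

lemma prod_lessThan_3: "(\<Prod>i<3::nat. f i) = f 0 * f 1 * (f 2 :: real)"
  and prod_lessThan_4: "(\<Prod>i<4::nat. f i) = f 0 * f 1 * f 2 * (f 3 :: real)"
  by (simp_all add: numeral_eq_Suc mult.assoc)

lemma rigid_form_phi0: "rigid_form 3 phi0"
proof
  fix vs :: "(real^7) list" assume "length vs = 3"
  then obtain a b c where "vs = [a, b, c]" by (auto simp: numeral_eq_Suc length_Suc_conv)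
  then show "(phi0 vs)\<^sup>2 \<le> (\<Prod>i<3. vs ! i \<bullet> vs ! i)"
    using phi0_comass[of a b c] by (simp add: prod_lessThan_3)
qed (use g2_inner_unique g2_inner_differentiable in blast)+

lemma rigid_form_psi0: "rigid_form 4 psi0"
proof
  fix vs :: "(real^8) list" assume "length vs = 4"
  then obtain a b c d where "vs = [a, b, c, d]" by (auto simp: numeral_eq_Suc length_Suc_conv)
  then show "(psi0 vs)\<^sup>2 \<le> (\<Prod>i<4. vs ! i \<bullet> vs ! i)"
    using psi0_comass[of a b c d] by (simp add: prod_lessThan_4)
qed (use spin7_inner_unique spin7_inner_differentiable in blast)+

section \<open>Conformal-Killing forms at a point\<close>

abbreviation axes :: "'n list \<Rightarrow> (real^'n::finite) list" where
  "axes \<equiv> map (\<lambda>i. axis i 1)"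

lemma omit_map: "omit i (map h vs) = map h (omit i vs)"
  by (simp add: omit_def take_map drop_map)

lemma alternating_contract: "alternating_form (Suc m) \<alpha> \<Longrightarrow> alternating_form m (contract X \<alpha>)"
  unfolding alternating_form_def[of m]
proof (intro conjI allI impI; elim conjE)
  fix vs :: "(real^'a) list" and i assume \<alpha>: "alternating_form (Suc m) \<alpha>" and *: "length vs = m" "i < m"
  then show "linear (\<lambda>u. contract X \<alpha> (vs[i := u]))"
    using alternating_formD_linear[OF \<alpha>, of "X # vs" "Suc i"] by (simp add: contract_def)
next
  fix vs :: "(real^'a) list" and i j
  assume \<alpha>: "alternating_form (Suc m) \<alpha>" and *: "length vs = m" "i < j" "j < m" "vs ! i = vs ! j"
  then have "\<not> distinct vs" by (simp add: distinct_conv_nth) (metis less_trans nat_neq_iff)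
  then show "contract X \<alpha> vs = 0"
    using alternating_form_not_distinct[OF \<alpha>, of "X # vs"] * by (simp add: contract_def)
qed

lemma alternating_form_sum:
  "finite I \<Longrightarrow> (\<And>i. i \<in> I \<Longrightarrow> alternating_form k (\<alpha> i)) \<Longrightarrow> alternating_form k (\<lambda>vs. \<Sum>i\<in>I. \<alpha> i vs)"
  unfolding alternating_form_def by (auto intro!: linear_compose_sum sum.neutral)

lemma alternating_form_pull_front:
  assumes \<alpha>: "alternating_form (Suc m) \<alpha>" and len: "length vs = Suc m" "i < Suc m"
  shows "\<alpha> (vs ! i # omit i vs) = (-1) ^ i * \<alpha> vs"
proof -
  have "vs = take i vs @ vs ! i # drop (Suc i) vs" using len by (simp add: id_take_nth_drop)
  moreover have "\<alpha> (vs ! i # take i vs @ drop (Suc i) vs) =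
      (-1) ^ length (take i vs) * \<alpha> (take i vs @ vs ! i # drop (Suc i) vs)"
    using alternating_form_move[OF \<alpha>, of "[]" "take i vs" "drop (Suc i) vs" "vs ! i"] len by simp
  ultimately show ?thesis using len by (simp add: omit_def)
qed

text \<open>Skew-symmetry in the last \<open>k\<close> places and in the first two generates skew-symmetry in all places.\<close>

lemma alternating_form_total:
  assumes alt: "\<And>u. alternating_form k (T u)" and lin: "\<And>vs. length vs = k \<Longrightarrow> linear (\<lambda>u. T u vs)"
    and rep: "\<And>u ws. length ws = k - 1 \<Longrightarrow> T u (u # ws) = 0" and k: "k > 0"
  shows "alternating_form (Suc k) (\<lambda>vs. T (hd vs) (tl vs))"
  unfolding alternating_form_def
proof (intro conjI allI impI; elim conjE)
  fix vs :: "(real^'a) list" and i assume *: "length vs = Suc k" "i < Suc k"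
  then obtain v ws where vs: "vs = v # ws" "length ws = k" by (auto simp: length_Suc_conv)
  show "linear (\<lambda>u. T (hd (vs[i := u])) (tl (vs[i := u])))"
    using vs * lin alternating_formD_linear[OF alt] by (cases i) auto
next
  fix vs :: "(real^'a) list" and i j assume *: "length vs = Suc k" "i < j" "j < Suc k" "vs ! i = vs ! j"
  then obtain v ws j' where vs: "vs = v # ws" "length ws = k" and j: "j = Suc j'"
    by (cases j) (auto simp: length_Suc_conv)
  obtain m where m: "k = Suc m" using k by (cases k) auto
  have "T v ws = 0"
  proof (cases i)
    case 0
    then have "T v (v # omit j' ws) = (-1) ^ j' * T v ws"
      using alternating_form_pull_front[of m "T v" ws j'] alt[of v] vs * j m by simp
    then show ?thesis using rep[of "omit j' ws" v] vs * j by simp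
  next
    case (Suc i')
    then show ?thesis
      using alt[of v] vs * j unfolding alternating_form_def by (metis Suc_less_eq nth_Cons_Suc)
  qed
  then show "T (hd vs) (tl vs) = 0" by (simp add: vs)
qed

text \<open>The conformal-Killing equation at one point, read in an adapted frame: \<open>T\<close> is the covariant derivative, \<open>\<beta>\<close> the
  codifferential, and the sum in \<open>killing\<close> the exterior derivative. The blocks are index lists of calibrated
  tuples of basis vectors; by \<open>cover\<close> every \<open>k - 1\<close> indices lie in a block.\<close>

locale conformal_killing_model =
  fixes k :: nat and \<alpha>\<^sub>0 :: "'n::finite form" and T :: "real^'n \<Rightarrow> 'n form"
    and \<beta> :: "'n form" and b :: real
    and blocks :: "'n list list" and indices :: "'n list"
  assumes k: "k > 0" and b: "b \<noteq> 0"
    and \<alpha>\<^sub>0: "alternating_form k \<alpha>\<^sub>0"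
    and T_alt: "\<And>u. alternating_form k (T u)" and T_lin: "\<And>vs. length vs = k \<Longrightarrow> linear (\<lambda>u. T u vs)"
    and T_calibrated: "\<And>u vs. \<lbrakk>length vs = k; (\<alpha>\<^sub>0 vs)\<^sup>2 = (\<Prod>i<k. vs ! i \<bullet> vs ! i); \<alpha>\<^sub>0 vs \<noteq> 0\<rbrakk> \<Longrightarrow> T u vs = 0"
    and \<beta>_alt: "alternating_form (k - 1) \<beta>"
    and killing: "\<And>u vs. length vs = k \<Longrightarrow> T u vs =
        1 / (real k + 1) * (\<Sum>i<Suc k. (-1) ^ i * T ((u # vs) ! i) (omit i (u # vs)))
        - b * covector_wedge (\<lambda>w. u \<bullet> w) \<beta> vs"
    and blocks: "\<And>t. t \<in> set blocks \<Longrightarrow> length t = k \<and> distinct t \<and> (\<alpha>\<^sub>0 (axes t))\<^sup>2 = 1"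
    and indices: "set indices = UNIV"
    and cover: "set (sublists_of_length (k - 1) indices) \<subseteq> (\<Union>t\<in>set blocks. (\<lambda>i. omit i t) ` {..<k})"
begin

lemma T_block: "t \<in> set blocks \<Longrightarrow> T u (axes t) = 0"
  using blocks[of t] by (intro T_calibrated) (auto simp: inner_axis_axis)

text \<open>With \<open>u\<close> repeated, the first two terms of the exterior derivative cancel and the others contain \<open>u\<close> twice.\<close>

lemma killing_repeated:
  assumes len: "length ws = k - 1"
  shows "T u (u # ws) = - b * covector_wedge (\<lambda>w. u \<bullet> w) \<beta> (u # ws)"
proof -
  let ?t = "\<lambda>i. (-1) ^ i * T ((u # u # ws) ! i) (omit i (u # u # ws))"
  have "(\<Sum>i<Suc k. ?t i) = (\<Sum>i\<in>{0, 1}. ?t i)"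
  proof (rule sum.mono_neutral_right)
    show "\<forall>i\<in>{..<Suc k} - {0, 1}. ?t i = 0"
    proof
      fix i assume i: "i \<in> {..<Suc k} - {0, 1}"
      then obtain i' where i': "i = Suc (Suc i')" by (cases i; cases "i - 1") auto
      then have "omit i (u # u # ws) = u # u # omit i' ws" by (simp add: omit_def)
      then have "T ((u # u # ws) ! i) (omit i (u # u # ws)) = 0"
        using i i' len by (intro alternating_form_not_distinct[OF T_alt]) auto
      then show "?t i = 0" by simp
    qed
  qed (use k in auto)
  also have "\<dots> = 0" by (simp add: omit_def)
  finally show ?thesis using killing[of "u # ws" u] len k by simp
qed

text \<open>Given indices \<open>js\<close>, complete them to a block by an index \<open>t ! i\<close>. For the basis vector \<open>u\<close> of this index the left side
  of \<open>killing_repeated\<close> vanishes by calibration, and the right side is \<open>- b \<beta>(js)\<close>.\<close>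

lemma \<beta>_zero: "length ws = k - 1 \<Longrightarrow> \<beta> ws = 0"
proof (rule alternating_form_eq_zero[OF \<beta>_alt indices])
  fix js assume "js \<in> set (sublists_of_length (k - 1) indices)"
  then obtain t i where t: "t \<in> set blocks" "i < k" "omit i t = js" using cover by blast
  let ?u = "axis (t ! i) 1 :: real^'n" and ?ws = "axes js"
  note tb = blocks[OF t(1)]
  obtain m where m: "k = Suc m" using k by (cases k) auto
  have "T ?u (axes t ! i # omit i (axes t)) = (-1) ^ i * T ?u (axes t)"
    by (rule alternating_form_pull_front) (use T_alt t tb m in auto)
  then have T0: "T ?u (?u # ?ws) = 0"
    using T_block[OF t(1)] t tb by (simp add: omit_map)
  have notin: "t ! i \<notin> set js"
  proof -
    have "t = take i t @ t ! i # drop (Suc i) t" using t tb by (simp add: id_take_nth_drop)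
    then have "distinct (take i t @ t ! i # drop (Suc i) t)" using tb by simp
    then show ?thesis using t by (auto simp: omit_def)
  qed
  have "covector_wedge (\<lambda>w. ?u \<bullet> w) \<beta> (?u # ?ws) =
      (\<Sum>i\<in>{0}. (-1) ^ i * (?u \<bullet> ((?u # ?ws) ! i)) * \<beta> (omit i (?u # ?ws)))"
    unfolding covector_wedge_def
  proof (rule sum.mono_neutral_right)
    show "\<forall>i\<in>{..<length (?u # ?ws)} - {0}. (-1) ^ i * (?u \<bullet> ((?u # ?ws) ! i)) * \<beta> (omit i (?u # ?ws)) = 0"
    proof
      fix i assume "i \<in> {..<length (?u # ?ws)} - {0}"
      then obtain l where "i = Suc l" "l < length js" by (cases i) auto
      moreover from this have "js ! l \<in> set js" by simp
      ultimately show "(-1) ^ i * (?u \<bullet> ((?u # ?ws) ! i)) * \<beta> (omit i (?u # ?ws)) = 0"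
        using notin by (auto simp: inner_axis_axis)
    qed
  qed auto
  also have "\<dots> = \<beta> ?ws" by (simp add: omit_def inner_axis_axis)
  finally show "\<beta> (axes js) = 0"
    using killing_repeated[of ?ws ?u] T0 t tb b by auto
qed

lemma T_repeated: "length ws = k - 1 \<Longrightarrow> T u (u # ws) = 0"
  using killing_repeated[of ws u] \<beta>_zero k by (simp add: covector_wedge_def)

definition \<tau> :: "'n form" where "\<tau> vs = T (hd vs) (tl vs)"

lemma alternating_\<tau>: "alternating_form (Suc k) \<tau>"
  unfolding \<tau>_def using T_alt T_lin T_repeated k by (rule alternating_form_total)

lemma \<tau>_calibrated:
  assumes "length vs = Suc k" "i < Suc k" "T (vs ! i) (omit i vs) = 0"
  shows "\<tau> vs = 0"
  using alternating_form_pull_front[OF alternating_\<tau> assms(1,2)] assms(3) by (simp add: \<tau>_def)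

lemma \<tau>_block:
  assumes "length is = Suc k" "i < Suc k" "omit i is \<in> set blocks"
  shows "\<tau> (axes is) = 0"
  by (rule \<tau>_calibrated[of _ i]) (use assms T_block in \<open>auto simp: omit_map\<close>)

end

section \<open>Fano lines and Cayley quadruples\<close>

definition fano_lines :: "7 list list" where
  "fano_lines = [[1,2,3], [1,4,5], [1,6,7], [2,4,6], [2,5,7], [3,4,7], [3,5,6]]"

definition cayley_quads :: "8 list list" where
  "cayley_quads = [[0,1,2,3], [0,1,4,5], [0,1,6,7], [0,2,4,6], [0,2,5,7], [0,3,4,7], [0,3,5,6],
     [4,5,6,7], [2,3,6,7], [2,3,4,5], [1,3,5,7], [1,3,4,6], [1,2,5,6], [1,2,4,7]]"

text \<open>For index lists of the same length, the sign of the permutation taking one to the other, or \<open>0\<close> if there is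
  none. It is computed by expanding the
  determinant \<open>basis_form\<close> along the only non-zero entry of each row, which makes the evaluation of the model forms on basis
  vectors fast.\<close>

primrec basis_sign :: "'n list \<Rightarrow> 'n list \<Rightarrow> real" where
  "basis_sign [] js = 1"
| "basis_sign (i # is) js =
     (if i \<in> set js then (-1) ^ length (takeWhile (\<lambda>j. j \<noteq> i) js) * basis_sign is (remove1 i js) else 0)"

lemma basis_form_axes: "distinct js \<Longrightarrow> basis_form is (axes js) = basis_sign is js"
proof (induction "is" arbitrary: js)
  case (Cons i "is")
  let ?t = "\<lambda>l. (-1) ^ l * axes js ! l $ i * basis_form is (omit l (axes js))"
  show ?case
  proof (cases "i \<in> set js")
    case False
    then have "(\<Sum>l<length (axes js). ?t l) = 0"
      by (intro sum.neutral) (auto simp: axis_def)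
    then show ?thesis using False by (simp add: basis_form.simps(2) covector_wedge_def)
  next
    case True
    then obtain us ws where js: "js = us @ i # ws" by (meson split_list)
    then have notin: "i \<notin> set us" "i \<notin> set ws" using Cons.prems by auto
    have "(\<Sum>l<length (axes js). ?t l) = (\<Sum>l\<in>{length us}. ?t l)"
    proof (rule sum.mono_neutral_right)
      show "\<forall>l\<in>{..<length (axes js)} - {length us}. ?t l = 0"
      proof
        fix l assume l: "l \<in> {..<length (axes js)} - {length us}"
        then have lj: "l < length js" by simp
        have i: "js ! length us = i" by (simp add: js)
        have "js ! l \<noteq> i"
          using l lj nth_eq_iff_index_eq[OF Cons.prems, of l "length us"] i js by auto
        then have "axes js ! l $ i = 0" using lj by (simp add: axis_def)
        then show "?t l = 0" by simp
      qed
    qed (use js in auto)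
    also have "\<dots> = (-1) ^ length us * basis_form is (axes (us @ ws))"
      using js by (simp add: omit_def nth_append)
    also have "\<dots> = basis_sign (i # is) js"
    proof -
      have "takeWhile (\<lambda>j. j \<noteq> i) js = us" "remove1 i js = us @ ws"
        using notin js by (auto simp: takeWhile_append remove1_append)
      then show ?thesis using Cons.IH[of "us @ ws"] Cons.prems js by simp
    qed
    finally show ?thesis by (simp add: basis_form.simps(2) covector_wedge_def)
  qed
qed simp

lemma phi0_axes: "distinct is \<Longrightarrow> phi0 (axes is) =
    basis_sign [1,2,3] is + basis_sign [1,4,5] is + basis_sign [1,6,7] is + basis_sign [2,4,6] is
  - basis_sign [2,5,7] is - basis_sign [3,4,7] is - basis_sign [3,5,6] is"
  by (simp only: phi0_def basis_form_axes)

lemma psi0_axes: "distinct is \<Longrightarrow> psi0 (axes is) =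
    basis_sign [0,1,2,3] is + basis_sign [0,1,4,5] is + basis_sign [0,1,6,7] is
  + basis_sign [0,2,4,6] is - basis_sign [0,2,5,7] is - basis_sign [0,3,4,7] is - basis_sign [0,3,5,6] is
  + basis_sign [4,5,6,7] is + basis_sign [2,3,6,7] is + basis_sign [2,3,4,5] is
  + basis_sign [1,3,5,7] is - basis_sign [1,3,4,6] is - basis_sign [1,2,5,6] is - basis_sign [1,2,4,7] is"
  by (simp only: psi0_def basis_form_axes)

lemma phi0_lines: "t \<in> set fano_lines \<Longrightarrow> length t = 3 \<and> distinct t \<and> (phi0 (axes t))\<^sup>2 = 1"
  unfolding fano_lines_def set_simps by (elim insertE emptyE; simp add: phi0_axes del: list.map)

lemma psi0_quads: "t \<in> set cayley_quads \<Longrightarrow> length t = 4 \<and> distinct t \<and> (psi0 (axes t))\<^sup>2 = 1"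
  unfolding cayley_quads_def set_simps by (elim insertE emptyE; simp add: psi0_axes del: list.map)

abbreviation "indices7 \<equiv> [1,2,3,4,5,6,7 :: 7]"
abbreviation "indices8 \<equiv> [0,1,2,3,4,5,6,7 :: 8]"

text \<open>Any two points of the Fano plane lie on a line.\<close>

lemma fano_lines_cover:
  "set (sublists_of_length (3 - 1) indices7) \<subseteq> (\<Union>t\<in>set fano_lines. (\<lambda>i. omit i t) ` {..<3})"
  by (simp add: fano_lines_def numeral_eq_Suc omit_def lessThan_Suc)

text \<open>Any three points lie in a quadruple: the quadruples are the planes of the affine space of dimension three
  over the field with two elements, whose points are the indices written in binary.\<close>

lemma cayley_quads_cover:
  "set (sublists_of_length (4 - 1) indices8) \<subseteq> (\<Union>t\<in>set cayley_quads. (\<lambda>i. omit i t) ` {..<4})"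
  by (simp add: cayley_quads_def numeral_eq_Suc omit_def lessThan_Suc)

text \<open>Conceptually: three points \<open>p\<close>, \<open>q\<close>, \<open>r\<close> are left out; the plane through them has a fourth point, and the
  remaining four points form the parallel plane.\<close>

lemma five_indices_contain_cayley_quad:
  "\<forall>is\<in>set (sublists_of_length 5 indices8). length is = 5 \<and> (\<exists>t\<in>(\<lambda>i. omit i is) ` {..<5}. t \<in> set cayley_quads)"
  by (simp add: cayley_quads_def numeral_eq_Suc omit_def lessThan_Suc)

text \<open>Every coefficient of the five-form \<open>\<tau>\<close> contains a Cayley quadruple and so vanishes.\<close>

lemma spin7_killing_model:
  assumes "conformal_killing_model 4 psi0 T \<beta> b cayley_quads indices8" and len: "length vs = 4"
  shows "T u vs = 0"
proof -
  interpret conformal_killing_model 4 psi0 T \<beta> b cayley_quads indices8 by fact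
  have "\<tau> (u # vs) = 0"
  proof (rule alternating_form_eq_zero[OF alternating_\<tau>, of indices8])
    fix "is" assume "is \<in> set (sublists_of_length (Suc 4) indices8)"
    then have "is \<in> set (sublists_of_length 5 indices8)" by simp
    then obtain i where "length is = 5" "i < 5" "omit i is \<in> set cayley_quads"
      using five_indices_contain_cayley_quad by blast
    then show "\<tau> (axes is) = 0" by (intro \<tau>_block) auto
  qed (use len in \<open>simp_all add: UNIV_8\<close>)
  then show ?thesis by (simp add: \<tau>_def)
qed

text \<open>The Hodge dual of \<open>phi0\<close>; see \<open>phi0_vol7_pairing\<close>. It is the part of \<open>psi0\<close> that does not involve the index \<open>0\<close>.\<close>

definition phi0_dual :: "7 form" where
  "phi0_dual vs = basis_form [4,5,6,7] vs + basis_form [2,3,6,7] vs + basis_form [2,3,4,5] vs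
     + basis_form [1,3,5,7] vs - basis_form [1,3,4,6] vs - basis_form [1,2,5,6] vs - basis_form [1,2,4,7] vs"

lemma alternating_phi0_dual: "alternating_form 4 phi0_dual"
  unfolding phi0_dual_def
  by (intro alternating_form_add alternating_form_diff alternating_basis_form) simp_all

lemma phi0_dual_axes: "distinct is \<Longrightarrow> phi0_dual (axes is) =
    basis_sign [4,5,6,7] is + basis_sign [2,3,6,7] is + basis_sign [2,3,4,5] is
  + basis_sign [1,3,5,7] is - basis_sign [1,3,4,6] is - basis_sign [1,2,5,6] is - basis_sign [1,2,4,7] is"
  by (simp only: phi0_dual_def basis_form_axes)

lemma sublists_of_length_too_long: "length xs < k \<Longrightarrow> sublists_of_length k xs = []"
  by (induction xs arbitrary: k) (auto split: nat.split)

lemma sublists_of_length_self: "sublists_of_length (length xs) xs = [xs]"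
  by (induction xs) (simp_all add: sublists_of_length_too_long)

lemma alternating_form_zero_permuted:
  assumes "alternating_form k \<alpha>" "\<alpha> (axes js) = 0" "length js = k" "length is = k" "set is \<subseteq> set js"
  shows "\<alpha> (axes is) = 0"
  using alternating_form_zero_on_sublists[OF assms(1), of k js "[]" "\<lambda>i. axis i 1" "is"] assms
    sublists_of_length_self[of js] by auto

text \<open>Four points of the Fano plane contain a line or form the complement of a line. The coefficients of \<open>*\<phi>\<^sub>0\<close> vanish
  in the first case.\<close>

lemma four_indices_fano:
  "\<forall>is\<in>set (sublists_of_length 4 indices7). length is = 4 \<and>
     ((\<exists>t\<in>(\<lambda>i. omit i is) ` {..<4}. t \<in> set fano_lines \<and> phi0_dual (axes is) = 0) \<or>
      is \<in> {[4,5,6,7], [2,3,6,7], [2,3,4,5], [1,3,5,7], [1,3,4,6], [1,2,5,6], [1,2,4,7]})"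
  by (simp add: fano_lines_def numeral_eq_Suc omit_def lessThan_Suc phi0_dual_axes del: list.map)

text \<open>The difference \<open>D\<close> of \<open>\<tau>\<close> and \<open>c *\<phi>\<^sub>0\<close> vanishes on quadruples containing a Fano line, and \<open>c\<close> is chosen so that it
  vanishes on \<open>4567\<close>. If \<open>ijl\<close> and \<open>ij'l'\<close> are two lines through \<open>i\<close> of signs \<open>p\<close> and \<open>p'\<close>, then
  \<open>(e\<^sub>i, e\<^sub>j + e\<^sub>j\<^sub>', p e\<^sub>l + p' e\<^sub>l\<^sub>')\<close> is calibrated; expanding \<open>T\<close> on it (\<open>polar\<close>) relates the coefficients of the
  quadruples \<open>wijl'\<close> and \<open>wij'l\<close>. Six such relations connect \<open>4567\<close> with the complements of the other lines.\<close>

lemma g2_killing_model: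
  assumes "conformal_killing_model 3 phi0 T \<beta> b fano_lines indices7"
  shows "\<exists>c. \<forall>u vs. length vs = 3 \<longrightarrow> T u vs = c * phi0_dual (u # vs)"
proof -
  interpret conformal_killing_model 3 phi0 T \<beta> b fano_lines indices7 by fact
  define c where "c = \<tau> (axes [4,5,6,7])"
  define D where "D vs = \<tau> vs - c * phi0_dual vs" for vs
  have D_alt: "alternating_form 4 D"
    using alternating_form_diff[OF _ alternating_form_cmult[OF alternating_phi0_dual], of \<tau> c] alternating_\<tau>
    by (simp add: D_def[abs_def])
  have polar: "p' * \<tau> (axes [w, i, j, l']) + p * \<tau> (axes [w, i, j', l]) = 0"
    if d: "i \<noteq> j" "i \<noteq> j'" "i \<noteq> l" "i \<noteq> l'" "j \<noteq> j'" "l \<noteq> l'"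
      and \<phi>: "phi0 (axes [i, j, l]) = p" "phi0 (axes [i, j', l']) = p'"
        "phi0 (axes [i, j, l']) = 0" "phi0 (axes [i, j', l]) = 0"
      and p: "p\<^sup>2 = 1" "p'\<^sup>2 = 1" for w i j j' l l' p p'
  proof -
    let ?a = "\<lambda>i. axis i 1 :: real^7"
    have cal: "T w [?a i, ?a j, ?a l] = 0" if "phi0 (axes [i, j, l])^2 = 1" for w i j l
    proof (rule T_calibrated)
      show "(phi0 [?a i, ?a j, ?a l])\<^sup>2 = (\<Prod>n<3. [?a i, ?a j, ?a l] ! n \<bullet> [?a i, ?a j, ?a l] ! n)"
        using that by (simp add: prod_lessThan_3 inner_axis_axis)
    qed (use that in auto)
    have lin2: "linear (\<lambda>y. \<alpha> [x, y, z])" and lin3: "linear (\<lambda>z. \<alpha> [x, y, z])"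
      if "alternating_form 3 \<alpha>" for \<alpha> :: "7 form" and x y z
      using alternating_form_linear_slot[OF that, of "[x]" "[z]"]
        alternating_form_linear_slot[OF that, of "[x, y]" "[]"] by simp_all
    note exp = linear_add[OF lin2] linear_add[OF lin3] linear_scale[OF lin3]
    let ?vs = "[?a i, ?a j + ?a j', p *\<^sub>R ?a l + p' *\<^sub>R ?a l']"
    have "phi0 ?vs = 2"
      using \<phi> p by (simp add: exp[OF alternating_phi0] power2_eq_square)
    moreover have "(\<Prod>n<3. ?vs ! n \<bullet> ?vs ! n) = 4"
      using d p by (simp add: prod_lessThan_3 inner_axis_axis inner_add_left inner_add_right power2_eq_square)
    ultimately have "T (?a w) ?vs = 0" by (intro T_calibrated) auto
    then show ?thesis
      using cal[of i j l "?a w"] cal[of i j' l' "?a w"] \<phi> p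
      by (simp add: exp[OF T_alt] \<tau>_def)
  qed
  have D0: "D (axes [4,5,6,7]) = 0"
    by (simp add: D_def c_def phi0_dual_axes del: list.map)
  have step: "D (axes is) = 0"
    if rel: "p' * \<tau> (axes js) + p * \<tau> (axes is) = 0" and rel': "p' * phi0_dual (axes js) + p * phi0_dual (axes is) = 0"
      and js: "length js = 4" "set js \<subseteq> set [4,5,6,7]" and p: "p\<^sup>2 = 1" for p p' js "is"
  proof -
    have "D (axes js) = 0"
      by (rule alternating_form_zero_permuted[OF D_alt D0]) (use js in auto)
    moreover have "p' * D (axes js) + p * D (axes is) = 0"
    proof -
      have "p' * D (axes js) + p * D (axes is) =
          (p' * \<tau> (axes js) + p * \<tau> (axes is)) - c * (p' * phi0_dual (axes js) + p * phi0_dual (axes is))"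
        by (simp add: D_def algebra_simps)
      then show ?thesis using rel rel' by simp
    qed
    ultimately show ?thesis using p by auto
  qed
  have s1: "D (axes [7,4,2,1]) = 0"
    by (rule step[OF polar[where i=4 and j=5 and l=1 and j'=2 and l'=6 and w=7 and p="1" and p'="-1"]])
      (simp_all add: phi0_axes phi0_dual_axes del: list.map)
  have s2: "D (axes [6,4,3,1]) = 0"
    by (rule step[OF polar[where i=4 and j=5 and l=1 and j'=3 and l'=7 and w=6 and p="1" and p'="1"]])
      (simp_all add: phi0_axes phi0_dual_axes del: list.map)
  have s3: "D (axes [5,4,3,2]) = 0"
    by (rule step[OF polar[where i=4 and j=6 and l=2 and j'=3 and l'=7 and w=5 and p="1" and p'="1"]])
      (simp_all add: phi0_axes phi0_dual_axes del: list.map)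
  have s4: "D (axes [6,5,2,1]) = 0"
    by (rule step[OF polar[where i=5 and j=4 and l=1 and j'=2 and l'=7 and w=6 and p="-1" and p'="1"]])
      (simp_all add: phi0_axes phi0_dual_axes del: list.map)
  have s5: "D (axes [7,5,3,1]) = 0"
    by (rule step[OF polar[where i=5 and j=4 and l=1 and j'=3 and l'=6 and w=7 and p="-1" and p'="1"]])
      (simp_all add: phi0_axes phi0_dual_axes del: list.map)
  have s6: "D (axes [7,6,3,2]) = 0"
    by (rule step[OF polar[where i=6 and j=4 and l=2 and j'=3 and l'=5 and w=7 and p="-1" and p'="-1"]])
      (simp_all add: phi0_axes phi0_dual_axes del: list.map)
  have D_zero: "D vs = 0" if "length vs = 4" for vs
  proof (rule alternating_form_eq_zero[OF D_alt, of indices7])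
    fix "is" assume "is \<in> set (sublists_of_length 4 indices7)"
    then consider i where "length is = 4" "i < 4" "omit i is \<in> set fano_lines" "phi0_dual (axes is) = 0"
      | "is \<in> {[4,5,6,7], [2,3,6,7], [2,3,4,5], [1,3,5,7], [1,3,4,6], [1,2,5,6], [1,2,4,7]}"
      using four_indices_fano by fast
    then show "D (axes is) = 0"
    proof cases
      case 1
      then have "\<tau> (axes is) = 0" by (intro \<tau>_block[of _ i]) auto
      then show ?thesis using 1 by (simp add: D_def)
    next
      case 2
      note perm = alternating_form_zero_permuted[OF D_alt]
      from 2 show ?thesis
        by (elim insertE emptyE; hypsubst)
          (rule perm[OF D0] perm[OF s1] perm[OF s2] perm[OF s3] perm[OF s4] perm[OF s5] perm[OF s6];
            simp; fail)+
    qed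
  qed (use that in \<open>simp_all add: UNIV_7\<close>)
  have "T u vs = c * phi0_dual (u # vs)" if "length vs = 3" for u vs
    using D_zero[of "u # vs"] that by (simp add: D_def \<tau>_def)
  then show ?thesis by blast
qed

section \<open>The Hodge star and the generator\<close>

abbreviation "multi_indices m \<equiv> {is. length is = m} :: 'n::finite list set"

lemma sum_multi_indices_Suc:
  "(\<Sum>is\<in>multi_indices (Suc m). G is) = (\<Sum>i\<in>UNIV. \<Sum>is\<in>multi_indices m. G ((i :: 'n::finite) # is) :: real)"
proof -
  have "(\<Sum>is\<in>multi_indices (Suc m). G is) = (\<Sum>(i, is)\<in>UNIV \<times> multi_indices m. G (i # is))"
    by (rule sum.reindex_bij_witness[where i = "\<lambda>(i, is). i # is" and j = "\<lambda>is. (hd is, tl is)"])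
      (auto simp: length_Suc_conv)
  then show ?thesis by (simp add: sum.cartesian_product)
qed

lemma sum_multi_indices_insert:
  assumes "j \<le> m"
  shows "(\<Sum>is\<in>multi_indices (Suc m). G (is ! j) (omit j is)) =
    (\<Sum>i\<in>UNIV. \<Sum>is\<in>multi_indices m. G (i :: 'n::finite) is :: real)"
proof -
  have "(\<Sum>is\<in>multi_indices (Suc m). G (is ! j) (omit j is)) =
      (\<Sum>(i, is)\<in>UNIV \<times> multi_indices m. G i is)"
    by (rule sum.reindex_bij_witness[where i = "\<lambda>(i, is). take j is @ i # drop j is"
          and j = "\<lambda>is. (is ! j, omit j is)"])
      (use assms in \<open>auto simp: omit_def nth_append id_take_nth_drop[symmetric] min_def\<close>)
  then show ?thesis by (simp add: sum.cartesian_product)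
qed

text \<open>Wedging with \<open>\<xi>\<close> is adjoint to contraction with \<open>\<xi>\<close>. Each of the \<open>m + 1\<close> summands of the wedge product gives the same
  contribution, since \<open>\<gamma>\<close> compensates the sign.\<close>

lemma wedge_pairing:
  fixes h :: "'n::finite \<Rightarrow> real^'n"
  assumes \<gamma>: "alternating_form (Suc m) \<gamma>"
  shows "(\<Sum>is\<in>multi_indices (Suc m). covector_wedge \<xi> \<alpha> (map h is) * \<gamma> (map h is)) =
    real (Suc m) * (\<Sum>i\<in>UNIV. \<Sum>is\<in>multi_indices m. \<xi> (h i) * \<alpha> (map h is) * \<gamma> (h i # map h is))"
proof -
  let ?G = "\<lambda>i is. \<xi> (h i) * \<alpha> (map h is) * \<gamma> (h i # map h is)"
  have "covector_wedge \<xi> \<alpha> (map h is) * \<gamma> (map h is) = (\<Sum>j<Suc m. ?G (is ! j) (omit j is))"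
    if "length is = Suc m" for "is"
  proof -
    have G: "(-1) ^ j * \<xi> (h (is ! j)) * \<alpha> (map h (omit j is)) * \<gamma> (map h is) = ?G (is ! j) (omit j is)"
      if j: "j < Suc m" for j
    proof -
      have "\<gamma> (map h is ! j # omit j (map h is)) = (-1) ^ j * \<gamma> (map h is)"
        by (rule alternating_form_pull_front[OF \<gamma>]) (use j \<open>length is = Suc m\<close> in auto)
      then have "\<gamma> (h (is ! j) # map h (omit j is)) = (-1) ^ j * \<gamma> (map h is)"
        using j \<open>length is = Suc m\<close> by (simp add: omit_map)
      then show ?thesis by simp
    qed
    have "covector_wedge \<xi> \<alpha> (map h is) * \<gamma> (map h is) =
        (\<Sum>j<Suc m. (-1) ^ j * \<xi> (h (is ! j)) * \<alpha> (map h (omit j is)) * \<gamma> (map h is))"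
      using that by (simp add: covector_wedge_def sum_distrib_right omit_map del: sum.lessThan_Suc)
    also have "\<dots> = (\<Sum>j<Suc m. ?G (is ! j) (omit j is))"
      by (intro sum.cong refl G) simp
    finally show ?thesis .
  qed
  then have "(\<Sum>is\<in>multi_indices (Suc m). covector_wedge \<xi> \<alpha> (map h is) * \<gamma> (map h is)) =
      (\<Sum>is\<in>multi_indices (Suc m). \<Sum>j<Suc m. ?G (is ! j) (omit j is))" by simp
  also have "\<dots> = (\<Sum>j<Suc m. \<Sum>is\<in>multi_indices (Suc m). ?G (is ! j) (omit j is))"
    by (rule sum.swap)
  also have "\<dots> = (\<Sum>j<Suc m. \<Sum>i\<in>UNIV. \<Sum>is\<in>multi_indices m. ?G i is)"
    by (intro sum.cong refl sum_multi_indices_insert) auto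
  finally show ?thesis by simp
qed

lemma basis_form_pairing:
  fixes t :: "'n::finite list"
  shows "length t = m \<Longrightarrow> alternating_form m \<gamma> \<Longrightarrow>
    (\<Sum>is\<in>multi_indices m. basis_form t (axes is) * \<gamma> (axes is)) = fact m * \<gamma> (axes t)"
proof (induction m arbitrary: t \<gamma>)
  case 0
  have "multi_indices 0 = {[] :: 'n list}" by auto
  then show ?case using 0 by simp
next
  case (Suc m)
  then obtain i t' where t: "t = i # t'" "length t' = m" by (auto simp: length_Suc_conv)
  let ?c = "contract (axis i 1) \<gamma>"
  have "(\<Sum>is\<in>multi_indices (Suc m). basis_form t (axes is) * \<gamma> (axes is)) =
      real (Suc m) * (\<Sum>j\<in>UNIV. \<Sum>is\<in>multi_indices m. axis j 1 $ i * basis_form t' (axes is) * \<gamma> (axis j 1 # axes is))"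
    using wedge_pairing[OF Suc.prems(2), of "\<lambda>v. v $ i" "basis_form t'" "\<lambda>i. axis i 1"]
    by (simp add: t basis_form.simps(2))
  also have "(\<Sum>j\<in>UNIV. \<Sum>is\<in>multi_indices m. axis j 1 $ i * basis_form t' (axes is) * \<gamma> (axis j 1 # axes is))
      = (\<Sum>j\<in>{i}. \<Sum>is\<in>multi_indices m. axis j 1 $ i * basis_form t' (axes is) * \<gamma> (axis j 1 # axes is))"
    by (rule sum.mono_neutral_right) (auto simp: axis_def)
  also have "\<dots> = (\<Sum>is\<in>multi_indices m. basis_form t' (axes is) * ?c (axes is))"
    by (simp add: contract_def axis_def)
  also have "\<dots> = fact m * ?c (axes t')"
    by (rule Suc.IH[OF t(2) alternating_contract[OF Suc.prems(2)]])
  finally show ?case by (simp add: t contract_def)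
qed

definition orthonormal :: "('n::finite \<Rightarrow> real^'n) \<Rightarrow> bool" where
  "orthonormal h \<longleftrightarrow> (\<forall>i j. h i \<bullet> h j = (if i = j then 1 else 0))"

lemma orthonormal_expand:
  fixes h :: "'n::finite \<Rightarrow> real^'n"
  assumes h: "orthonormal h"
  shows "(\<Sum>k\<in>UNIV. (h k \<bullet> v) *\<^sub>R h k) = v"
proof -
  let ?H = "(\<chi> k. h k) :: real^'n^'n"
  have "?H ** transpose ?H = mat 1"
    using h by (simp add: vec_eq_iff matrix_matrix_mult_def transpose_def mat_def orthonormal_def inner_vec_def)
  then have HH: "transpose ?H ** ?H = mat 1" by (simp add: matrix_left_right_inverse)
  have "(\<Sum>k\<in>UNIV. (h k \<bullet> v) *\<^sub>R h k) = transpose ?H *v (?H *v v)"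
    by (simp add: vec_eq_iff matrix_vector_mult_def transpose_def inner_vec_def mult.commute)
  also have "\<dots> = v" by (simp add: matrix_vector_mul_assoc HH)
  finally show ?thesis .
qed

text \<open>The trace of the bilinear form \<open>a(u) b(v)\<close> is the same in all orthonormal bases. Iterated over the indices, this makes
  the sum in the Hodge star independent of the basis (\<open>pairing_orthonormal\<close>).\<close>

lemma orthonormal_trace:
  fixes h :: "'n::finite \<Rightarrow> real^'n" and a b :: "real^'n \<Rightarrow> real"
  assumes h: "orthonormal h" and a: "linear a" and b: "linear b"
  shows "(\<Sum>k\<in>UNIV. a (h k) * b (h k)) = (\<Sum>k\<in>UNIV. a (axis k 1) * b (axis k 1))"
proof -
  have b': "b v = (\<Sum>k\<in>UNIV. v $ k * b (axis k 1))" for v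
    using linear_sum[OF b, of "\<lambda>i. (v $ i) *\<^sub>R axis i 1" UNIV] vec_expand[of v]
    by (simp add: linear_scale[OF b])
  have "a v = (\<Sum>k\<in>UNIV. (h k \<bullet> v) * a (h k))" for v
    using linear_sum[OF a, of "\<lambda>k. (h k \<bullet> v) *\<^sub>R h k" UNIV] orthonormal_expand[OF h, of v]
    by (simp add: linear_scale[OF a])
  note a' = this
  have "(\<Sum>j\<in>UNIV. a (axis j 1) * b (axis j 1)) = (\<Sum>j\<in>UNIV. \<Sum>k\<in>UNIV. h k $ j * a (h k) * b (axis j 1))"
    by (simp add: a'[of "axis _ 1"] sum_distrib_right inner_axis)
  also have "\<dots> = (\<Sum>k\<in>UNIV. \<Sum>j\<in>UNIV. a (h k) * (h k $ j * b (axis j 1)))"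
    by (subst sum.swap) (simp add: mult_ac)
  also have "\<dots> = (\<Sum>k\<in>UNIV. a (h k) * b (h k))"
    by (intro sum.cong refl) (simp only: b'[of "h _"] sum_distrib_left)
  finally show ?thesis by simp
qed

lemma pairing_orthonormal:
  fixes h :: "'n::finite \<Rightarrow> real^'n"
  assumes h: "orthonormal h"
  shows "alternating_form m \<alpha> \<Longrightarrow> alternating_form m \<gamma> \<Longrightarrow>
    (\<Sum>is\<in>multi_indices m. \<alpha> (map h is) * \<gamma> (map h is)) = (\<Sum>is\<in>multi_indices m. \<alpha> (axes is) * \<gamma> (axes is))"
proof (induction m arbitrary: \<alpha> \<gamma>)
  case 0
  have "multi_indices 0 = {[] :: 'n list}" by auto
  then show ?case by simp
next
  case (Suc m)
  have "(\<Sum>is\<in>multi_indices (Suc m). \<alpha> (map h is) * \<gamma> (map h is)) =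
      (\<Sum>i\<in>UNIV. \<Sum>is\<in>multi_indices m. contract (h i) \<alpha> (map h is) * contract (h i) \<gamma> (map h is))"
    unfolding sum_multi_indices_Suc by (simp add: contract_def)
  also have "\<dots> = (\<Sum>i\<in>UNIV. \<Sum>is\<in>multi_indices m. contract (h i) \<alpha> (axes is) * contract (h i) \<gamma> (axes is))"
    by (intro sum.cong refl Suc.IH alternating_contract Suc.prems)
  also have "\<dots> = (\<Sum>is\<in>multi_indices m. \<Sum>i\<in>UNIV. \<alpha> (h i # axes is) * \<gamma> (h i # axes is))"
    by (subst sum.swap) (simp add: contract_def)
  also have "\<dots> = (\<Sum>is\<in>multi_indices m. \<Sum>i\<in>UNIV. \<alpha> (axis i 1 # axes is) * \<gamma> (axis i 1 # axes is))"
  proof (rule sum.cong[OF refl])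
    fix "is" :: "'n list" assume "is \<in> multi_indices m"
    then have "linear (\<lambda>v. \<alpha> (v # axes is))" "linear (\<lambda>v. \<gamma> (v # axes is))"
      using alternating_form_linear_slot[OF Suc.prems(1), of "[]"]
        alternating_form_linear_slot[OF Suc.prems(2), of "[]"] by auto
    then show "(\<Sum>i\<in>UNIV. \<alpha> (h i # axes is) * \<gamma> (h i # axes is)) =
        (\<Sum>i\<in>UNIV. \<alpha> (axis i 1 # axes is) * \<gamma> (axis i 1 # axes is))"
      by (rule orthonormal_trace[OF h])
  qed
  also have "\<dots> = (\<Sum>is\<in>multi_indices (Suc m). \<alpha> (axes is) * \<gamma> (axes is))"
    unfolding sum_multi_indices_Suc by (subst sum.swap) simp
  finally show ?case .
qed

abbreviation vol7 :: "7 form" where "vol7 \<equiv> basis_form indices7"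

lemma alternating_vol7: "alternating_form 7 vol7"
  by (rule alternating_basis_form) simp

lemma alternating_append:
  "alternating_form (m + l) \<gamma> \<Longrightarrow> length ws = l \<Longrightarrow> alternating_form m (\<lambda>vs. \<gamma> (vs @ ws))"
  unfolding alternating_form_def[of m]
proof (intro conjI allI impI; elim conjE)
  fix vs :: "(real^'a) list" and i
  assume \<gamma>: "alternating_form (m + l) \<gamma>" and ws: "length ws = l" and *: "length vs = m" "i < m"
  then show "linear (\<lambda>u. \<gamma> (vs[i := u] @ ws))"
    using alternating_formD_linear[OF \<gamma>, of "vs @ ws" i] by (simp add: list_update_append)
next
  fix vs :: "(real^'a) list" and i j
  assume \<gamma>: "alternating_form (m + l) \<gamma>" and ws: "length ws = l" and *: "length vs = m" "i < j" "j < m" "vs ! i = vs ! j"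
  then have "\<not> distinct vs" by (simp add: distinct_conv_nth) (metis less_trans nat_neq_iff)
  then show "\<gamma> (vs @ ws) = 0"
    using alternating_form_not_distinct[OF \<gamma>, of "vs @ ws"] * ws by simp
qed

lemma alternating_prepend:
  "alternating_form (l + m) \<gamma> \<Longrightarrow> length us = l \<Longrightarrow> alternating_form m (\<lambda>vs. \<gamma> (us @ vs))"
proof (induction us arbitrary: l \<gamma>)
  case (Cons u us)
  then obtain l' where "l = Suc l'" by (cases l) auto
  then show ?case
    using Cons.IH[OF alternating_contract[of "l' + m" \<gamma> u]] Cons.prems by (simp add: contract_def)
qed simp

lemma basis_sign_eq_0: "\<not> set is \<subseteq> set js \<Longrightarrow> basis_sign is js = 0"
proof (induction "is" arbitrary: js)
  case (Cons i "is")
  then show ?case using set_remove1_subset[of i js] by auto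
qed simp

lemma basis_sign_self: "basis_sign is is = 1"
  by (induction "is") simp_all

text \<open>If \<open>t\<close> and \<open>q\<close> are complementary index lists in positive order, then contracting the volume form with the vectors of \<open>t\<close> gives
  the basis form of \<open>q\<close>. It turns the signs of \<open>\<phi>\<^sub>0\<close> into those of \<open>*\<phi>\<^sub>0\<close>.\<close>

lemma vol7_line:
  assumes t: "length t = 3" and q: "length q = 4"
    and tq: "distinct (t @ q)" and sign: "basis_sign indices7 (t @ q) = 1"
    and ws: "length ws = 4"
  shows "vol7 (axes t @ ws) = basis_form q ws"
proof -
  have alt: "alternating_form 4 (\<lambda>ws. vol7 (axes t @ ws) - basis_form q ws)"
    by (rule alternating_form_diff[OF alternating_prepend[of 3] alternating_basis_form])
      (use alternating_vol7 t q in simp_all)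
  have UNIV: "set t \<union> set q = UNIV"
  proof (rule card_subset_eq)
    show "card (set t \<union> set q) = card (UNIV :: 7 set)"
      using distinct_card[OF tq] t q by simp
  qed simp_all
  have "vol7 (axes t @ ws) - basis_form q ws = 0"
  proof (rule alternating_form_zero_from_axes[OF alt _ ws])
    fix js :: "7 list" assume js: "length js = 4"
    show "vol7 (axes t @ axes js) - basis_form q (axes js) = 0"
    proof (cases "set js \<subseteq> set q")
      case True
      have "vol7 (axes (t @ q)) = 1" "basis_form q (axes q) = 1"
        using sign tq basis_sign_self[of q] basis_form_axes[of q q] by (simp_all only: basis_form_axes distinct_append)
      then have "vol7 (axes t @ axes q) - basis_form q (axes q) = 0" by simp
      then show ?thesis by (rule alternating_form_zero_permuted[OF alt]) (use js q True in auto)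
    next
      case False
      then have "\<not> distinct (axes (t @ js))" using UNIV by (auto simp: distinct_map)
      then have "vol7 (axes (t @ js)) = 0"
        by (intro alternating_form_not_distinct[OF alternating_vol7]) (use t js in simp_all)
      moreover have "basis_form q (axes js) = 0"
      proof (cases "distinct js")
        case True
        have "\<not> set q \<subseteq> set js"
        proof
          assume "set q \<subseteq> set js"
          moreover have "card (set q) = card (set js)"
            using True tq q js by (simp add: distinct_card)
          ultimately have "set q = set js" by (simp add: card_subset_eq)
          then show False using False by simp
        qed
        then show ?thesis using True by (simp add: basis_form_axes basis_sign_eq_0)
      next
        case False
        then have "\<not> distinct (axes js)" by (auto simp: distinct_map)
        then show ?thesis
          by (intro alternating_form_not_distinct[OF alternating_basis_form]) (use q js in simp_all)
      qed
      ultimately show ?thesis by simp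
    qed
  qed
  then show ?thesis by simp
qed

lemma phi0_dual_vol7:
  assumes ws: "length ws = 4"
  shows "phi0_dual ws = vol7 (axes [1,2,3] @ ws) + vol7 (axes [1,4,5] @ ws) + vol7 (axes [1,6,7] @ ws)
    + vol7 (axes [2,4,6] @ ws) - vol7 (axes [2,5,7] @ ws) - vol7 (axes [3,4,7] @ ws) - vol7 (axes [3,5,6] @ ws)"
proof -
  note v = vol7_line[OF _ _ _ _ ws]
  have "vol7 (axes [1,2,3] @ ws) = basis_form [4,5,6,7] ws"
    by (rule v) simp_all
  moreover have "vol7 (axes [1,4,5] @ ws) = basis_form [2,3,6,7] ws"
    by (rule v) simp_all
  moreover have "vol7 (axes [1,6,7] @ ws) = basis_form [2,3,4,5] ws"
    by (rule v) simp_all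
  moreover have "vol7 (axes [2,4,6] @ ws) = basis_form [1,3,5,7] ws"
    by (rule v) simp_all
  moreover have "vol7 (axes [2,5,7] @ ws) = basis_form [1,3,4,6] ws"
    by (rule v) simp_all
  moreover have "vol7 (axes [3,4,7] @ ws) = basis_form [1,2,5,6] ws"
    by (rule v) simp_all
  moreover have "vol7 (axes [3,5,6] @ ws) = basis_form [1,2,4,7] ws"
    by (rule v) simp_all
  ultimately show ?thesis by (simp only: phi0_dual_def)
qed

text \<open>Up to the factor \<open>3!\<close> the left side is the definition of the Hodge dual of \<open>phi0\<close> in the standard basis.\<close>

lemma phi0_vol7_pairing:
  assumes ws: "length ws = 4"
  shows "(\<Sum>is\<in>multi_indices 3. phi0 (axes is) * vol7 (axes is @ ws)) = 6 * phi0_dual ws"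
proof -
  have \<gamma>: "alternating_form 3 (\<lambda>us. vol7 (us @ ws))"
    by (rule alternating_append[of _ 4]) (use alternating_vol7 ws in simp_all)
  have "(\<Sum>is\<in>multi_indices 3. basis_form t (axes is) * vol7 (axes is @ ws)) = 6 * vol7 (axes t @ ws)"
    if "length t = 3" for t :: "7 list"
    using basis_form_pairing[OF that \<gamma>] by (simp add: fact_numeral)
  then show ?thesis
    unfolding phi0_def phi0_dual_vol7[OF ws]
    by (simp add: distrib_right left_diff_distrib sum.distrib sum_subtractf del: list.map)
qed

lemma linear_cross7_left: "linear (\<lambda>u. cross7 u v)"
proof (rule linearI)
  have lin: "linear (\<lambda>a. phi0 [a, v, b])" for b
    using alternating_form_linear_slot[OF alternating_phi0, of "[]" "[v, b]"] by simp
  show "cross7 (a + a') v = cross7 a v + cross7 a' v" "cross7 (r *\<^sub>R a) v = r *\<^sub>R cross7 a v" for a a' r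
    by (simp_all add: cross7_def vec_eq_iff linear_add[OF lin] linear_scale[OF lin])
qed

lemma cross7_nth:
  "cross7 u v $ 1 = u$2 * v$3 - u$3 * v$2 + u$4 * v$5 - u$5 * v$4 + u$6 * v$7 - u$7 * v$6"
  "cross7 u v $ 2 = u$3 * v$1 - u$1 * v$3 + u$4 * v$6 - u$6 * v$4 + u$7 * v$5 - u$5 * v$7"
  "cross7 u v $ 3 = u$1 * v$2 - u$2 * v$1 + u$7 * v$4 - u$4 * v$7 + u$6 * v$5 - u$5 * v$6"
  "cross7 u v $ 4 = u$5 * v$1 - u$1 * v$5 + u$6 * v$2 - u$2 * v$6 + u$3 * v$7 - u$7 * v$3"
  "cross7 u v $ 5 = u$1 * v$4 - u$4 * v$1 + u$2 * v$7 - u$7 * v$2 + u$3 * v$6 - u$6 * v$3"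
  "cross7 u v $ 6 = u$7 * v$1 - u$1 * v$7 + u$2 * v$4 - u$4 * v$2 + u$5 * v$3 - u$3 * v$5"
  "cross7 u v $ 7 = u$1 * v$6 - u$6 * v$1 + u$5 * v$2 - u$2 * v$5 + u$4 * v$3 - u$3 * v$4"
  by (simp_all add: cross7_def phi0_def basis_form_3 axis_def)

text \<open>This formula uses only the inner product and the cross product, not the orientation, and for this reason it
  decides the orientation question in \<open>stabilizer_preserves_vol7\<close>.\<close>

lemma phi0_dual_cross7:
  "phi0_dual [a, b, c, d] = cross7 a b \<bullet> cross7 c d - (a \<bullet> c) * (b \<bullet> d) + (a \<bullet> d) * (b \<bullet> c)"
proof (rule linear_eq_on_axes[where x = d])
  show "linear (\<lambda>d. phi0_dual [a, b, c, d])"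
    using alternating_form_linear_slot[OF alternating_phi0_dual, of "[a, b, c]" "[]"] by simp
  show "linear (\<lambda>d. cross7 a b \<bullet> cross7 c d - (a \<bullet> c) * (b \<bullet> d) + (a \<bullet> d) * (b \<bullet> c))" for c
    by (rule linearI) (simp_all add: linear_add[OF linear_cross7] linear_scale[OF linear_cross7]
      inner_right_distrib algebra_simps)
  fix j
  show "phi0_dual [a, b, c, axis j 1] = cross7 a b \<bullet> cross7 c (axis j 1)
    - (a \<bullet> c) * (b \<bullet> axis j 1) + (a \<bullet> axis j 1) * (b \<bullet> c)"
  proof (rule linear_eq_on_axes[where x = c])
    show "linear (\<lambda>c. phi0_dual [a, b, c, axis j 1])"
      using alternating_form_linear_slot[OF alternating_phi0_dual, of "[a, b]" "[axis j 1]"] by simp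
    show "linear (\<lambda>c. cross7 a b \<bullet> cross7 c (axis j 1)
      - (a \<bullet> c) * (b \<bullet> axis j 1) + (a \<bullet> axis j 1) * (b \<bullet> c))"
      by (rule linearI) (simp_all add: linear_add[OF linear_cross7_left] linear_scale[OF linear_cross7_left]
        inner_right_distrib algebra_simps)
    fix i
    have "\<forall>i j. phi0_dual [a, b, axis i 1, axis j 1] = cross7 a b \<bullet> cross7 (axis i 1) (axis j 1)
      - (a \<bullet> axis i 1) * (b \<bullet> axis j 1) + (a \<bullet> axis j 1) * (b \<bullet> axis i 1)"
      unfolding forall_7
      by (simp add: phi0_dual_def basis_form_Cons4 basis_form_3 inner_vec_def sum_7 cross7_nth axis_def)
    then show "phi0_dual [a, b, axis i 1, axis j 1] = cross7 a b \<bullet> cross7 (axis i 1) (axis j 1)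
      - (a \<bullet> axis i 1) * (b \<bullet> axis j 1) + (a \<bullet> axis j 1) * (b \<bullet> axis i 1)"
      by blast
  qed
qed

lemma vol7_pullback:
  assumes h: "linear h" and len: "length vs = 7"
  shows "vol7 (map h vs) = vol7 (map h (axes indices7)) * vol7 vs"
proof -
  let ?d = "vol7 (map h (axes indices7))"
  have "vol7 (map h vs) - ?d * vol7 vs = 0"
  proof (rule alternating_form_eq_zero[of 7 "\<lambda>vs. vol7 (map h vs) - ?d * vol7 vs" indices7])
    show "alternating_form 7 (\<lambda>vs. vol7 (map h vs) - ?d * vol7 vs)"
      by (intro alternating_form_diff alternating_form_pullback alternating_form_cmult alternating_vol7 h)
    fix "is" assume "is \<in> set (sublists_of_length 7 indices7)"
    then have is_eq: "is = indices7" using sublists_of_length_self[of indices7] by simp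
    have "vol7 (axes indices7) = 1" using basis_form_axes[of indices7 indices7] basis_sign_self by simp
    then show "vol7 (map h (axes is)) - ?d * vol7 (axes is) = 0" unfolding is_eq by simp
  qed (use len in \<open>simp_all add: UNIV_7\<close>)
  then show ?thesis by simp
qed

text \<open>Let \<open>d\<close> be the factor by which \<open>h\<close> changes the volume form. The pairing \<open>phi0_vol7_pairing\<close> shows that \<open>h\<close> multiplies
  \<open>*\<phi>\<^sub>0\<close> by \<open>d\<close>; but \<open>h\<close> preserves the cross product and hence, by \<open>phi0_dual_cross7\<close>, also \<open>*\<phi>\<^sub>0\<close>.\<close>

lemma stabilizer_preserves_vol7:
  assumes h: "linear h" and \<phi>: "\<And>vs. length vs = 3 \<Longrightarrow> phi0 (map h vs) = phi0 vs"
    and isom: "\<And>u v. h u \<bullet> h v = u \<bullet> v" and len: "length vs = 7"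
  shows "vol7 (map h vs) = vol7 vs"
proof -
  define d where "d = vol7 (map h (axes indices7))"
  let ?e = "\<lambda>i. h (axis i 1)"
  have e: "orthonormal ?e" by (simp add: orthonormal_def isom inner_axis_axis)
  have "inj h" using h isom by (metis inner_eq_zero_iff linear_injective_0)
  then have surj: "surj h" using h linear_injective_imp_surjective by blast
  have cross: "cross7 (h u) (h v) = h (cross7 u v)" for u v
  proof (rule vector_eq_rdot[THEN iffD1], rule allI)
    fix y
    obtain w where y: "y = h w" using surj by (metis surjD)
    show "cross7 (h u) (h v) \<bullet> y = h (cross7 u v) \<bullet> y"
      using \<phi>[of "[u, v, w]"] by (simp add: y isom phi0_cross7)
  qed
  define q where "q = (axes [4,5,6,7] :: (real^7) list)"
  have lq: "length q = 4" by (simp add: q_def)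
  have dual: "phi0_dual (map h q) = phi0_dual q"
    by (simp add: q_def phi0_dual_cross7 cross isom)
  have \<gamma>: "alternating_form 3 (\<lambda>us. vol7 (us @ map h q))"
    by (rule alternating_append[of _ 4]) (use alternating_vol7 lq in simp_all)
  have "6 * phi0_dual (map h q) = (\<Sum>is\<in>multi_indices 3. phi0 (axes is) * vol7 (axes is @ map h q))"
    by (rule phi0_vol7_pairing[symmetric]) (simp add: lq)
  also have "\<dots> = (\<Sum>is\<in>multi_indices 3. phi0 (map ?e is) * vol7 (map ?e is @ map h q))"
    by (rule pairing_orthonormal[OF e alternating_phi0 \<gamma>, symmetric])
  also have "\<dots> = (\<Sum>is\<in>multi_indices 3. d * (phi0 (axes is) * vol7 (axes is @ q)))"
  proof (rule sum.cong[OF refl])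
    fix "is" :: "7 list" assume "is \<in> multi_indices 3"
    then have len: "length is = 3" by simp
    have "phi0 (map ?e is) = phi0 (axes is)" using \<phi>[of "axes is"] len by (simp add: o_def)
    moreover have "vol7 (map ?e is @ map h q) = d * vol7 (axes is @ q)"
      using vol7_pullback[OF h, of "axes is @ q"] len lq by (simp add: o_def d_def)
    ultimately show "phi0 (map ?e is) * vol7 (map ?e is @ map h q) = d * (phi0 (axes is) * vol7 (axes is @ q))"
      by simp
  qed
  also have "\<dots> = d * (6 * phi0_dual q)"
    using phi0_vol7_pairing[OF lq] by (simp add: sum_distrib_left[symmetric])
  finally have "phi0_dual q = d * phi0_dual q" by (simp add: dual)
  moreover have "phi0_dual q = 1" by (simp add: q_def phi0_dual_axes del: list.map)
  ultimately have "d = 1" by simp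
  then show ?thesis using vol7_pullback[OF h len] by (simp add: d_def)
qed

lemma g2_volume_eq:
  assumes f: "adapted 3 phi0 (\<phi> p) f" and len: "length vs = 7"
  shows "g2_volume \<phi> p vs = vol7 (map f vs)"
  unfolding g2_volume_def
proof (rule the_equality)
  have same: "vol7 (map f' vs) = vol7 (map f vs)" if f': "adapted 3 phi0 (\<phi> p) f'" for f'
  proof -
    let ?h = "f' \<circ> inv f"
    have inv: "linear (inv f)" "\<And>v. f (inv f v) = v" "\<And>v. inv f (f v) = v"
      using adapted_linear[OF f] adapted_bij[OF f] inj_linear_imp_inv_linear[of f]
      by (simp_all add: bij_is_inj bij_is_surj surj_f_inv_f)
    have "vol7 (map ?h (map f vs)) = vol7 (map f vs)"
    proof (rule stabilizer_preserves_vol7)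
      show "linear ?h" using inv(1) adapted_linear[OF f'] by (rule linear_compose)
      show "?h u \<bullet> ?h v = u \<bullet> v" for u v using g2_inner_unique[OF f' f] inv by simp
      fix ws :: "(real^7) list" assume ws: "length ws = 3"
      have "phi0 (map f' (map (inv f) ws)) = \<phi> p (map (inv f) ws)" using f' ws by (simp add: adapted_def del: map_map)
      also have "\<dots> = phi0 (map f (map (inv f) ws))" using f ws by (simp add: adapted_def del: map_map)
      finally show "phi0 (map ?h ws) = phi0 ws" by (simp add: o_def inv)
    qed (use len in simp)
    then show ?thesis by (simp add: o_def inv)
  qed
  show "\<forall>f'. adapted 3 phi0 (\<phi> p) f' \<longrightarrow> vol7 (map f vs) = vol7 (map f' vs)" using same by metis
  show "r = vol7 (map f vs)" if "\<forall>f. adapted 3 phi0 (\<phi> p) f \<longrightarrow> r = vol7 (map f vs)" for r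
    using that f by blast
qed

lemma covector_wedge_adapted:
  assumes f: "adapted k \<alpha>\<^sub>0 \<alpha> f" and len: "length vs = Suc k"
  shows "covector_wedge (\<lambda>v. \<xi> (f v)) \<alpha> vs = covector_wedge \<xi> \<alpha>\<^sub>0 (map f vs)"
  using f len by (auto simp: covector_wedge_def adapted_def omit_map intro!: sum.cong)

lemma some_basis_adapted:
  assumes g: "\<And>u v. g u v = f u \<bullet> f v" and f: "bij f"
  shows "orthonormal (\<lambda>i. f (some_basis g i))"
proof -
  have "orthonormal_basis g (\<lambda>i. inv f (axis i 1))"
    using f by (simp add: orthonormal_basis_def g inner_axis_axis bij_is_surj surj_f_inv_f)
  then have "orthonormal_basis g (some_basis g)" unfolding some_basis_def by (rule someI[of "orthonormal_basis g"])
  then show ?thesis by (simp add: orthonormal_basis_def orthonormal_def g)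
qed

text \<open>In an orthonormal frame, the sum over \<open>k\<close> of \<open>e\<^sup>k(X) *(e\<^sup>k \<and> \<phi>)\<close> is \<open>*(X \<and> \<phi>)\<close> by Parseval. The adjointness of wedging
  and contracting turns this into a contraction of \<open>\<phi>\<close> with the volume form in which \<open>X\<close> stands before the three
  contracted vectors; in \<open>*\<phi>\<close> it stands behind them, which accounts for the sign \<open>(- 1)\<^sup>3\<close>.\<close>

lemma g2_generator_eq:
  assumes f: "adapted 3 phi0 (\<phi> p) f" and len: "length vs = 3"
  shows "g2_generator \<phi> p X vs = - phi0_dual (f X # map f vs)"
proof -
  define e where "e = some_basis (g2_metric \<phi> p)"
  define h where "h i = f (e i)" for i
  define Y ws where "Y = f X" and "ws = map f vs"
  have ws: "length ws = 3" using len by (simp add: ws_def)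
  have g: "g2_metric \<phi> p u v = f u \<bullet> f v" for u v
    unfolding g2_metric_def by (rule rigid_form.assoc_metric_eq[OF rigid_form_phi0, where \<omega> = \<phi> and p = p, OF f])
  have h: "orthonormal h"
    unfolding h_def e_def by (rule some_basis_adapted[OF g adapted_bij[OF f]])
  let ?w = "\<lambda>Z is. covector_wedge (\<lambda>v. Z \<bullet> v) phi0 (map h is)" and ?vol = "\<lambda>is. vol7 (map h is @ ws)"
  have star: "g2_star \<phi> p 4 (covector_wedge (g2_metric \<phi> p (e k)) (\<phi> p)) vs =
      (\<Sum>is\<in>multi_indices 4. ?w (h k) is * ?vol is) / 24" for k
  proof -
    have "covector_wedge (g2_metric \<phi> p (e k)) (\<phi> p) (map e is) * g2_volume \<phi> p (map e is @ vs) = ?w (h k) is * ?vol is"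
      if "length is = 4" for "is"
    proof -
      have "g2_metric \<phi> p (e k) = (\<lambda>v. h k \<bullet> f v)" by (simp add: g h_def fun_eq_iff)
      moreover have "f \<circ> e = h" by (simp add: h_def fun_eq_iff)
      ultimately show ?thesis
        using covector_wedge_adapted[OF f, of "map e is" "\<lambda>v. h k \<bullet> v"]
          g2_volume_eq[where \<phi> = \<phi> and p = p, OF f, of "map e is @ vs"] that len by (simp add: ws_def)
    qed
    then show ?thesis unfolding g2_star_def hodge_star_def e_def by (simp add: fact_numeral)
  qed
  have Parseval: "(\<Sum>k\<in>UNIV. (h k \<bullet> Y) * (h k \<bullet> v)) = Y \<bullet> v" for v
  proof -
    have "Y \<bullet> v = (\<Sum>k\<in>UNIV. (h k \<bullet> Y) *\<^sub>R h k) \<bullet> v" by (simp add: orthonormal_expand[OF h])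
    then show ?thesis by (simp add: inner_sum_left)
  qed
  have wedge: "(\<Sum>k\<in>UNIV. (h k \<bullet> Y) * ?w (h k) is) = ?w Y is" for "is"
  proof -
    have "(\<Sum>k\<in>UNIV. (h k \<bullet> Y) * ?w (h k) is) =
        (\<Sum>j<length is. \<Sum>k\<in>UNIV. (-1) ^ j * ((h k \<bullet> Y) * (h k \<bullet> map h is ! j)) * phi0 (omit j (map h is)))"
      unfolding covector_wedge_def sum_distrib_left by (subst sum.swap) (simp add: mult_ac)
    also have "\<dots> = ?w Y is"
      unfolding covector_wedge_def
      by (simp add: Parseval flip: sum_distrib_left sum_distrib_right)
    finally show ?thesis .
  qed
  have vol_lin: "linear (\<lambda>v. vol7 (v # map h is @ ws))" if "length is = 3" for "is"
    using alternating_form_linear_slot[OF alternating_vol7, of "[]" "map h is @ ws"] that ws by simp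
  have \<gamma>: "alternating_form (Suc 3) (\<lambda>us. vol7 (us @ ws))"
    by (rule alternating_append[of _ 3]) (use alternating_vol7 ws in simp_all)
  have \<gamma>': "alternating_form 3 (\<lambda>us. vol7 (us @ Y # ws))"
    by (rule alternating_append[of _ 4]) (use alternating_vol7 ws in simp_all)
  \<comment> \<open>Here \<open>24 = 4!\<close> is the normalisation of the star of a four-form; the pairing below contributes \<open>4 \<sqdot> 3!\<close>.\<close>
  have "g2_generator \<phi> p X vs = (\<Sum>k\<in>UNIV. (h k \<bullet> Y) * ((\<Sum>is\<in>multi_indices 4. ?w (h k) is * ?vol is) / 24))"
    unfolding g2_generator_def Let_def by (simp add: star[unfolded e_def] g h_def e_def Y_def)
  also have "\<dots> = (\<Sum>k\<in>UNIV. \<Sum>is\<in>multi_indices 4. ((h k \<bullet> Y) * ?w (h k) is) * ?vol is) / 24"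
    by (simp add: sum_distrib_left sum_divide_distrib mult_ac)
  also have "(\<Sum>k\<in>UNIV. \<Sum>is\<in>multi_indices 4. ((h k \<bullet> Y) * ?w (h k) is) * ?vol is) =
      (\<Sum>is\<in>multi_indices 4. ?w Y is * ?vol is)"
    by (subst sum.swap) (simp add: wedge flip: sum_distrib_right)
  also have "\<dots> = 4 * (\<Sum>i\<in>UNIV. \<Sum>is\<in>multi_indices 3. (Y \<bullet> h i) * phi0 (map h is) * vol7 (h i # map h is @ ws))"
    using wedge_pairing[OF \<gamma>, of "\<lambda>v. Y \<bullet> v" phi0 h] by simp
  also have "(\<Sum>i\<in>UNIV. \<Sum>is\<in>multi_indices 3. (Y \<bullet> h i) * phi0 (map h is) * vol7 (h i # map h is @ ws)) =
      (\<Sum>is\<in>multi_indices 3. phi0 (map h is) * (\<Sum>i\<in>UNIV. (h i \<bullet> Y) * vol7 (h i # map h is @ ws)))"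
    by (subst sum.swap) (simp add: sum_distrib_left mult_ac inner_commute)
  also have "\<dots> = (\<Sum>is\<in>multi_indices 3. - (phi0 (map h is) * vol7 (map h is @ Y # ws)))"
  proof (rule sum.cong[OF refl])
    fix "is" :: "7 list" assume "is \<in> multi_indices 3"
    then have len: "length is = 3" by simp
    have "(\<Sum>i\<in>UNIV. (h i \<bullet> Y) * vol7 (h i # map h is @ ws)) = vol7 ((\<Sum>i\<in>UNIV. (h i \<bullet> Y) *\<^sub>R h i) # map h is @ ws)"
      using linear_sum[OF vol_lin[OF len], of "\<lambda>i. (h i \<bullet> Y) *\<^sub>R h i" UNIV]
      by (simp add: linear_scale[OF vol_lin[OF len]])
    also have "\<dots> = vol7 ([] @ Y # map h is @ ws)" by (simp add: orthonormal_expand[OF h])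
    also have "\<dots> = (-1) ^ length (map h is) * vol7 ([] @ map h is @ Y # ws)"
      by (rule alternating_form_move[OF alternating_vol7]) (use len ws in simp)
    finally have "(\<Sum>i\<in>UNIV. (h i \<bullet> Y) * vol7 (h i # map h is @ ws)) = - vol7 (map h is @ Y # ws)"
      by (simp add: len)
    then show "phi0 (map h is) * (\<Sum>i\<in>UNIV. (h i \<bullet> Y) * vol7 (h i # map h is @ ws)) =
        - (phi0 (map h is) * vol7 (map h is @ Y # ws))" by simp
  qed
  also have "\<dots> = - (\<Sum>is\<in>multi_indices 3. phi0 (axes is) * vol7 (axes is @ Y # ws))"
    using pairing_orthonormal[OF h alternating_phi0 \<gamma>'] by (simp add: sum_negf)
  also have "\<dots> = - (6 * phi0_dual (Y # ws))"
    using phi0_vol7_pairing[of "Y # ws"] ws by simp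
  finally show ?thesis by (simp add: Y_def ws_def)
qed

section \<open>Conformal-Killing structures\<close>

context modelled_manifold
begin

lemma killing_model:
  assumes f: "adapted k \<alpha>\<^sub>0 (\<omega> p) f" and ck: "conformal_killing A g k \<omega>"
    and k: "0 < k" "k \<le> CARD('n)" and \<alpha>\<^sub>0: "alternating_form k \<alpha>\<^sub>0"
    and blocks: "\<And>t. t \<in> set blocks \<Longrightarrow> length t = k \<and> distinct t \<and> (\<alpha>\<^sub>0 (axes t))\<^sup>2 = 1"
    and indices: "set indices = UNIV"
    and cover: "set (sublists_of_length (k - 1) indices) \<subseteq> (\<Union>t\<in>set blocks. (\<lambda>i. omit i t) ` {..<k})"
  shows "conformal_killing_model k \<alpha>\<^sub>0 (\<lambda>u vs. cov_deriv (inv f u) (map (inv f) vs))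
    (\<lambda>vs. codifferential A g \<omega> p (map (inv f) vs)) (1 / (real CARD('n) - real k + 1)) blocks indices"
proof -
  have inv: "linear (inv f)" "\<And>v. f (inv f v) = v" "\<And>v. inv f (f v) = v"
    using adapted_linear[OF f] adapted_bij[OF f] inj_linear_imp_inv_linear[of f]
    by (simp_all add: bij_is_inj bij_is_surj surj_f_inv_f)
  show ?thesis
  proof (rule conformal_killing_model.intro)
    show "1 / (real CARD('n) - real k + 1) \<noteq> 0" using k by simp
    show "alternating_form k (\<lambda>vs. cov_deriv (inv f u) (map (inv f) vs))" for u
      by (rule alternating_form_pullback[OF alternating_cov_deriv inv(1)])
    show "linear (\<lambda>u. cov_deriv (inv f u) (map (inv f) vs))" if "length vs = k" for vs
      using linear_compose[OF inv(1) linear_cov_deriv, of "map (inv f) vs"] that by (simp add: o_def)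
    show "cov_deriv (inv f u) (map (inv f) vs) = 0"
      if "length vs = k" "(\<alpha>\<^sub>0 vs)\<^sup>2 = (\<Prod>i<k. vs ! i \<bullet> vs ! i)" "\<alpha>\<^sub>0 vs \<noteq> 0" for u vs
      by (rule nabla_calibrated_frame[OF f]) (use that in \<open>simp_all add: inv o_def\<close>)
    show "alternating_form (k - 1) (\<lambda>vs. codifferential A g \<omega> p (map (inv f) vs))"
    proof (rule alternating_form_pullback[OF _ inv(1)])
      obtain m where m: "k = Suc m" using k by (cases k) auto
      have "alternating_form (k - 1) (\<lambda>vs. (-1) * (\<Sum>i\<in>UNIV. contract (some_basis (g p) i) (cov_deriv (some_basis (g p) i)) vs))"
        by (intro alternating_form_cmult alternating_form_sum alternating_contract finite)
          (use alternating_cov_deriv m in simp)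
      then show "alternating_form (k - 1) (codifferential A g \<omega> p)"
        by (simp add: codifferential_def[abs_def] Let_def)
    qed
    show "cov_deriv (inv f u) (map (inv f) vs) =
        1 / (real k + 1) * (\<Sum>i<Suc k. (-1) ^ i * cov_deriv (inv f ((u # vs) ! i)) (map (inv f) (omit i (u # vs))))
        - 1 / (real CARD('n) - real k + 1) * covector_wedge (\<lambda>w. u \<bullet> w) (\<lambda>vs. codifferential A g \<omega> p (map (inv f) vs)) vs"
      if len: "length vs = k" for u vs
    proof -
      let ?X = "inv f u" and ?vs = "map (inv f) vs"
      have "ext_deriv A \<omega> p (map (inv f) (u # vs)) =
          (\<Sum>i<Suc k. (-1) ^ i * cov_deriv (map (inv f) (u # vs) ! i) (omit i (map (inv f) (u # vs))))"
        by (rule ext_deriv_eq) (simp add: len)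
      also have "\<dots> = (\<Sum>i<Suc k. (-1) ^ i * cov_deriv (inv f ((u # vs) ! i)) (map (inv f) (omit i (u # vs))))"
        by (intro sum.cong refl) (simp add: omit_map len del: list.map)
      finally have "contract ?X (ext_deriv A \<omega> p) ?vs =
          (\<Sum>i<Suc k. (-1) ^ i * cov_deriv (inv f ((u # vs) ! i)) (map (inv f) (omit i (u # vs))))"
        by (simp add: contract_def)
      moreover have "covector_wedge (g p ?X) (codifferential A g \<omega> p) ?vs =
          covector_wedge (\<lambda>w. u \<bullet> w) (\<lambda>vs. codifferential A g \<omega> p (map (inv f) vs)) vs"
        unfolding covector_wedge_def
        by (auto simp: assoc_metric_eq[where \<omega> = \<omega> and p = p, OF f] inv omit_map intro!: sum.cong)
      moreover have "cov_deriv ?X ?vs = 1 / (real k + 1) * contract ?X (ext_deriv A \<omega> p) ?vs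
          - 1 / (real CARD('n) - real k + 1) * covector_wedge (g p ?X) (codifferential A g \<omega> p) ?vs"
        by (rule ck[unfolded conformal_killing_def, rule_format, OF p]) (simp add: len)
      ultimately show ?thesis by simp
    qed
  qed (fact | use k in simp)+
qed

end

text \<open>For the converse, \<open>T\<^sub>X\<close> is a multiple of \<open>i\<^sub>X *\<phi>\<close>, so all four terms of \<open>d\<phi>(X, v)\<close> equal \<open>T\<^sub>X(v)\<close> and the codifferential, a trace
  of a form with a repeated argument, is zero.\<close>

lemma g2_conformal_killing_iff:
  fixes A :: "('a, 7) chart set"
  assumes M: "smooth_manifold X A" and \<phi>: "g2_structure A \<phi>"
  shows "conformal_killing A (g2_metric \<phi>) 3 \<phi> \<longleftrightarrow> nearly_parallel_g2 A \<phi>"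
proof
  have mm: "modelled_manifold 3 phi0 X A \<phi> p" if "p \<in> points A" for p
    using rigid_form_phi0 M \<phi> that
    by (simp add: modelled_manifold_def modelled_manifold_axioms_def g2_structure_def)
  have frame: "\<exists>f. adapted 3 phi0 (\<phi> p) f" if "p \<in> points A" for p
    using \<phi> that by (simp add: g2_structure_def modelled_on_def)
  {
    assume ck: "conformal_killing A (g2_metric \<phi>) 3 \<phi>"
    show "nearly_parallel_g2 A \<phi>"
      unfolding nearly_parallel_g2_def
    proof
      fix p assume p: "p \<in> points A"
      interpret modelled_manifold 3 phi0 X A \<phi> p by (rule mm[OF p])
      obtain f where f: "adapted 3 phi0 (\<phi> p) f" using frame[OF p] by blast
      have inv: "inv f (f v) = v" for v using adapted_bij[OF f] by (simp add: bij_is_inj)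
      have "conformal_killing_model 3 phi0 (\<lambda>u vs. cov_deriv (inv f u) (map (inv f) vs))
          (\<lambda>vs. codifferential A g \<phi> p (map (inv f) vs)) (1 / (real CARD(7) - real 3 + 1)) fano_lines indices7"
      proof (rule killing_model[OF f _ _ _ alternating_phi0 phi0_lines _ fano_lines_cover])
        show "conformal_killing A g 3 \<phi>" using ck by (simp only: g2_metric_def)
        show "set indices7 = UNIV" using UNIV_7 by simp
      qed simp_all
      then obtain c where c: "\<And>u vs. length vs = 3 \<Longrightarrow> cov_deriv (inv f u) (map (inv f) vs) = c * phi0_dual (u # vs)"
        using g2_killing_model by blast
      have "nabla A (g2_metric \<phi>) \<phi> p Y vs = - c * g2_generator \<phi> p Y vs" if "length vs = 3" for Y vs
        using c[of "map f vs" "f Y"] that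
        by (simp add: g2_metric_def g2_generator_eq[where \<phi> = \<phi> and p = p, OF f] inv o_def)
      then show "\<exists>r. \<forall>X vs. length vs = 3 \<longrightarrow> nabla A (g2_metric \<phi>) \<phi> p X vs = r * g2_generator \<phi> p X vs"
        by blast
    qed
  next
    assume np: "nearly_parallel_g2 A \<phi>"
    show "conformal_killing A (g2_metric \<phi>) 3 \<phi>"
      unfolding conformal_killing_def
    proof (intro ballI allI impI)
      fix p Y and vs :: "(real^7) list" assume p: "p \<in> points A" and len: "length vs = 3"
      interpret modelled_manifold 3 phi0 X A \<phi> p by (rule mm[OF p])
      obtain f where f: "adapted 3 phi0 (\<phi> p) f" using frame[OF p] by blast
      obtain r where r: "\<And>Y vs. length vs = 3 \<Longrightarrow> cov_deriv Y vs = r * g2_generator \<phi> p Y vs"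
        using np p unfolding nearly_parallel_g2_def g2_metric_def by blast
      have D: "cov_deriv Y vs = - r * phi0_dual (map f (Y # vs))" if "length vs = 3" for Y vs
        using r[OF that] by (simp add: g2_generator_eq[where \<phi> = \<phi> and p = p, OF f that])
      have "ext_deriv A \<phi> p (Y # vs) = (\<Sum>i<Suc 3. (-1) ^ i * cov_deriv ((Y # vs) ! i) (omit i (Y # vs)))"
        by (rule ext_deriv_eq) (simp add: len)
      also have "\<dots> = (\<Sum>i<Suc 3. cov_deriv Y vs)"
      proof (rule sum.cong[OF refl])
        fix i assume i: "i \<in> {..<Suc 3}"
        have "phi0_dual (map f (Y # vs) ! i # omit i (map f (Y # vs))) = (-1) ^ i * phi0_dual (map f (Y # vs))"
          by (rule alternating_form_pull_front[of 3]) (use i len alternating_phi0_dual in simp_all)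
        then have "phi0_dual (map f ((Y # vs) ! i # omit i (Y # vs))) = (-1) ^ i * phi0_dual (map f (Y # vs))"
          using i len by (simp add: omit_map nth_Cons' flip: list.map)
        then show "(-1) ^ i * cov_deriv ((Y # vs) ! i) (omit i (Y # vs)) = cov_deriv Y vs"
          using i len D[of "omit i (Y # vs)" "(Y # vs) ! i"] D[of vs Y]
          by (simp del: list.map)
      qed
      finally have ext: "contract Y (ext_deriv A \<phi> p) vs = 4 * cov_deriv Y vs" by (simp add: contract_def)
      have codiff: "codifferential A g \<phi> p ws = 0" if "length ws = 2" for ws
      proof -
        have "cov_deriv e (e # ws) = 0" for e
          using D[of "e # ws" e] alternating_form_not_distinct[OF alternating_phi0_dual, of "map f (e # e # ws)"] that
          by simp
        then show ?thesis by (simp add: codifferential_def contract_def Let_def)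
      qed
      have "covector_wedge (g p Y) (codifferential A g \<phi> p) vs = 0"
        unfolding covector_wedge_def by (intro sum.neutral) (use len codiff in simp)
      then show "nabla A (g2_metric \<phi>) \<phi> p Y vs =
          1 / (real 3 + 1) * contract Y (ext_deriv A \<phi> p) vs
          - 1 / (real CARD(7) - real 3 + 1) * covector_wedge (g2_metric \<phi> p Y) (codifferential A (g2_metric \<phi>) \<phi> p) vs"
        using ext by (simp add: g2_metric_def)
    qed
  }
qed

lemma spin7_conformal_killing_iff:
  fixes A :: "('a, 8) chart set"
  assumes M: "smooth_manifold X A" and \<psi>: "spin7_structure A \<psi>"
  shows "conformal_killing A (spin7_metric \<psi>) 4 \<psi> \<longleftrightarrow> parallel_spin7 A \<psi>"
proof
  have mm: "modelled_manifold 4 psi0 X A \<psi> p" if "p \<in> points A" for p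
    using rigid_form_psi0 M \<psi> that
    by (simp add: modelled_manifold_def modelled_manifold_axioms_def spin7_structure_def)
  {
    assume ck: "conformal_killing A (spin7_metric \<psi>) 4 \<psi>"
    show "parallel_spin7 A \<psi>"
      unfolding parallel_spin7_def
    proof (intro ballI allI impI)
      fix p Y and vs :: "(real^8) list" assume p: "p \<in> points A" and len: "length vs = 4"
      interpret modelled_manifold 4 psi0 X A \<psi> p by (rule mm[OF p])
      obtain f where f: "adapted 4 psi0 (\<psi> p) f"
        using \<psi> p by (auto simp: spin7_structure_def modelled_on_def)
      have "conformal_killing_model 4 psi0 (\<lambda>u vs. cov_deriv (inv f u) (map (inv f) vs))
          (\<lambda>vs. codifferential A g \<psi> p (map (inv f) vs)) (1 / (real CARD(8) - real 4 + 1)) cayley_quads indices8"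
      proof (rule killing_model[OF f _ _ _ alternating_psi0 psi0_quads _ cayley_quads_cover])
        show "conformal_killing A g 4 \<psi>" using ck by (simp only: spin7_metric_def)
        show "set indices8 = UNIV" using UNIV_8 by simp
      qed simp_all
      then have "cov_deriv (inv f (f Y)) (map (inv f) (map f vs)) = 0"
        by (rule spin7_killing_model) (simp add: len)
      then show "nabla A (spin7_metric \<psi>) \<psi> p Y vs = 0"
        using adapted_bij[OF f] by (simp add: spin7_metric_def bij_is_inj o_def)
    qed
  next
    assume par: "parallel_spin7 A \<psi>"
    show "conformal_killing A (spin7_metric \<psi>) 4 \<psi>"
      unfolding conformal_killing_def
    proof (intro ballI allI impI)
      fix p Y and vs :: "(real^8) list" assume p: "p \<in> points A" and len: "length vs = 4"
      interpret modelled_manifold 4 psi0 X A \<psi> p by (rule mm[OF p])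
      have D: "cov_deriv Y vs = 0" if "length vs = 4" for Y vs
        using par p that by (simp add: parallel_spin7_def spin7_metric_def)
      have "ext_deriv A \<psi> p (Y # vs) = 0"
        using ext_deriv_eq[of "Y # vs"] len D by simp
      moreover have "codifferential A g \<psi> p ws = 0" if "length ws = 3" for ws
        using D that by (simp add: codifferential_def contract_def Let_def)
      then have "covector_wedge (g p Y) (codifferential A g \<psi> p) vs = 0"
        unfolding covector_wedge_def by (intro sum.neutral) (use len in simp)
      ultimately show "nabla A (spin7_metric \<psi>) \<psi> p Y vs =
          1 / (real 4 + 1) * contract Y (ext_deriv A \<psi> p) vs
          - 1 / (real CARD(8) - real 4 + 1) * covector_wedge (spin7_metric \<psi> p Y) (codifferential A (spin7_metric \<psi>) \<psi> p) vs"
        using D[OF len] by (simp add: spin7_metric_def contract_def)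
    qed
  }
qed

theorem theorem1:
  shows "(\<forall>(X :: 'a topology) (A :: ('a, 7) chart set) \<phi>.
            smooth_manifold X A \<and> g2_structure A \<phi> \<longrightarrow>
            (conformal_killing A (g2_metric \<phi>) 3 \<phi> \<longleftrightarrow> nearly_parallel_g2 A \<phi>))
       \<and> (\<forall>(X :: 'b topology) (A :: ('b, 8) chart set) \<psi>.
            smooth_manifold X A \<and> spin7_structure A \<psi> \<longrightarrow>
            (conformal_killing A (spin7_metric \<psi>) 4 \<psi> \<longleftrightarrow> parallel_spin7 A \<psi>))"
  using g2_conformal_killing_iff spin7_conformal_killing_iff by blast

end
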